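(* Let $\mathcal{G}_{net}$ be a strongly connected directed network on $m$ sensors $y_1,\dots,y_m$ with positive link costs $b_{ij}$. Consider the networking cost optimization problem $$\min_{\mathcal{W}\in\{0,1\}^{m\times m}}\ \sum_{i=1}^m\sum_{j=1}^m b_{ij}\mathcal{W}_{ij}\quad\text{s.t. }\mathcal{G}_W\subset\mathcal{G}_{net},\quad \mathcal{G}_W\text{ is strongly connected and spans all } m \text{ sensors}.$$ Fix any root node of $\mathcal{G}_{net}$, and let $\mathcal{G}_W$ be the union of a minimum-cost spanning in-branching and a minimum-cost spanning out-branching of $\mathcal{G}_{net}$ at this root. Then $\mathcal{G}_W$ is feasible for the problem, its cost is at most twice the optimal value, and it can be computed in $\mathcal{O}(m^2)$ operations. That is, the problem admits a 2-approximation algorithm with complexity $\mathcal{O}(m^2)$.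
   Context: $\mathcal{G}_{net}$ represents all possible communication links among the sensors, and $b_{ij}$ is the cost of the directed communication link from sensor $y_i$ to sensor $y_j$. $\mathcal{G}_W$ is the communication network actually selected; its structure is encoded by the 0-1 matrix $\mathcal{W}$, where $\mathcal{W}_{ij}=1$ means that the link from $y_i$ to $y_j$ is used (which is only allowed if this link is in $\mathcal{G}_{net}$). A digraph is strongly connected if there is a directed path from every node to every other node. A spanning out-branching at a root $r$ is a spanning subdigraph whose underlying graph is a tree and in which there is a directed path from $r$ to every node. A spanning in-branching at $r$ is a spanning subdigraph whose underlying graph is a tree and in which there is a directed path from every node to $r$. The cost of a subdigraph is the sum of the costs of its links. A $\rho$-approximation algorithm is one that finds a feasible solution of cost within a factor $\rho$ of the optimum. *)

theory Defs
  imports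
    Complex_Main
    "HOL-Library.Landau_Symbols"
    "Graph_Theory.Graph_Theory"
    "Jordan_Normal_Form.Matrix"
begin

section \<open>Branchings\<close>

text \<open>
  A cycle of the underlying undirected graph of \<open>T\<close>: pairwise distinct vertices, consecutive ones
  (cyclically) joined by pairwise distinct arcs that may be traversed in either direction. A loop is
  such a cycle of length 1, a pair of antiparallel arcs one of length 2. The notion \<^const>\<open>tree\<close> of
  the digraph library only excludes directed cycles and is therefore too weak here.
\<close>

definition underlying_cycle :: "'a pair_pre_digraph \<Rightarrow> 'a list \<Rightarrow> ('a \<times> 'a) list \<Rightarrow> bool" where
  "underlying_cycle T vs es \<longleftrightarrow>
     vs \<noteq> [] \<and> distinct vs \<and> length es = length vs \<and> distinct es \<and> set es \<subseteq> parcs T \<and>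
     (\<forall>i < length vs. es ! i = (vs ! i, vs ! (Suc i mod length vs)) \<or>
                      es ! i = (vs ! (Suc i mod length vs), vs ! i))"

definition underlying_tree :: "'a pair_pre_digraph \<Rightarrow> bool" where
  "underlying_tree T \<longleftrightarrow> connected (with_proj T) \<and> (\<nexists>vs es. underlying_cycle T vs es)"

definition spanning_out_branching ::
    "'a pair_pre_digraph \<Rightarrow> 'a \<Rightarrow> 'a pair_pre_digraph \<Rightarrow> bool" where
  "spanning_out_branching G r T \<longleftrightarrow>
     spanning (with_proj T) (with_proj G) \<and> underlying_tree T \<and>
     (\<forall>v \<in> pverts G. r \<rightarrow>\<^sup>*\<^bsub>with_proj T\<^esub> v)"

definition spanning_in_branching ::
    "'a pair_pre_digraph \<Rightarrow> 'a \<Rightarrow> 'a pair_pre_digraph \<Rightarrow> bool" where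
  "spanning_in_branching G r T \<longleftrightarrow>
     spanning (with_proj T) (with_proj G) \<and> underlying_tree T \<and>
     (\<forall>v \<in> pverts G. v \<rightarrow>\<^sup>*\<^bsub>with_proj T\<^esub> r)"


section \<open>The networking cost problem\<close>

text \<open>The sensors are numbered \<open>0, \<dots>, m - 1\<close>. Entries of \<open>b\<close> outside the links of \<open>G\<close> are arbitrary.\<close>

definition sensor_network :: "nat \<Rightarrow> nat pair_pre_digraph \<Rightarrow> real mat \<Rightarrow> bool" where
  "sensor_network m G b \<longleftrightarrow>
     pair_wf_digraph G \<and> pverts G = {0..<m} \<and> strongly_connected (with_proj G) \<and>
     b \<in> carrier_mat m m \<and> (\<forall>(i, j) \<in> parcs G. 0 < b $$ (i, j))"

definition subdigraph_cost :: "real mat \<Rightarrow> nat pair_pre_digraph \<Rightarrow> real" where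
  "subdigraph_cost b H = (\<Sum>(i, j) \<in> parcs H. b $$ (i, j))"

definition min_spanning_out_branching ::
    "nat pair_pre_digraph \<Rightarrow> real mat \<Rightarrow> nat \<Rightarrow> nat pair_pre_digraph \<Rightarrow> bool" where
  "min_spanning_out_branching G b r T \<longleftrightarrow>
     is_arg_min (subdigraph_cost b) (spanning_out_branching G r) T"

definition min_spanning_in_branching ::
    "nat pair_pre_digraph \<Rightarrow> real mat \<Rightarrow> nat \<Rightarrow> nat pair_pre_digraph \<Rightarrow> bool" where
  "min_spanning_in_branching G b r T \<longleftrightarrow>
     is_arg_min (subdigraph_cost b) (spanning_in_branching G r) T"

definition zero_one_mat :: "nat \<Rightarrow> nat mat \<Rightarrow> bool" where
  "zero_one_mat m W \<longleftrightarrow> W \<in> carrier_mat m m \<and> elements_mat W \<subseteq> {0, 1}"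

definition network_of :: "nat \<Rightarrow> nat mat \<Rightarrow> nat pair_pre_digraph" where
  "network_of m W =
     \<lparr> pverts = {0..<m}, parcs = {(i, j). i < m \<and> j < m \<and> W $$ (i, j) = 1} \<rparr>"

definition feasible :: "nat \<Rightarrow> nat pair_pre_digraph \<Rightarrow> nat mat \<Rightarrow> bool" where
  "feasible m G W \<longleftrightarrow>
     zero_one_mat m W \<and> spanning (with_proj (network_of m W)) (with_proj G) \<and>
     strongly_connected (with_proj (network_of m W))"

definition networking_cost :: "nat \<Rightarrow> real mat \<Rightarrow> nat mat \<Rightarrow> real" where
  "networking_cost m b W = (\<Sum>i<m. \<Sum>j<m. b $$ (i, j) * real (W $$ (i, j)))"

definition optimal_cost :: "nat \<Rightarrow> nat pair_pre_digraph \<Rightarrow> real mat \<Rightarrow> real" where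
  "optimal_cost m G b = Min (networking_cost m b ` {W. feasible m G W})"

definition min_branching_union ::
    "nat \<Rightarrow> nat pair_pre_digraph \<Rightarrow> real mat \<Rightarrow> nat \<Rightarrow> nat mat \<Rightarrow> bool" where
  "min_branching_union m G b r W \<longleftrightarrow>
     zero_one_mat m W \<and>
     (\<exists>Tin Tout. min_spanning_in_branching G b r Tin \<and> min_spanning_out_branching G b r Tout \<and>
        with_proj (network_of m W) = union (with_proj Tin) (with_proj Tout))"


section \<open>Machine model\<close>

text \<open>
  A unit-cost random access machine with exact real arithmetic, programmed in a structured language.
  The store consists of named one-dimensional arrays of naturals (used for indices and flags) and
  of reals; a scalar variable is cell 0 of an array. Naturals can be added, subtracted (truncated at
  0) and compared, reals can be added, subtracted and compared. Multiplication, rounding and bit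
  operations, with which a unit-cost machine could hide large computations, are absent.
\<close>

record store =
  nats :: "string \<Rightarrow> nat \<Rightarrow> nat"
  reals :: "string \<Rightarrow> nat \<Rightarrow> real"

datatype nexp = NConst nat | NCell string nexp | NAdd nexp nexp | NSub nexp nexp

datatype rexp = RCell string nexp | RAdd rexp rexp | RSub rexp rexp

datatype bexp = NLess nexp nexp | NEq nexp nexp | RLess rexp rexp | BNot bexp | BAnd bexp bexp

datatype com =
    Skip
  | NAssign string nexp nexp
  | RAssign string nexp rexp
  | Seq com com
  | Cond bexp com com
  | While bexp com

primrec nval :: "nexp \<Rightarrow> store \<Rightarrow> nat" where
  "nval (NConst k) s = k"
| "nval (NCell a i) s = nats s a (nval i s)"
| "nval (NAdd x y) s = nval x s + nval y s"
| "nval (NSub x y) s = nval x s - nval y s"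

primrec rval :: "rexp \<Rightarrow> store \<Rightarrow> real" where
  "rval (RCell a i) s = reals s a (nval i s)"
| "rval (RAdd x y) s = rval x s + rval y s"
| "rval (RSub x y) s = rval x s - rval y s"

primrec bval :: "bexp \<Rightarrow> store \<Rightarrow> bool" where
  "bval (NLess x y) s = (nval x s < nval y s)"
| "bval (NEq x y) s = (nval x s = nval y s)"
| "bval (RLess x y) s = (rval x s < rval y s)"
| "bval (BNot c) s = (\<not> bval c s)"
| "bval (BAnd c d) s = (bval c s \<and> bval d s)"

text \<open>Every constant, memory access, arithmetic or logical operation and comparison costs 1.\<close>

primrec ncost :: "nexp \<Rightarrow> nat" where
  "ncost (NConst k) = 1"
| "ncost (NCell a i) = 1 + ncost i"
| "ncost (NAdd x y) = 1 + ncost x + ncost y"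
| "ncost (NSub x y) = 1 + ncost x + ncost y"

primrec rcost :: "rexp \<Rightarrow> nat" where
  "rcost (RCell a i) = 1 + ncost i"
| "rcost (RAdd x y) = 1 + rcost x + rcost y"
| "rcost (RSub x y) = 1 + rcost x + rcost y"

primrec bcost :: "bexp \<Rightarrow> nat" where
  "bcost (NLess x y) = 1 + ncost x + ncost y"
| "bcost (NEq x y) = 1 + ncost x + ncost y"
| "bcost (RLess x y) = 1 + rcost x + rcost y"
| "bcost (BNot c) = 1 + bcost c"
| "bcost (BAnd c d) = 1 + bcost c + bcost d"

definition set_nat :: "string \<Rightarrow> nat \<Rightarrow> nat \<Rightarrow> store \<Rightarrow> store" where
  "set_nat a i v s = s\<lparr> nats := (nats s)(a := (nats s a)(i := v)) \<rparr>"

definition set_real :: "string \<Rightarrow> nat \<Rightarrow> real \<Rightarrow> store \<Rightarrow> store" where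
  "set_real a i v s = s\<lparr> reals := (reals s)(a := (reals s a)(i := v)) \<rparr>"

text \<open>\<open>exec c s t s'\<close>: started in \<open>s\<close>, the program \<open>c\<close> halts in \<open>s'\<close> after exactly \<open>t\<close> operations.\<close>

inductive exec :: "com \<Rightarrow> store \<Rightarrow> nat \<Rightarrow> store \<Rightarrow> bool" where
  Skip: "exec Skip s 1 s"
| NAssign: "exec (NAssign a i x) s (1 + ncost i + ncost x) (set_nat a (nval i s) (nval x s) s)"
| RAssign: "exec (RAssign a i x) s (1 + ncost i + rcost x) (set_real a (nval i s) (rval x s) s)"
| Seq: "exec c s t s' \<Longrightarrow> exec d s' t' s'' \<Longrightarrow> exec (Seq c d) s (t + t') s''"
| CondTrue: "bval e s \<Longrightarrow> exec c s t s' \<Longrightarrow> exec (Cond e c d) s (1 + bcost e + t) s'"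
| CondFalse: "\<not> bval e s \<Longrightarrow> exec d s t s' \<Longrightarrow> exec (Cond e c d) s (1 + bcost e + t) s'"
| WhileFalse: "\<not> bval e s \<Longrightarrow> exec (While e c) s (1 + bcost e) s"
| WhileTrue: "bval e s \<Longrightarrow> exec c s t s' \<Longrightarrow> exec (While e c) s' t' s'' \<Longrightarrow>
    exec (While e c) s (1 + bcost e + t + t') s''"

inductive_cases SkipE: "exec Skip s t s'"
inductive_cases NAssignE: "exec (NAssign a i x) s t s'"
inductive_cases RAssignE: "exec (RAssign a i x) s t s'"
inductive_cases SeqE: "exec (Seq c d) s t s'"
inductive_cases CondE: "exec (Cond e c d) s t s'"
inductive_cases WhileE: "exec (While e c) s t s'"

lemma exec_deterministic:
  "exec c s t s' \<Longrightarrow> exec c s u s'' \<Longrightarrow> t = u \<and> s' = s''"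
proof (induction arbitrary: u s'' rule: exec.induct)
  case (Skip s)
  then show ?case by (elim SkipE) simp
next
  case (NAssign a i x s)
  then show ?case by (elim NAssignE) simp
next
  case (RAssign a i x s)
  then show ?case by (elim RAssignE) simp
next
  case (Seq c s t s' d t' r)
  from Seq.prems show ?case
  proof (rule SeqE)
    fix t1 r1 t2
    assume u: "u = t1 + t2" and "exec c s t1 r1" and d: "exec d r1 t2 s''"
    then have "t = t1 \<and> s' = r1" using Seq.IH(1) by blast
    with d have "t' = t2 \<and> r = s''" using Seq.IH(2) by blast
    with \<open>t = t1 \<and> s' = r1\<close> u show ?thesis by simp
  qed
next
  case (CondTrue e s c t s' d)
  from CondTrue.prems show ?case
    by (rule CondE) (use CondTrue.hyps(1) CondTrue.IH in auto)
next
  case (CondFalse e s d t s' c)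
  from CondFalse.prems show ?case
    by (rule CondE) (use CondFalse.hyps(1) CondFalse.IH in auto)
next
  case (WhileFalse e s c)
  from WhileFalse.prems show ?case
    by (rule WhileE) (use WhileFalse.hyps in simp_all)
next
  case (WhileTrue e s c t s' t' r)
  from WhileTrue.prems show ?case
  proof (rule WhileE)
    assume "\<not> bval e s"
    with WhileTrue.hyps(1) show ?thesis by simp
  next
    fix t1 r1 t2
    assume u: "u = Suc (bcost e + t1 + t2)" and "exec c s t1 r1" and d: "exec (While e c) r1 t2 s''"
    then have "t = t1 \<and> s' = r1" using WhileTrue.IH(1) by blast
    with d have "t' = t2 \<and> r = s''" using WhileTrue.IH(2) by blast
    with \<open>t = t1 \<and> s' = r1\<close> u show ?thesis by simp
  qed
qed


section \<open>Algorithms for the problem\<close>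

text \<open>
  Matrices are passed row by row: entry \<open>(i, j)\<close> is cell \<open>i * m + j\<close>. The input consists of \<open>m\<close>,
  the 0-1 adjacency matrix of the network, the cost matrix and, where required, the root. All other
  cells are initially 0.
\<close>

definition network_input :: "nat \<Rightarrow> nat pair_pre_digraph \<Rightarrow> real mat \<Rightarrow> store" where
  "network_input m G b =
     \<lparr> nats = (\<lambda>a k.
         if a = ''m'' \<and> k = 0 then m
         else if a = ''link'' \<and> k < m * m \<and> (k div m, k mod m) \<in> parcs G then 1
         else 0),
       reals = (\<lambda>a k. if a = ''b'' \<and> k < m * m then b $$ (k div m, k mod m) else 0) \<rparr>"

definition rooted_input :: "nat \<Rightarrow> nat pair_pre_digraph \<Rightarrow> real mat \<Rightarrow> nat \<Rightarrow> store" where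
  "rooted_input m G b r = set_nat ''r'' 0 r (network_input m G b)"

definition output_mat :: "nat \<Rightarrow> store \<Rightarrow> nat mat" where
  "output_mat m s = mat m m (\<lambda>(i, j). nats s ''W'' (i * m + j))"

definition computes_min_branching_union :: "com \<Rightarrow> (nat \<Rightarrow> nat) \<Rightarrow> bool" where
  "computes_min_branching_union P T \<longleftrightarrow>
     (\<forall>m G b r. sensor_network m G b \<longrightarrow> r \<in> pverts G \<longrightarrow>
        (\<exists>t s. exec P (rooted_input m G b r) t s \<and> t \<le> T m \<and>
               min_branching_union m G b r (output_mat m s)))"

definition approximation_algorithm :: "real \<Rightarrow> com \<Rightarrow> (nat \<Rightarrow> nat) \<Rightarrow> bool" where
  "approximation_algorithm \<rho> P T \<longleftrightarrow>
     (\<forall>m G b. sensor_network m G b \<longrightarrow>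
        (\<exists>t s. exec P (network_input m G b) t s \<and> t \<le> T m \<and>
               feasible m G (output_mat m s) \<and>
               networking_cost m b (output_mat m s) \<le> \<rho> * optimal_cost m G b))"

end

theory Submission
  imports Defs
begin

text \<open>
  Every feasible network contains, for each root, a spanning in-branching and a spanning out-branching,
  so the two minimum branchings together cost at most twice the optimum.

  A minimum out-branching is found by path-growing contraction (Edmonds' algorithm in the dense form of Tarjan).
  A path of disjoint strongly connected vertex sets is kept; the last set \<open>S\<close> selects its cheapest entering
  arc in reduced costs, which are then lowered by that amount \<open>y\<close> on all arcs entering \<open>S\<close>. If the arc starts
  outside the path, its tail is appended, otherwise the path is contracted down to the set containing the tail.
  The logged sets with their \<open>y\<close> form a packing of cuts, i.e. a dual solution. Afterwards the branching is grown from the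
  root, always by the earliest selected arc leaving the current vertex set. It then enters every logged set at
  most once, and not at all if the set contains the root, so its cost equals the value of the dual
  solution. Each selection and each pairwise merge scans \<open>m\<close> cells, and there are \<open>O(m)\<close> of them.
  In-branchings are out-branchings of the reversed network.
\<close>


section \<open>Branchings as sets of arcs\<close>

text \<open>Unpacking the contracted sets explicitly would need a forest of contractions. Here the
  order of the log replaces it, at the price of a condition sharper than laminarity: a logged set
  that meets an earlier one contains it together with the tail of its arc. Hence later reductions
  keep every logged arc tight, and the growth cannot enter a set that it already meets. The
  contraction itself never looks at the root. Every proper vertex set must have an entering arc, so
  missing links get a prohibitive weight and the contraction works on the complete digraph until a
  single set is left. Quadratic time rests on two facts. Reduced costs are not stored per arc: each
  path position has one row of column minima, and the row of a new vertex needs no correction,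
  because no logged set contains a vertex that was never on the path. Each push and each merge of
  neighbouring positions lowers twice the number of off-path vertices plus the top position by one,
  so there are at most \<open>2 * n\<close> of them, and at most as many logged arcs; the growth can
  thus afford to read the whole log once per added vertex.\<close>

definition branching_on :: "'a set \<Rightarrow> 'a \<Rightarrow> ('a \<times> 'a) set \<Rightarrow> bool" where
  "branching_on X r F \<longleftrightarrow> r \<in> X \<and> F \<subseteq> X \<times> X \<and> (\<forall>v\<in>X. (r, v) \<in> F\<^sup>*) \<and> inj_on snd F \<and>
     (\<exists>d :: 'a \<Rightarrow> nat. \<forall>(u, v) \<in> F. d v = Suc (d u))"

lemma branching_on_singleton: "branching_on {r} r {}"
  by (simp add: branching_on_def)

text \<open>The depth function in \<open>branching_on\<close> certifies acyclicity, and injectivity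
  of \<open>snd\<close> bounds the in-degree by one. Both survive because the head is fresh and gets
  the depth of the tail plus one.\<close>

lemma branching_on_insert:
  assumes "branching_on X r F" "u \<in> X" "v \<notin> X"
  shows "branching_on (insert v X) r (insert (u, v) F)"
proof -
  obtain d :: "'a \<Rightarrow> nat" where d: "\<forall>(a, b) \<in> F. d b = Suc (d a)" and FX: "F \<subseteq> X \<times> X"
    and reach: "\<forall>x\<in>X. (r, x) \<in> F\<^sup>*" and inj: "inj_on snd F"
    using assms(1) unfolding branching_on_def by auto
  have mono: "(r, x) \<in> (insert (u, v) F)\<^sup>*" if "x \<in> X" for x
    using reach that rtrancl_mono[of F "insert (u, v) F"] by blast
  then have "(r, v) \<in> (insert (u, v) F)\<^sup>*"
    using assms(2) by (meson insertI1 rtrancl.rtrancl_into_rtrancl)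
  moreover have "\<forall>(a, b) \<in> insert (u, v) F. (d(v := Suc (d u))) b = Suc ((d(v := Suc (d u))) a)"
    using d FX assms(2,3) by auto
  moreover have "inj_on snd (insert (u, v) F)"
    using inj FX assms(3) by (auto simp: inj_on_def)
  ultimately show ?thesis
    using mono FX assms unfolding branching_on_def by blast
qed

text \<open>The cut argument behind all growth and duality steps; applied to a complement it yields
  an arc entering a set.\<close>

lemma rtrancl_leaves:
  assumes "(x, y) \<in> E\<^sup>*" "x \<in> X" "y \<notin> X"
  obtains u v where "(u, v) \<in> E" "u \<in> X" "v \<notin> X"
  using assms by (induction rule: rtrancl_induct) blast+

lemma branching_exists:
  assumes "finite V" "r \<in> V" "E \<subseteq> V \<times> V" "\<forall>v\<in>V. (r, v) \<in> E\<^sup>*"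
  shows "\<exists>F\<subseteq>E. branching_on V r F"
proof -
  \<comment> \<open>Induction on the number of growth rounds: \<open>k\<close> bounds the size of
    \<open>X\<close> from below, so \<open>k = card V\<close> forces \<open>X = V\<close>.\<close>
  have "\<exists>F X. F \<subseteq> E \<and> X \<subseteq> V \<and> branching_on X r F \<and> (X = V \<or> k < card X)" for k
  proof (induction k)
    case 0
    show ?case
      by (rule exI[of _ "{}"], rule exI[of _ "{r}"]) (simp add: branching_on_singleton assms(2))
  next
    case (Suc k)
    then obtain F X where FX: "F \<subseteq> E" "X \<subseteq> V" "branching_on X r F" "X = V \<or> k < card X"
      by blast
    show ?case
    proof (cases "X = V")
      case True
      with FX show ?thesis by blast
    next
      case False
      then obtain y where y: "y \<in> V" "y \<notin> X" using FX by blast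
      have ry: "(r, y) \<in> E\<^sup>*" "r \<in> X" using assms(4) y FX(3) by (auto simp: branching_on_def)
      obtain u v where uv: "(u, v) \<in> E" "u \<in> X" "v \<notin> X"
        by (rule rtrancl_leaves[OF ry y(2)])
      have "finite X" using FX(2) assms(1) finite_subset by blast
      then have "Suc k < card (insert v X)" using uv False FX(4) by simp
      moreover have "v \<in> V" using uv assms(3) by blast
      ultimately show ?thesis
        using branching_on_insert[OF FX(3) uv(2,3)] uv(1) FX(1,2)
        by (intro exI[of _ "insert (u, v) F"] exI[of _ "insert v X"]) simp
    qed
  qed
  from this[of "card V"] obtain F X
    where FX: "F \<subseteq> E" "X \<subseteq> V" "branching_on X r F" "X = V \<or> card V < card X" by blast
  then have "X = V" using card_mono[OF assms(1) FX(2)] by simp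
  with FX show ?thesis by blast
qed


section \<open>Dual certificates\<close>

definition arcs_upto :: "(nat \<Rightarrow> nat) \<Rightarrow> (nat \<Rightarrow> nat) \<Rightarrow> nat \<Rightarrow> nat set \<Rightarrow> (nat \<times> nat) set" where
  "arcs_upto src dst k A = {(src j, dst j) | j. j < k \<and> src j \<in> A \<and> dst j \<in> A}"

text \<open>The index bound \<open>k\<close> dates the connectivity: it lets the growth compare the
  age of an arc with the age of a set.\<close>

definition strong_upto :: "(nat \<Rightarrow> nat) \<Rightarrow> (nat \<Rightarrow> nat) \<Rightarrow> nat \<Rightarrow> nat set \<Rightarrow> bool" where
  "strong_upto src dst k A \<longleftrightarrow> (\<forall>x\<in>A. \<forall>y\<in>A. (x, y) \<in> (arcs_upto src dst k A)\<^sup>*)"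

definition reduced_cost ::
    "(nat \<Rightarrow> nat \<Rightarrow> real) \<Rightarrow> nat \<Rightarrow> (nat \<Rightarrow> nat set) \<Rightarrow> (nat \<Rightarrow> real) \<Rightarrow> nat \<Rightarrow> nat \<Rightarrow> real" where
  "reduced_cost w k S y u v = w u v - (\<Sum>i<k. if v \<in> S i \<and> u \<notin> S i then y i else 0)"

text \<open>The \<open>i\<close>-th selection, made by the set \<open>S i\<close>, is the arc from \<open>src i\<close> to \<open>dst i\<close>, and \<open>y i\<close> is the dual value of the
  cut entering \<open>S i\<close>.\<close>

definition dual_log :: "nat \<Rightarrow> (nat \<Rightarrow> nat \<Rightarrow> real) \<Rightarrow> nat \<Rightarrow> (nat \<Rightarrow> nat) \<Rightarrow> (nat \<Rightarrow> nat) \<Rightarrow>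
    (nat \<Rightarrow> nat set) \<Rightarrow> (nat \<Rightarrow> real) \<Rightarrow> bool" where
  "dual_log n w k src dst S y \<longleftrightarrow>
     (\<forall>i<k. src i < n \<and> src i \<notin> S i \<and> dst i \<in> S i \<and> S i \<subseteq> {..<n} \<and> 0 \<le> y i \<and>
            strong_upto src dst i (S i) \<and> reduced_cost w k S y (src i) (dst i) = 0) \<and>
     (\<forall>i<k. \<forall>j<i. S j \<inter> S i = {} \<or> insert (src j) (S j) \<subseteq> S i) \<and>
     (\<forall>u<n. \<forall>v<n. 0 \<le> reduced_cost w k S y u v)"

lemma arcs_upto_mono: "k \<le> k' \<Longrightarrow> A \<subseteq> A' \<Longrightarrow> arcs_upto src dst k A \<subseteq> arcs_upto src dst k' A'"
  unfolding arcs_upto_def using order.strict_trans2 by blast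

lemma arcs_upto_upd [simp]: "k \<le> K \<Longrightarrow> arcs_upto (src(K := u)) (dst(K := v)) k A = arcs_upto src dst k A"
  unfolding arcs_upto_def by (intro Collect_cong ex_cong1) auto

lemma strong_upto_upd [simp]:
  "k \<le> K \<Longrightarrow> strong_upto (src(K := u)) (dst(K := v)) k A = strong_upto src dst k A"
  by (simp add: strong_upto_def)

lemma strong_upto_mono: "strong_upto src dst k A \<Longrightarrow> k \<le> k' \<Longrightarrow> strong_upto src dst k' A"
  unfolding strong_upto_def using arcs_upto_mono[of k k' A A src dst] rtrancl_mono by blast

lemma reduced_cost_Suc:
  "reduced_cost w (Suc K) (S(K := A)) (y(K := c)) u v =
     reduced_cost w K S y u v - (if v \<in> A \<and> u \<notin> A then c else 0)"
proof -
  have "(\<Sum>i<K. if v \<in> (S(K := A)) i \<and> u \<notin> (S(K := A)) i then (y(K := c)) i else 0) =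
      (\<Sum>i<K. if v \<in> S i \<and> u \<notin> S i then y i else 0)"
    by (rule sum.cong) auto
  then show ?thesis by (simp add: reduced_cost_def)
qed

lemma dual_log_0: "\<forall>u<n. \<forall>v<n. 0 \<le> w u v \<Longrightarrow> dual_log n w 0 src dst S y"
  by (simp add: dual_log_def reduced_cost_def)

text \<open>An older arc with its head in \<open>A\<close> has its tail there too, by the sharpened
  laminarity, so lowering the arcs that enter \<open>A\<close> leaves every logged arc tight.
  Minimality of the selected arc keeps the other reduced costs nonnegative.\<close>

lemma dual_log_extend:
  assumes log: "dual_log n w K src dst S y"
    and A: "A \<subseteq> {..<n}" "strong_upto src dst K A" "\<forall>i<K. S i \<inter> A = {} \<or> insert (src i) (S i) \<subseteq> A"
    and uv: "u < n" "u \<notin> A" "v \<in> A"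
    and least: "\<forall>u'<n. \<forall>v'\<in>A. u' \<notin> A \<longrightarrow> reduced_cost w K S y u v \<le> reduced_cost w K S y u' v'"
  shows "dual_log n w (Suc K) (src(K := u)) (dst(K := v)) (S(K := A)) (y(K := reduced_cost w K S y u v))"
proof -
  let ?c = "reduced_cost w K S y u v"
  have v: "v < n" using A(1) uv(3) by blast
  have nonneg: "\<forall>u<n. \<forall>v<n. 0 \<le> reduced_cost w K S y u v"
    and old: "\<forall>i<K. src i < n \<and> src i \<notin> S i \<and> dst i \<in> S i \<and> S i \<subseteq> {..<n} \<and> 0 \<le> y i \<and>
            strong_upto src dst i (S i) \<and> reduced_cost w K S y (src i) (dst i) = 0"
    and lam: "\<forall>i<K. \<forall>j<i. S j \<inter> S i = {} \<or> insert (src j) (S j) \<subseteq> S i"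
    using log by (auto simp: dual_log_def)
  have inside: "src i \<in> A" if "i < K" "dst i \<in> A" for i
    using that A(3) old by blast
  have 1: "\<forall>i<Suc K. (src(K := u)) i < n \<and> (src(K := u)) i \<notin> (S(K := A)) i \<and> (dst(K := v)) i \<in> (S(K := A)) i \<and>
      (S(K := A)) i \<subseteq> {..<n} \<and> 0 \<le> (y(K := ?c)) i \<and>
      strong_upto (src(K := u)) (dst(K := v)) i ((S(K := A)) i) \<and>
      reduced_cost w (Suc K) (S(K := A)) (y(K := ?c)) ((src(K := u)) i) ((dst(K := v)) i) = 0"
  proof (intro allI impI)
    fix i assume "i < Suc K"
    then consider "i = K" | "i < K" by linarith
    then show "(src(K := u)) i < n \<and> (src(K := u)) i \<notin> (S(K := A)) i \<and> (dst(K := v)) i \<in> (S(K := A)) i \<and>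
      (S(K := A)) i \<subseteq> {..<n} \<and> 0 \<le> (y(K := ?c)) i \<and>
      strong_upto (src(K := u)) (dst(K := v)) i ((S(K := A)) i) \<and>
      reduced_cost w (Suc K) (S(K := A)) (y(K := ?c)) ((src(K := u)) i) ((dst(K := v)) i) = 0"
    proof cases
      case 1
      then show ?thesis using uv A v nonneg unfolding reduced_cost_Suc by simp
    next
      case 2
      then have ne: "i \<noteq> K" "i \<le> K" by auto
      show ?thesis using 2 old inside[of i] unfolding reduced_cost_Suc
        by (auto simp: ne)
    qed
  qed
  have 2: "\<forall>i<Suc K. \<forall>j<i. (S(K := A)) j \<inter> (S(K := A)) i = {} \<or>
      insert ((src(K := u)) j) ((S(K := A)) j) \<subseteq> (S(K := A)) i"
    using lam A(3) by (auto simp: less_Suc_eq)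
  have 3: "\<forall>a<n. \<forall>b<n. 0 \<le> reduced_cost w (Suc K) (S(K := A)) (y(K := ?c)) a b"
    using nonneg least unfolding reduced_cost_Suc by simp
  show ?thesis unfolding dual_log_def using 1 2 3 by blast
qed

text \<open>The growth always adds the earliest logged arc that leaves \<open>X\<close>. Since \<open>S i\<close> is strongly connected
  by arcs logged before the one entering it, a set that has been entered is exhausted before another arc enters it.\<close>

definition tight_growth ::
    "nat \<Rightarrow> (nat \<Rightarrow> nat) \<Rightarrow> (nat \<Rightarrow> nat) \<Rightarrow> (nat \<Rightarrow> nat set) \<Rightarrow> nat \<Rightarrow> nat set \<Rightarrow> (nat \<times> nat) set \<Rightarrow> bool" where
  "tight_growth k src dst S r X F \<longleftrightarrow> branching_on X r F \<and> F \<subseteq> {(src i, dst i) | i. i < k} \<and>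
     (\<forall>i<k. card {(u, v) \<in> F. u \<notin> S i \<and> v \<in> S i} = (if r \<notin> S i \<and> X \<inter> S i \<noteq> {} then 1 else 0))"

lemma tight_growth_start: "tight_growth k src dst S r {r} {}"
  by (simp add: tight_growth_def branching_on_singleton)

lemma tight_growth_step:
  assumes log: "dual_log n w K src dst S y" and gr: "tight_growth K src dst S r X F"
    and i: "i < K" "src i \<in> X" "dst i \<notin> X"
    and first: "\<forall>j<i. \<not> (src j \<in> X \<and> dst j \<notin> X)"
  shows "tight_growth K src dst S r (insert (dst i) X) (insert (src i, dst i) F)"
proof -
  let ?u = "src i" and ?v = "dst i"
  have br: "branching_on X r F" and FX: "F \<subseteq> X \<times> X" and rX: "r \<in> X"
    using gr by (auto simp: tight_growth_def branching_on_def)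
  have new: "(?u, ?v) \<notin> F" using FX i by blast
  have fin: "finite F"
    by (rule finite_subset[of _ "(\<lambda>i. (src i, dst i)) ` {..<K}"])
      (use gr in \<open>auto simp: tight_growth_def\<close>)
  have "card {(u, v) \<in> insert (?u, ?v) F. u \<notin> S l \<and> v \<in> S l} =
      (if r \<notin> S l \<and> insert ?v X \<inter> S l \<noteq> {} then 1 else 0)" if l: "l < K" for l
  proof (cases "X \<inter> S l = {}")
    case True
    then have *: "r \<notin> S l" "?u \<notin> S l" using rX i by auto
    have c0: "card {(u, v) \<in> F. u \<notin> S l \<and> v \<in> S l} = 0"
      using gr l True by (auto simp: tight_growth_def)
    then have e: "{(u, v) \<in> F. u \<notin> S l \<and> v \<in> S l} = {}"
      using finite_subset[OF _ fin, of "{(u, v) \<in> F. u \<notin> S l \<and> v \<in> S l}"] by (auto simp: card_eq_0_iff)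
    show ?thesis
    proof (cases "?v \<in> S l")
      case True
      then have "{(u, v) \<in> insert (?u, ?v) F. u \<notin> S l \<and> v \<in> S l} = {(?u, ?v)}"
        using e * by blast
      then show ?thesis using True * by simp
    next
      case False
      then have "{(u, v) \<in> insert (?u, ?v) F. u \<notin> S l \<and> v \<in> S l} = {}"
        using e by blast
      then have "card {(u, v) \<in> insert (?u, ?v) F. u \<notin> S l \<and> v \<in> S l} = 0"
        by (simp only: card.empty)
      then show ?thesis using False \<open>X \<inter> S l = {}\<close> by simp
    qed
  next
    case False
    then obtain x where x: "x \<in> X" "x \<in> S l" by blast
    \<comment> \<open>Otherwise a path inside \<open>S l\<close>, made of arcs older than selection
      \<open>l\<close>, would leave \<open>X\<close>. As arc \<open>i\<close> is the earliest that
      leaves \<open>X\<close>, this gives \<open>i < l\<close>, and the sharpened laminarity puts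
      \<open>src i\<close> inside \<open>S l\<close>.\<close>
    have "\<not> (?u \<notin> S l \<and> ?v \<in> S l)"
    proof
      assume enter: "?u \<notin> S l \<and> ?v \<in> S l"
      have "strong_upto src dst l (S l)" using log l by (simp add: dual_log_def)
      then have path: "(x, ?v) \<in> (arcs_upto src dst l (S l))\<^sup>*"
        using x enter by (simp add: strong_upto_def)
      obtain a b where "(a, b) \<in> arcs_upto src dst l (S l)" "a \<in> X" "b \<notin> X"
        by (rule rtrancl_leaves[OF path x(1) i(3)])
      then obtain j where j: "j < l" "src j \<in> X" "dst j \<notin> X" by (auto simp: arcs_upto_def)
      then have "\<not> j < i" using first by blast
      then have "i < l" using j(1) by simp
      moreover have "?v \<in> S i" using log i(1) by (simp add: dual_log_def)
      moreover have "S i \<inter> S l = {} \<or> insert ?u (S i) \<subseteq> S l"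
        using log l \<open>i < l\<close> by (simp add: dual_log_def)
      ultimately have "insert ?u (S i) \<subseteq> S l" using enter by blast
      then show False using enter by blast
    qed
    then have "{(u, v) \<in> insert (?u, ?v) F. u \<notin> S l \<and> v \<in> S l} = {(u, v) \<in> F. u \<notin> S l \<and> v \<in> S l}"
      by blast
    then show ?thesis using gr l False by (auto simp: tight_growth_def)
  qed
  then show ?thesis
    using branching_on_insert[OF br i(2,3)] gr i(1) unfolding tight_growth_def by auto
qed

lemma tight_growth_continues:
  assumes "strong_upto src dst K V" "tight_growth K src dst S r X F" "r \<in> V" "\<not> V \<subseteq> X"
  obtains i where "i < K" "src i \<in> X" "dst i \<notin> X"
proof -
  obtain v where v: "v \<in> V" "v \<notin> X" using assms(4) by blast
  have path: "(r, v) \<in> (arcs_upto src dst K V)\<^sup>*" using assms(1,3) v by (simp add: strong_upto_def)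
  have rX: "r \<in> X" using assms(2) by (simp add: tight_growth_def branching_on_def)
  obtain a b where "(a, b) \<in> arcs_upto src dst K V" "a \<in> X" "b \<notin> X"
    by (rule rtrancl_leaves[OF path rX v(2)])
  then show thesis using that by (auto simp: arcs_upto_def)
qed

text \<open>Competitors are all arc sets that reach every vertex from \<open>r\<close>, not only
  branchings. Weak duality covers them as well, and the set of all links of a network can then serve
  as a competitor.\<close>

definition optimal_branching :: "nat \<Rightarrow> (nat \<Rightarrow> nat \<Rightarrow> real) \<Rightarrow> nat \<Rightarrow> (nat \<times> nat) set \<Rightarrow> bool" where
  "optimal_branching n w r F \<longleftrightarrow> branching_on {..<n} r F \<and>
     (\<forall>F'. F' \<subseteq> {..<n} \<times> {..<n} \<longrightarrow> (\<forall>v<n. (r, v) \<in> F'\<^sup>*) \<longrightarrow>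
        (\<Sum>(u, v)\<in>F. w u v) \<le> (\<Sum>(u, v)\<in>F'. w u v))"

text \<open>Exchanging the two sums charges each dual value once per arc that crosses its cut; weak
  duality compares arc sets through this identity.\<close>

lemma sum_reduced_cost:
  assumes "finite F"
  shows "(\<Sum>(u, v)\<in>F. w u v) = (\<Sum>(u, v)\<in>F. reduced_cost w k S y u v) +
    (\<Sum>i<k. y i * real (card {(u, v) \<in> F. u \<notin> S i \<and> v \<in> S i}))"
proof -
  have "(\<Sum>(u, v)\<in>F. \<Sum>i<k. if v \<in> S i \<and> u \<notin> S i then y i else 0) =
      (\<Sum>i<k. \<Sum>(u, v)\<in>F. if v \<in> S i \<and> u \<notin> S i then y i else 0)"
    using sum.swap[of "\<lambda>e i. if snd e \<in> S i \<and> fst e \<notin> S i then y i else 0" "{..<k}" F]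
    by (simp add: case_prod_unfold)
  also have "\<dots> = (\<Sum>i<k. y i * real (card {(u, v) \<in> F. u \<notin> S i \<and> v \<in> S i}))"
  proof (rule sum.cong[OF refl])
    fix i
    have "(\<Sum>(u, v)\<in>F. if v \<in> S i \<and> u \<notin> S i then y i else 0) =
        (\<Sum>e\<in>{e \<in> F. snd e \<in> S i \<and> fst e \<notin> S i}. y i)"
      unfolding case_prod_unfold by (rule sum.inter_filter[OF assms, symmetric])
    also have "{e \<in> F. snd e \<in> S i \<and> fst e \<notin> S i} = {(u, v) \<in> F. u \<notin> S i \<and> v \<in> S i}"
      by auto
    finally show "(\<Sum>(u, v)\<in>F. if v \<in> S i \<and> u \<notin> S i then y i else 0) =
        y i * real (card {(u, v) \<in> F. u \<notin> S i \<and> v \<in> S i})" by simp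
  qed
  finally show ?thesis
    by (simp add: reduced_cost_def case_prod_unfold sum_subtractf)
qed

text \<open>Complementary slackness: \<open>F\<close> has reduced cost zero and crosses each cut as
  rarely as possible, while a competitor has nonnegative reduced cost and must cross every cut that
  separates \<open>r\<close> from a logged set.\<close>

lemma tight_growth_optimal:
  assumes log: "dual_log n w K src dst S y" and gr: "tight_growth K src dst S r {..<n} F"
  shows "optimal_branching n w r F"
proof -
  have fin: "finite F'" if "F' \<subseteq> {..<n} \<times> {..<n}" for F' :: "(nat \<times> nat) set"
    using that finite_subset by blast
  have br: "branching_on {..<n} r F" using gr by (simp add: tight_growth_def)
  then have Fn: "F \<subseteq> {..<n} \<times> {..<n}" and rn: "r < n" by (auto simp: branching_on_def)
  have "(\<Sum>(u, v)\<in>F. w u v) \<le> (\<Sum>(u, v)\<in>F'. w u v)"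
    if F': "F' \<subseteq> {..<n} \<times> {..<n}" and reach: "\<forall>v<n. (r, v) \<in> F'\<^sup>*" for F'
  proof -
    have "(\<Sum>(u, v)\<in>F. reduced_cost w K S y u v) = 0"
      using gr log by (intro sum.neutral) (auto simp: tight_growth_def dual_log_def)
    moreover have "0 \<le> (\<Sum>(u, v)\<in>F'. reduced_cost w K S y u v)"
      using F' log by (intro sum_nonneg) (auto simp: dual_log_def)
    moreover have "(\<Sum>i<K. y i * real (card {(u, v) \<in> F. u \<notin> S i \<and> v \<in> S i})) \<le>
        (\<Sum>i<K. y i * real (card {(u, v) \<in> F'. u \<notin> S i \<and> v \<in> S i}))"
    proof (intro sum_mono mult_left_mono)
      fix i assume "i \<in> {..<K}"
      then have i: "i < K" by simp
      then show "0 \<le> y i" using log by (simp add: dual_log_def)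
      \<comment> \<open>\<open>dst i\<close> is the vertex of \<open>S i\<close> whose reachability
        forces a competitor to enter \<open>S i\<close>.\<close>
      have dst: "dst i \<in> S i" "dst i < n" using log i by (auto simp: dual_log_def)
      have cF: "card {(u, v) \<in> F. u \<notin> S i \<and> v \<in> S i} = (if r \<notin> S i \<and> {..<n} \<inter> S i \<noteq> {} then 1 else 0)"
        using gr i by (simp add: tight_growth_def)
      show "real (card {(u, v) \<in> F. u \<notin> S i \<and> v \<in> S i}) \<le> real (card {(u, v) \<in> F'. u \<notin> S i \<and> v \<in> S i})"
      proof (cases "r \<in> S i")
        case True
        then show ?thesis using cF by simp
      next
        case False
        have path: "(r, dst i) \<in> F'\<^sup>*" using reach dst by blast
        obtain a b where "(a, b) \<in> F'" "a \<in> - S i" "b \<notin> - S i"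
          by (rule rtrancl_leaves[OF path, of "- S i"]) (use False dst in auto)
        then have "{(u, v) \<in> F'. u \<notin> S i \<and> v \<in> S i} \<noteq> {}" by blast
        moreover have "finite {(u, v) \<in> F'. u \<notin> S i \<and> v \<in> S i}"
          by (rule finite_subset[OF _ fin[OF F']]) auto
        ultimately have "0 < card {(u, v) \<in> F'. u \<notin> S i \<and> v \<in> S i}"
          by (simp add: card_gt_0_iff)
        then show ?thesis using cF by (simp split: if_splits)
      qed
    qed
    ultimately show ?thesis
      using sum_reduced_cost[OF fin[OF Fn], of w K S y] sum_reduced_cost[OF fin[OF F'], of w K S y]
      by linarith
  qed
  with br show ?thesis by (simp add: optimal_branching_def)
qed

section \<open>The contraction phase\<close>

definition comp_set :: "nat \<Rightarrow> (nat \<Rightarrow> nat) \<Rightarrow> nat \<Rightarrow> nat set" where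
  "comp_set n cmp p = {x. x < n \<and> cmp x = Suc p}"

text \<open>\<open>cmp x = Suc p\<close> places \<open>x\<close> in the \<open>p\<close>-th set of the path, and \<open>cmp x = 0\<close> off the path. The selected
  arcs lead from position \<open>Suc p\<close> to position \<open>p\<close>. The last conjunct bounds the number of selections.\<close>

definition path_stack :: "nat \<Rightarrow> nat \<Rightarrow> (nat \<Rightarrow> nat) \<Rightarrow> (nat \<Rightarrow> nat) \<Rightarrow> (nat \<Rightarrow> nat set) \<Rightarrow>
    (nat \<Rightarrow> nat) \<Rightarrow> nat \<Rightarrow> bool" where
  "path_stack n K src dst S cmp tp \<longleftrightarrow>
     (\<forall>x<n. cmp x \<le> Suc tp) \<and>
     (\<forall>p\<le>tp. comp_set n cmp p \<noteq> {} \<and> strong_upto src dst K (comp_set n cmp p)) \<and>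
     (\<forall>i<K. \<forall>x<n. x \<in> S i \<longrightarrow> 0 < cmp x) \<and>
     (\<forall>i<K. \<forall>p\<le>tp. S i \<inter> comp_set n cmp p = {} \<or> insert (src i) (S i) \<subseteq> comp_set n cmp p \<or>
        (p < tp \<and> S i = comp_set n cmp p \<and> src i \<in> comp_set n cmp (Suc p))) \<and>
     (\<forall>p<tp. \<exists>i<K. dst i \<in> comp_set n cmp p \<and> src i \<in> comp_set n cmp (Suc p)) \<and>
     K + 2 * card {x. x < n \<and> cmp x = 0} + tp \<le> 2 * n"

lemma comp_set_cong: "\<forall>x<n. cmp x = cmp' x \<Longrightarrow> comp_set n cmp = comp_set n cmp'"
  by (auto simp: comp_set_def fun_eq_iff)

lemma path_stack_cong:
  assumes "\<forall>x<n. cmp x = cmp' x"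
  shows "path_stack n K src dst S cmp tp = path_stack n K src dst S cmp' tp"
proof -
  have "{x. x < n \<and> cmp x = 0} = {x. x < n \<and> cmp' x = 0}" using assms by auto
  then show ?thesis using assms by (simp add: path_stack_def comp_set_cong[OF assms])
qed

lemma comp_set_disjoint: "p \<noteq> p' \<Longrightarrow> comp_set n cmp p \<inter> comp_set n cmp p' = {}"
  by (auto simp: comp_set_def)

text \<open>The path sets are nonempty, so each of the labels from 1 to \<open>Suc tp\<close> is
  taken by one of the \<open>n\<close> vertices.\<close>

lemma path_stack_top_less:
  assumes "path_stack n K src dst S cmp tp"
  shows "tp < n"
proof -
  have "{1..Suc tp} \<subseteq> cmp ` {..<n}"
  proof
    fix p assume p: "p \<in> {1..Suc tp}"
    then have "p - 1 \<le> tp" by auto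
    then obtain x where "x \<in> comp_set n cmp (p - 1)"
      using assms by (fastforce simp: path_stack_def)
    with p show "p \<in> cmp ` {..<n}" by (auto simp: comp_set_def image_iff)
  qed
  then have "card {1..Suc tp} \<le> card {..<n}" by (rule surj_card_le[rotated]) simp
  then show ?thesis by simp
qed

lemma path_stack_start:
  assumes "0 < n"
  shows "path_stack n 0 src dst S (\<lambda>x. if x = 0 then 1 else 0) 0"
proof -
  have "comp_set n (\<lambda>x. if x = 0 then 1 else 0) 0 = {0}" using assms by (auto simp: comp_set_def)
  moreover have "{x. x < n \<and> (if x = 0 then 1 else 0 :: nat) = 0} \<subseteq> {1..<n}" by auto
  then have "card {x. x < n \<and> (if x = 0 then 1 else 0 :: nat) = 0} \<le> card {1..<n}"
    by (intro card_mono) auto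
  ultimately show ?thesis by (simp add: path_stack_def strong_upto_def)
qed

text \<open>A set that has selected its arc and is not yet contracted is a logged set equal to a
  path set, with its tail one position further; this is the third alternative of
  \<open>path_stack\<close>. The count stays balanced: log and top grow by one each, while twice the
  number of off-path vertices drops by two.\<close>

lemma path_stack_push:
  assumes st: "path_stack n K src dst S cmp tp" and u: "u < n" "cmp u = 0"
    and v: "v \<in> comp_set n cmp tp"
  shows "path_stack n (Suc K) (src(K := u)) (dst(K := v)) (S(K := comp_set n cmp tp))
           (cmp(u := Suc (Suc tp))) (Suc tp)"
proof -
  let ?C = "comp_set n cmp" and ?cmp = "cmp(u := Suc (Suc tp))"
  let ?C' = "comp_set n ?cmp" and ?S = "S(K := ?C tp)"
  let ?src = "src(K := u)" and ?dst = "dst(K := v)"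
  have le: "\<forall>x<n. cmp x \<le> Suc tp" using st by (simp add: path_stack_def)
  have C': "?C' p = ?C p" if "p \<le> tp" for p using that u by (auto simp: comp_set_def)
  have Cu: "?C' (Suc tp) = {u}" using le u by (auto simp: comp_set_def)
  have pos: "\<forall>i<Suc K. \<forall>x<n. x \<in> ?S i \<longrightarrow> 0 < cmp x"
    using st by (auto simp: path_stack_def comp_set_def less_Suc_eq)
  have 1: "?C' p \<noteq> {} \<and> strong_upto ?src ?dst (Suc K) (?C' p)" if "p \<le> Suc tp" for p
  proof (cases "p \<le> tp")
    case True
    then have "?C p \<noteq> {}" "strong_upto src dst K (?C p)" using st by (auto simp: path_stack_def)
    then show ?thesis
      using True C' strong_upto_mono[of ?src ?dst K "?C p" "Suc K"] by simp
  next
    case False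
    then have "p = Suc tp" using that by simp
    then show ?thesis by (simp add: Cu strong_upto_def)
  qed
  have 2: "?S i \<inter> ?C' p = {} \<or> insert (?src i) (?S i) \<subseteq> ?C' p \<or>
        (p < Suc tp \<and> ?S i = ?C' p \<and> ?src i \<in> ?C' (Suc p))" if i: "i < Suc K" and p: "p \<le> Suc tp" for i p
  proof (cases "p \<le> tp")
    case False
    then have "p = Suc tp" using p by simp
    \<comment> \<open>Logged sets contain only vertices that were on the path before, and
      \<open>u\<close> was not.\<close>
    moreover have "u \<notin> ?S i" using pos i u by (metis less_irrefl)
    ultimately show ?thesis by (simp add: Cu)
  next
    case True
    show ?thesis
    proof (cases "i = K")
      case True
      then show ?thesis using \<open>p \<le> tp\<close> C' Cu comp_set_disjoint[of tp p n cmp] by (cases "p = tp") auto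
    next
      case False
      then have "i < K" using i by simp
      with \<open>p \<le> tp\<close> st
      have "S i \<inter> ?C p = {} \<or> insert (src i) (S i) \<subseteq> ?C p \<or>
        (p < tp \<and> S i = ?C p \<and> src i \<in> ?C (Suc p))" unfolding path_stack_def by blast
      then show ?thesis using False \<open>p \<le> tp\<close> C' by auto
    qed
  qed
  have 3: "\<exists>i<Suc K. ?dst i \<in> ?C' p \<and> ?src i \<in> ?C' (Suc p)" if "p < Suc tp" for p
  proof (cases "p = tp")
    case True
    then show ?thesis using v C' Cu by (intro exI[of _ K]) simp
  next
    case False
    then have "p < tp" using that by simp
    then obtain i where "i < K" "dst i \<in> ?C p" "src i \<in> ?C (Suc p)"
      using st unfolding path_stack_def by blast
    then show ?thesis using C' \<open>p < tp\<close> by (intro exI[of _ i]) simp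
  qed
  have "{x. x < n \<and> cmp x = 0} = insert u {x. x < n \<and> ?cmp x = 0}" using u by auto
  then have "card {x. x < n \<and> cmp x = 0} = Suc (card {x. x < n \<and> ?cmp x = 0})" by simp
  then have 4: "Suc K + 2 * card {x. x < n \<and> ?cmp x = 0} + Suc tp \<le> 2 * n"
    using st by (simp add: path_stack_def)
  have 5: "\<forall>x<n. ?cmp x \<le> Suc (Suc tp)" using le by (auto intro: le_SucI)
  have 6: "\<forall>i<Suc K. \<forall>x<n. x \<in> ?S i \<longrightarrow> 0 < ?cmp x" using pos by auto
  show ?thesis unfolding path_stack_def using 1 2 3 4 5 6 by blast
qed

text \<open>Older arcs lead from each position to the one below, so the selected arc from position
  \<open>j\<close> to the top closes a cycle through positions \<open>j\<close> to
  \<open>tp\<close>. Cutting all labels at \<open>Suc j\<close> merges these positions in one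
  stroke.\<close>

lemma path_stack_contract:
  assumes st: "path_stack n K src dst S cmp tp" and u: "u < n" "cmp u = Suc j" "j < tp"
    and v: "v \<in> comp_set n cmp tp"
  shows "path_stack n (Suc K) (src(K := u)) (dst(K := v)) (S(K := comp_set n cmp tp))
           (\<lambda>x. min (cmp x) (Suc j)) j"
proof -
  let ?C = "comp_set n cmp" and ?cmp = "\<lambda>x. min (cmp x) (Suc j)"
  let ?C' = "comp_set n ?cmp" and ?S = "S(K := ?C tp)"
  let ?src = "src(K := u)" and ?dst = "dst(K := v)"
  have le: "\<forall>x<n. cmp x \<le> Suc tp" using st by (simp add: path_stack_def)
  have C': "?C' p = ?C p" if "p < j" for p using that by (auto simp: comp_set_def)
  have sub: "?C p \<subseteq> ?C' j" if "j \<le> p" for p using that by (auto simp: comp_set_def)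
  have cover: "\<exists>p. j \<le> p \<and> p \<le> tp \<and> x \<in> ?C p" if "x \<in> ?C' j" for x
  proof (intro exI conjI)
    show "x \<in> ?C (cmp x - 1)" "j \<le> cmp x - 1" "cmp x - 1 \<le> tp"
      using that le by (auto simp: comp_set_def)
  qed
  define R where "R = (arcs_upto ?src ?dst (Suc K) (?C' j))\<^sup>*"
  have Rtrans: "(x, y) \<in> R \<Longrightarrow> (y, z) \<in> R \<Longrightarrow> (x, z) \<in> R" for x y z :: nat
    unfolding R_def by (rule rtrancl_trans)
  have within: "(x, y) \<in> R" if "x \<in> ?C p" "y \<in> ?C p" "j \<le> p" "p \<le> tp" for x y p
  proof -
    have "(x, y) \<in> (arcs_upto src dst K (?C p))\<^sup>*"
      using st that by (auto simp: path_stack_def strong_upto_def)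
    then have "(x, y) \<in> (arcs_upto ?src ?dst K (?C p))\<^sup>*" by simp
    then show ?thesis unfolding R_def
      using rtrancl_mono[OF arcs_upto_mono[of K "Suc K" "?C p" "?C' j" ?src ?dst]] sub that by auto
  qed
  have down: "(x, y) \<in> R" if "x \<in> ?C (j + d)" "y \<in> ?C j" "j + d \<le> tp" for x y d
    using that
  proof (induction d arbitrary: x)
    case 0
    then show ?case using within[of x j y] by simp
  next
    case (Suc d)
    then obtain i where i: "i < K" "dst i \<in> ?C (j + d)" "src i \<in> ?C (Suc (j + d))"
      using st unfolding path_stack_def by (metis Suc_le_eq add_Suc_right)
    have "(?src i, ?dst i) \<in> arcs_upto ?src ?dst (Suc K) (?C' j)"
      unfolding arcs_upto_def using i sub[of "j + d"] sub[of "Suc (j + d)"] by force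
    then have "(src i, dst i) \<in> R" unfolding R_def using i by auto
    moreover have "(x, src i) \<in> R" using within[of x "Suc (j + d)"] Suc.prems i by simp
    moreover have "(dst i, y) \<in> R" using Suc.IH[of "dst i"] Suc.prems i by simp
    ultimately show ?case by (meson Rtrans)
  qed
  have uj: "u \<in> ?C j" using u by (simp add: comp_set_def)
  have closing: "(u, v) \<in> R"
  proof -
    have "(?src K, ?dst K) \<in> arcs_upto ?src ?dst (Suc K) (?C' j)"
      unfolding arcs_upto_def using uj v sub[of j] sub[of tp] u(3) by force
    then show ?thesis unfolding R_def by auto
  qed
  have strong: "strong_upto ?src ?dst (Suc K) (?C' j)"
    unfolding strong_upto_def R_def[symmetric]
  \<comment> \<open>The route from \<open>x\<close> to \<open>y\<close> descends to \<open>u\<close>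
    at position \<open>j\<close>, takes the closing arc to \<open>v\<close> at the top, and descends
    again to the position of \<open>y\<close>.\<close>
  proof (intro ballI)
    fix x y assume "x \<in> ?C' j" "y \<in> ?C' j"
    then obtain p q where p: "j \<le> p" "p \<le> tp" "x \<in> ?C p" and q: "j \<le> q" "q \<le> tp" "y \<in> ?C q"
      using cover by meson
    have "(x, u) \<in> R" using down[of x "p - j" u] p uj by simp
    moreover have "(v, y) \<in> R"
    proof -
      have "(v, z) \<in> R" if "z \<in> ?C (tp - d)" "d \<le> tp - j" for z d
        using that
      proof (induction d arbitrary: z)
        case 0
        then show ?case using within[of v tp z] v u(3) by simp
      next
        case (Suc d)
        then have d: "tp - Suc d < tp" "Suc (tp - Suc d) = tp - d" "j \<le> tp - Suc d" by auto
        then obtain i where i: "i < K" "dst i \<in> ?C (tp - Suc d)" "src i \<in> ?C (tp - d)"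
          using st unfolding path_stack_def by metis
        have "(?src i, ?dst i) \<in> arcs_upto ?src ?dst (Suc K) (?C' j)"
          unfolding arcs_upto_def using i d sub[of "tp - d"] sub[of "tp - Suc d"] by force
        then have "(src i, dst i) \<in> R" unfolding R_def using i by auto
        moreover have "(v, src i) \<in> R" using Suc.IH[of "src i"] Suc.prems i by simp
        moreover have "(dst i, z) \<in> R" using within[of "dst i" "tp - Suc d" z] Suc.prems i d by simp
        ultimately show ?case by (meson Rtrans)
      qed
      from this[of y "tp - q"] show ?thesis using q by simp
    qed
    ultimately show "(x, y) \<in> R" using closing by (meson Rtrans)
  qed
  have 1: "?C' p \<noteq> {} \<and> strong_upto ?src ?dst (Suc K) (?C' p)" if "p \<le> j" for p
  proof (cases "p = j")
    case True
    then show ?thesis using strong uj sub[of j] by auto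
  next
    case False
    then have "p < j" "p \<le> tp" using that u by auto
    then show ?thesis
      using C' st strong_upto_mono[of ?src ?dst K "?C p" "Suc K"] by (auto simp: path_stack_def)
  qed
  have old: "S i \<inter> ?C p = {} \<or> insert (src i) (S i) \<subseteq> ?C p \<or>
        (p < tp \<and> S i = ?C p \<and> src i \<in> ?C (Suc p))" if "i < K" "p \<le> tp" for i p
    using st that unfolding path_stack_def by blast
  have 2: "?S i \<inter> ?C' p = {} \<or> insert (?src i) (?S i) \<subseteq> ?C' p \<or>
        (p < j \<and> ?S i = ?C' p \<and> ?src i \<in> ?C' (Suc p))" if i: "i < Suc K" and p: "p \<le> j" for i p
  proof (cases "i = K")
    case True
    show ?thesis
    proof (cases "p = j")
      case True
      then show ?thesis using \<open>i = K\<close> uj sub[of j] sub[of tp] u(3) by auto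
    next
      case False
      then show ?thesis using \<open>i = K\<close> p u(3) C'[of p] comp_set_disjoint[of tp p n cmp] by auto
    qed
  next
    case False
    then have iK: "i < K" using i by simp
    show ?thesis
    proof (cases "p = j")
      case True
      show ?thesis
      proof (cases "S i \<inter> ?C' j = {}")
        case False
        then obtain x where x: "x \<in> S i" "x \<in> ?C' j" by blast
        then obtain q where q: "j \<le> q" "q \<le> tp" "x \<in> ?C q" using cover by meson
        \<comment> \<open>If the arc of \<open>S i\<close> comes from the next position, its tail
          lies inside as well, since that position is merged too.\<close>
        then have "insert (src i) (S i) \<subseteq> ?C' j"
          using old[OF iK q(2)] x sub[of q] sub[of "Suc q"] by fastforce
        then show ?thesis using True \<open>i \<noteq> K\<close> by simp
      qed (use True \<open>i \<noteq> K\<close> in simp)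
    next
      case False
      then have p': "p < j" "p \<le> tp" using p u by auto
      then have "?C (Suc p) \<subseteq> ?C' (Suc p)"
        using C'[of "Suc p"] sub[of "Suc p"] by (cases "Suc p = j") auto
      then show ?thesis using old[OF iK p'(2)] C' p' \<open>i \<noteq> K\<close> by auto
    qed
  qed
  have 3: "\<exists>i<Suc K. ?dst i \<in> ?C' p \<and> ?src i \<in> ?C' (Suc p)" if p: "p < j" for p
  proof -
    have "p < tp" using p u by simp
    then obtain i where i: "i < K" "dst i \<in> ?C p" "src i \<in> ?C (Suc p)"
      using st unfolding path_stack_def by blast
    moreover have "?C (Suc p) \<subseteq> ?C' (Suc p)"
      using C'[of "Suc p"] sub[of "Suc p"] p by (cases "Suc p = j") auto
    ultimately show ?thesis using C' p by (intro exI[of _ i]) auto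
  qed
  have "{x. x < n \<and> ?cmp x = 0} = {x. x < n \<and> cmp x = 0}" by (auto simp: min_def split: if_splits)
  then have 4: "Suc K + 2 * card {x. x < n \<and> ?cmp x = 0} + j \<le> 2 * n"
    using st u(3) by (simp add: path_stack_def)
  have 5: "\<forall>x<n. ?cmp x \<le> Suc j" by simp
  have 6: "\<forall>i<Suc K. \<forall>x<n. x \<in> ?S i \<longrightarrow> 0 < ?cmp x"
    using st by (auto simp: path_stack_def comp_set_def less_Suc_eq)
  show ?thesis unfolding path_stack_def using 1 2 3 4 5 6 by blast
qed

text \<open>At the last position the third alternative of \<open>path_stack\<close> is excluded;
  what remains is the premise of \<open>dual_log_extend\<close> for the selecting set.\<close>

lemma path_stack_laminar:
  assumes "path_stack n K src dst S cmp tp" "i < K"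
  shows "S i \<inter> comp_set n cmp tp = {} \<or> insert (src i) (S i) \<subseteq> comp_set n cmp tp"
  using assms unfolding path_stack_def by blast

section \<open>Cheapest arcs from each vertex into a path set\<close>

definition min_column ::
    "nat \<Rightarrow> (nat \<Rightarrow> nat \<Rightarrow> real) \<Rightarrow> nat set \<Rightarrow> (nat \<Rightarrow> real) \<Rightarrow> (nat \<Rightarrow> nat) \<Rightarrow> bool" where
  "min_column n c A q h \<longleftrightarrow>
     (\<forall>u<n. u \<notin> A \<longrightarrow> h u \<in> A \<and> q u = c u (h u) \<and> (\<forall>v\<in>A. q u \<le> c u v))"

text \<open>A tail outside the union is outside both sets, so both minima are valid for it. Tails
  inside a set are unconstrained, which allows whole rows to be combined without testing
  membership.\<close>

lemma min_column_union:
  assumes "min_column n c A q h" "min_column n c B q' h'"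
    and "\<forall>u<n. q'' u = (if q' u < q u then q' u else q u) \<and> h'' u = (if q' u < q u then h' u else h u)"
  shows "min_column n c (A \<union> B) q'' h''"
  using assms unfolding min_column_def by (smt (verit) Un_iff)

text \<open>All arcs entering \<open>A\<close> drop by the same \<open>c\<close>, so the minimising
  heads stay.\<close>

lemma min_column_select:
  assumes "min_column n (reduced_cost w K S y) A q h" "\<forall>u<n. q' u = q u - c"
  shows "min_column n (reduced_cost w (Suc K) (S(K := A)) (y(K := c))) A q' h"
  using assms unfolding min_column_def reduced_cost_Suc by auto

lemma min_column_other:
  assumes "min_column n (reduced_cost w K S y) B q h" "A \<inter> B = {}"
  shows "min_column n (reduced_cost w (Suc K) (S(K := A)) (y(K := c))) B q h"
proof -
  let ?c = "reduced_cost w K S y" and ?c' = "reduced_cost w (Suc K) (S(K := A)) (y(K := c))"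
  have same: "?c' u v = ?c u v" if "v \<in> B" for u v
    unfolding reduced_cost_Suc using that assms(2) by auto
  show ?thesis unfolding min_column_def
  proof (intro allI impI)
    fix u assume "u < n" "u \<notin> B"
    then have "h u \<in> B" "q u = ?c u (h u)" "\<forall>v\<in>B. q u \<le> ?c u v"
      using assms(1) unfolding min_column_def by blast+
    then show "h u \<in> B \<and> q u = ?c' u (h u) \<and> (\<forall>v\<in>B. q u \<le> ?c' u v)"
      using same by metis
  qed
qed

text \<open>No logged cut has \<open>u\<close> on its inner side, so raw and reduced costs into
  \<open>u\<close> agree: a vertex new on the path carries no history.\<close>

lemma min_column_single:
  assumes "\<forall>i<K. u \<notin> S i" "\<forall>x<n. q x = w x u \<and> h x = u"
  shows "min_column n (reduced_cost w K S y) {u} q h"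
proof -
  have "reduced_cost w K S y x u = w x u" for x
    unfolding reduced_cost_def using assms(1) by simp
  then show ?thesis using assms(2) by (simp add: min_column_def)
qed

section \<open>Branchings as digraphs\<close>

lemma subgraph_with_proj_iff:
  "subgraph (with_proj H) (with_proj G) \<longleftrightarrow>
     pverts H \<subseteq> pverts G \<and> parcs H \<subseteq> parcs G \<and>
     parcs G \<subseteq> pverts G \<times> pverts G \<and> parcs H \<subseteq> pverts H \<times> pverts H"
proof -
  have "wf_digraph (with_proj T) \<longleftrightarrow> parcs T \<subseteq> pverts T \<times> pverts T" for T :: "'a pair_pre_digraph"
    by (force simp: wf_digraph_def)
  then show ?thesis by (auto simp: subgraph_def compatible_def)
qed

lemma spanning_with_proj_iff:
  "spanning (with_proj H) (with_proj G) \<longleftrightarrow>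
     pverts H = pverts G \<and> parcs H \<subseteq> parcs G \<and> parcs G \<subseteq> pverts G \<times> pverts G"
  unfolding spanning_def subgraph_with_proj_iff by auto

lemma pair_wf_digraph_iff: "pair_wf_digraph T \<longleftrightarrow> parcs T \<subseteq> pverts T \<times> pverts T"
  by (force simp: pair_wf_digraph_def)

lemma reachable_with_proj_iff:
  assumes "parcs T \<subseteq> pverts T \<times> pverts T"
  shows "u \<rightarrow>\<^sup>*\<^bsub>with_proj T\<^esub> v \<longleftrightarrow> u \<in> pverts T \<and> (u, v) \<in> (parcs T)\<^sup>*"
proof
  assume "u \<rightarrow>\<^sup>*\<^bsub>with_proj T\<^esub> v"
  then have "(u, v) \<in> rtrancl_on (pverts T) (parcs T)" by (simp add: reachable_def)
  then show "u \<in> pverts T \<and> (u, v) \<in> (parcs T)\<^sup>*"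
    using in_rtrancl_on_in_F rtrancl_on_rtranclI by metis
next
  assume uv: "u \<in> pverts T \<and> (u, v) \<in> (parcs T)\<^sup>*"
  then have "v \<in> pverts T" using assms by (auto elim: rtranclE)
  with uv have "(u, v) \<in> rtrancl_on (pverts T) (parcs T)"
    by (intro rtrancl_consistent_rtrancl_on) (use assms in auto)
  then show "u \<rightarrow>\<^sup>*\<^bsub>with_proj T\<^esub> v" by (simp add: reachable_def)
qed

lemma strongly_connected_with_proj_iff:
  assumes "parcs T \<subseteq> pverts T \<times> pverts T"
  shows "strongly_connected (with_proj T) \<longleftrightarrow>
    pverts T \<noteq> {} \<and> (\<forall>u\<in>pverts T. \<forall>v\<in>pverts T. (u, v) \<in> (parcs T)\<^sup>*)"
  using assms by (auto simp: strongly_connected_def reachable_with_proj_iff)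

lemma connected_with_projI:
  assumes "parcs T \<subseteq> pverts T \<times> pverts T" "r \<in> pverts T"
    and "\<forall>v\<in>pverts T. (r, v) \<in> (parcs T \<union> (parcs T)\<inverse>)\<^sup>*"
  shows "connected (with_proj T)"
proof -
  let ?M = "mk_symmetric (with_proj T)" and ?R = "parcs T \<union> (parcs T)\<inverse>"
  have arcs: "parcs ?M = ?R" by (auto simp: parcs_mk_symmetric)
  then have wf: "parcs ?M \<subseteq> pverts ?M \<times> pverts ?M" using assms(1) by auto
  have "(u, v) \<in> ?R\<^sup>*" if "u \<in> pverts T" "v \<in> pverts T" for u v
  proof -
    have "(u, r) \<in> (?R\<inverse>)\<^sup>*" using assms(3) that(1) by (simp add: rtrancl_converse)
    moreover have "?R\<inverse> = ?R" by auto
    ultimately show ?thesis using assms(3) that(2) by (metis rtrancl_trans)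
  qed
  then show ?thesis
    using assms(2) arcs unfolding connected_def strongly_connected_with_proj_iff[OF wf] by auto
qed

text \<open>On an underlying cycle, both arcs at a vertex of greatest depth would have to enter it.\<close>

lemma no_underlying_cycle:
  fixes d :: "'a \<Rightarrow> nat"
  assumes "inj_on snd (parcs T)" "\<forall>(u, v) \<in> parcs T. d v = Suc (d u)"
  shows "\<not> underlying_cycle T vs es"
proof
  assume "underlying_cycle T vs es"
  then have vs: "vs \<noteq> []" "length es = length vs" "distinct es" "set es \<subseteq> parcs T"
    and arc: "\<And>i. i < length vs \<Longrightarrow> es ! i = (vs ! i, vs ! (Suc i mod length vs)) \<or>
                      es ! i = (vs ! (Suc i mod length vs), vs ! i)"
    unfolding underlying_cycle_def by auto
  let ?L = "length vs"
  obtain j where j: "j < ?L" "\<forall>i<?L. d (vs ! i) \<le> d (vs ! j)"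
  proof -
    have "finite (d ` set vs)" "d ` set vs \<noteq> {}" using vs by auto
    then have "Max (d ` set vs) \<in> d ` set vs" by (rule Max_in)
    then obtain j where "j < ?L" "d (vs ! j) = Max (d ` set vs)"
      by (metis (no_types, lifting) imageE in_set_conv_nth)
    then show thesis using that by (metis List.finite_set Max_ge finite_imageI imageI nth_mem)
  qed
  have enters: "snd (es ! i) = vs ! j" if i: "i < ?L" "vs ! j = vs ! i \<or> vs ! j = vs ! (Suc i mod ?L)" for i
  proof -
    have k: "Suc i mod ?L < ?L" using vs by simp
    have "es ! i \<in> parcs T" using vs i(1) by (metis nth_mem subsetD)
    then have "d (snd (es ! i)) = Suc (d (fst (es ! i)))" using assms(2) by (auto simp: case_prod_unfold)
    then show ?thesis using arc[OF i(1)] i j(2)[rule_format, OF i(1)] j(2)[rule_format, OF k] by auto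
  qed
  \<comment> \<open>\<open>i\<close> is the cyclic predecessor of \<open>j\<close>, so
    \<open>es ! i\<close> and \<open>es ! j\<close> are the two arcs at the deepest vertex. If they
    coincide, the cycle is a loop, which the depth function forbids.\<close>
  define i where "i = (if j = 0 then ?L - 1 else j - 1)"
  have i: "i < ?L" "Suc i mod ?L = j" using j(1) by (auto simp: i_def)
  have "es ! i \<in> parcs T" "es ! j \<in> parcs T" using vs i(1) j(1) by (metis nth_mem subsetD)+
  moreover have "snd (es ! i) = snd (es ! j)" using enters[of i] enters[of j] i j by simp
  ultimately have "es ! i = es ! j" using assms(1) by (simp add: inj_on_def)
  then have "i = j" using vs i(1) j(1) by (simp add: nth_eq_iff_index_eq)
  then have "?L = 1" using i by (auto simp: i_def split: if_splits)
  then have "fst (es ! j) = snd (es ! j)" using arc[OF j(1)] j(1) by auto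
  then show False using \<open>es ! j \<in> parcs T\<close> assms(2) by (auto simp: case_prod_unfold)
qed

definition reverse :: "'a pair_pre_digraph \<Rightarrow> 'a pair_pre_digraph" where
  "reverse T = \<lparr> pverts = pverts T, parcs = (parcs T)\<inverse> \<rparr>"

lemma reverse_simps [simp]:
  "pverts (reverse T) = pverts T" "parcs (reverse T) = (parcs T)\<inverse>" "reverse (reverse T) = T"
  by (simp_all add: reverse_def)

lemma underlying_cycle_reverse:
  assumes "underlying_cycle T vs es"
  shows "underlying_cycle (reverse T) vs (map prod.swap es)"
proof -
  have "prod.swap ` set es \<subseteq> (parcs T)\<inverse>" using assms by (auto simp: underlying_cycle_def)
  moreover have "map prod.swap es ! i = (vs ! i, vs ! (Suc i mod length vs)) \<or>
      map prod.swap es ! i = (vs ! (Suc i mod length vs), vs ! i)" if "i < length vs" for i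
    using assms that unfolding underlying_cycle_def by auto
  ultimately show ?thesis
    using assms by (auto simp: underlying_cycle_def distinct_map inj_on_def)
qed

lemma underlying_tree_reverse: "underlying_tree (reverse T) \<longleftrightarrow> underlying_tree T"
proof -
  have "mk_symmetric (with_proj (reverse T)) = mk_symmetric (with_proj T)"
    by (auto simp: mk_symmetric_def)
  then have "connected (with_proj (reverse T)) = connected (with_proj T)"
    by (simp add: connected_def)
  moreover have "(\<exists>vs es. underlying_cycle (reverse T) vs es) = (\<exists>vs es. underlying_cycle T vs es)"
    using underlying_cycle_reverse[of T] underlying_cycle_reverse[of "reverse T"] unfolding reverse_simps by blast
  ultimately show ?thesis by (auto simp: underlying_tree_def)
qed

lemma spanning_out_branching_reverse:
  "spanning_out_branching (reverse G) r (reverse T) \<longleftrightarrow> spanning_in_branching G r T"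
proof -
  have sp: "spanning (with_proj (reverse T)) (with_proj (reverse G)) = spanning (with_proj T) (with_proj G)"
    by (auto simp: spanning_with_proj_iff)
  show ?thesis
  \<comment> \<open>Reachability translates into a statement on arcs only if the arcs stay within
    the vertices, which spanning provides; without it both sides are false.\<close>
  proof (cases "spanning (with_proj T) (with_proj G)")
    case True
    then have wf: "parcs T \<subseteq> pverts T \<times> pverts T" "pverts T = pverts G"
      by (auto simp: spanning_with_proj_iff)
    then have wf': "parcs (reverse T) \<subseteq> pverts (reverse T) \<times> pverts (reverse T)" by auto
    have "(r \<rightarrow>\<^sup>*\<^bsub>with_proj (reverse T)\<^esub> v) = (v \<rightarrow>\<^sup>*\<^bsub>with_proj T\<^esub> r)" if "v \<in> pverts G" for v
    proof -
      have "(v, r) \<in> (parcs T)\<^sup>* \<Longrightarrow> v \<in> pverts T \<Longrightarrow> r \<in> pverts T"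
        using wf by (auto elim: rtranclE)
      then show ?thesis
        using that wf by (auto simp: reachable_with_proj_iff[OF wf(1)] reachable_with_proj_iff[OF wf'] rtrancl_converse
          elim: converse_rtranclE)
    qed
    then show ?thesis
      by (simp add: spanning_out_branching_def spanning_in_branching_def sp underlying_tree_reverse)
  qed (simp add: spanning_out_branching_def spanning_in_branching_def sp)
qed

lemma branching_on_spanning:
  assumes "branching_on (pverts G) r (parcs T)" "pverts T = pverts G" "parcs T \<subseteq> parcs G"
    and "parcs G \<subseteq> pverts G \<times> pverts G"
  shows "spanning_out_branching G r T"
proof -
  have r: "r \<in> pverts T" and reach: "\<forall>v\<in>pverts T. (r, v) \<in> (parcs T)\<^sup>*"
    and wf: "parcs T \<subseteq> pverts T \<times> pverts T"
    using assms by (auto simp: branching_on_def)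
  obtain d :: "'a \<Rightarrow> nat" where "\<forall>(u, v) \<in> parcs T. d v = Suc (d u)"
    using assms(1) by (auto simp: branching_on_def)
  then have "\<nexists>vs es. underlying_cycle T vs es"
    using no_underlying_cycle[of T d] assms(1) by (auto simp: branching_on_def)
  moreover have "connected (with_proj T)"
    using connected_with_projI[OF wf r] reach rtrancl_mono[of "parcs T" "parcs T \<union> (parcs T)\<inverse>"] by blast
  ultimately show ?thesis
    using assms r reach
    by (simp add: spanning_out_branching_def underlying_tree_def spanning_with_proj_iff
        reachable_with_proj_iff[OF wf])
qed

lemma spanning_out_branching_reach:
  assumes "spanning_out_branching G r T"
  shows "pverts T = pverts G" "parcs T \<subseteq> parcs G" "\<forall>v\<in>pverts G. (r, v) \<in> (parcs T)\<^sup>*"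
proof -
  have "spanning (with_proj T) (with_proj G)" using assms by (simp add: spanning_out_branching_def)
  then have *: "pverts T = pverts G" "parcs T \<subseteq> parcs G" "parcs T \<subseteq> pverts T \<times> pverts T"
    by (auto simp: spanning_with_proj_iff)
  then show "pverts T = pverts G" "parcs T \<subseteq> parcs G" "\<forall>v\<in>pverts G. (r, v) \<in> (parcs T)\<^sup>*"
    using assms by (auto simp: spanning_out_branching_def reachable_with_proj_iff[OF *(3)])
qed

lemma spanning_in_branching_reach:
  assumes "spanning_in_branching G r T"
  shows "pverts T = pverts G" "parcs T \<subseteq> parcs G" "\<forall>v\<in>pverts G. (v, r) \<in> (parcs T)\<^sup>*"
  using spanning_out_branching_reach[of "reverse G" r "reverse T"] assms
  by (auto simp: spanning_out_branching_reverse rtrancl_converse)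


section \<open>The approximation guarantee\<close>

lemma zero_one_matD: "zero_one_mat m W \<Longrightarrow> i < m \<Longrightarrow> j < m \<Longrightarrow> W $$ (i, j) \<in> {0, 1}"
  using elements_matI[of W m m i j "W $$ (i, j)"] by (auto simp: zero_one_mat_def)

lemma networking_cost_eq:
  assumes "zero_one_mat m W"
  shows "networking_cost m b W = subdigraph_cost b (network_of m W)"
proof -
  have "networking_cost m b W = (\<Sum>(i, j)\<in>{..<m} \<times> {..<m}. b $$ (i, j) * real (W $$ (i, j)))"
    by (simp add: networking_cost_def sum.cartesian_product)
  also have "\<dots> = (\<Sum>e\<in>{..<m} \<times> {..<m}. if e \<in> parcs (network_of m W) then b $$ e else 0)"
  proof (rule sum.cong[OF refl])
    fix e assume "e \<in> {..<m} \<times> {..<m}"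
    then obtain i j where e: "e = (i, j)" and ij: "i < m" "j < m" by auto
    then have "W $$ (i, j) = 0 \<or> W $$ (i, j) = 1" using zero_one_matD[OF assms ij] by simp
    then show "(case e of (i, j) \<Rightarrow> b $$ (i, j) * real (W $$ (i, j))) =
        (if e \<in> parcs (network_of m W) then b $$ e else 0)"
      using e ij by (auto simp: network_of_def)
  qed
  also have "\<dots> = (\<Sum>e\<in>({..<m} \<times> {..<m}) \<inter> parcs (network_of m W). b $$ e)"
    by (simp add: sum.inter_restrict)
  also have "({..<m} \<times> {..<m}) \<inter> parcs (network_of m W) = parcs (network_of m W)"
    by (auto simp: network_of_def)
  finally show ?thesis by (simp add: subdigraph_cost_def case_prod_unfold)
qed

text \<open>Dimensions are fixed and entries are 0 or 1, so the arcs determine the matrix.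
  Finiteness is what makes \<open>Min\<close> in \<open>optimal_cost\<close> an attained
  minimum.\<close>

lemma finite_feasible: "finite {W. feasible m G W}"
proof (rule finite_imageD)
  show "finite ((\<lambda>W. parcs (network_of m W)) ` {W. feasible m G W})"
    by (rule finite_subset[of _ "Pow ({..<m} \<times> {..<m})"]) (auto simp: network_of_def)
  show "inj_on (\<lambda>W. parcs (network_of m W)) {W. feasible m G W}"
  proof (rule inj_onI)
    fix W W' assume *: "W \<in> {W. feasible m G W}" "W' \<in> {W. feasible m G W}"
      "parcs (network_of m W) = parcs (network_of m W')"
    then have c: "W \<in> carrier_mat m m" "W' \<in> carrier_mat m m"
      by (auto simp: feasible_def zero_one_mat_def)
    have "W $$ (i, j) = W' $$ (i, j)" if ij: "i < m" "j < m" for i j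
    proof -
      have "W $$ (i, j) \<in> {0, 1}" "W' $$ (i, j) \<in> {0, 1}"
        using * ij zero_one_matD[of m W i j] zero_one_matD[of m W' i j] by (simp_all add: feasible_def)
      moreover have "W $$ (i, j) = 1 \<longleftrightarrow> W' $$ (i, j) = 1"
        using *(3) ij by (auto simp: network_of_def)
      ultimately show ?thesis by auto
    qed
    then show "W = W'" using c by (intro eq_matI) auto
  qed
qed

lemma sensor_networkD:
  assumes "sensor_network m G b"
  shows "pverts G = {0..<m}" "parcs G \<subseteq> {0..<m} \<times> {0..<m}" "finite (parcs G)"
    "\<And>i j. (i, j) \<in> parcs G \<Longrightarrow> 0 < b $$ (i, j)" "0 < m"
    "\<And>u v. u < m \<Longrightarrow> v < m \<Longrightarrow> (u, v) \<in> (parcs G)\<^sup>*"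
proof -
  show V: "pverts G = {0..<m}" using assms by (simp add: sensor_network_def)
  show E: "parcs G \<subseteq> {0..<m} \<times> {0..<m}"
    using assms V by (auto simp: sensor_network_def pair_wf_digraph_iff)
  then show "finite (parcs G)" using finite_subset by blast
  show "\<And>i j. (i, j) \<in> parcs G \<Longrightarrow> 0 < b $$ (i, j)" using assms by (auto simp: sensor_network_def)
  have "strongly_connected (with_proj G)" using assms by (simp add: sensor_network_def)
  then show "0 < m" "\<And>u v. u < m \<Longrightarrow> v < m \<Longrightarrow> (u, v) \<in> (parcs G)\<^sup>*"
    using V E by (simp_all add: strongly_connected_with_proj_iff)
qed

lemma sensor_network_reverse:
  assumes "sensor_network m G b"
  shows "sensor_network m (reverse G) (transpose_mat b)"
proof -
  note G = sensor_networkD[OF assms]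
  have "b \<in> carrier_mat m m" using assms by (simp add: sensor_network_def)
  then have "0 < transpose_mat b $$ (i, j)" if "(j, i) \<in> parcs G" for i j
    using that G(2) G(4)[of j i] by auto
  moreover have "strongly_connected (with_proj (reverse G))"
    by (subst strongly_connected_with_proj_iff) (use G in \<open>auto simp: rtrancl_converse\<close>)
  ultimately show ?thesis
    using G \<open>b \<in> carrier_mat m m\<close> by (auto simp: sensor_network_def pair_wf_digraph_iff)
qed

lemma subdigraph_cost_reverse:
  assumes "b \<in> carrier_mat m m" "parcs T \<subseteq> {0..<m} \<times> {0..<m}"
  shows "subdigraph_cost (transpose_mat b) (reverse T) = subdigraph_cost b T"
  unfolding subdigraph_cost_def
  by (rule sum.reindex_bij_witness[of _ prod.swap prod.swap]) (use assms in auto)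

lemma min_spanning_in_branching_reverse:
  assumes "sensor_network m G b"
  shows "min_spanning_out_branching (reverse G) (transpose_mat b) r (reverse T) \<longleftrightarrow>
    min_spanning_in_branching G b r T"
proof -
  have b: "b \<in> carrier_mat m m" using assms by (simp add: sensor_network_def)
  have cost: "subdigraph_cost (transpose_mat b) (reverse T) = subdigraph_cost b T"
    if "spanning_in_branching G r T" for T
    using subdigraph_cost_reverse[OF b] spanning_in_branching_reach[OF that] sensor_networkD[OF assms] by auto
  \<comment> \<open>Reversal is an involution, so the competitors of \<open>reverse T\<close> are
    exactly the reversals of the competitors of \<open>T\<close>.\<close>
  have all: "(\<forall>T. P T) = (\<forall>T. P (reverse T))" for P :: "nat pair_pre_digraph \<Rightarrow> bool"
    by (metis reverse_simps(3))
  show ?thesis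
    unfolding min_spanning_out_branching_def min_spanning_in_branching_def is_arg_min_def
      all[of "\<lambda>Y. \<not> (spanning_out_branching (reverse G) r Y \<and> _ Y)"] not_ex
    using cost by (auto simp: spanning_out_branching_reverse)
qed

text \<open>A reaching arc set contains a branching, and dropping its other arcs cannot raise the
  cost because links cost something positive.\<close>

lemma min_out_branching_le_subdigraph:
  assumes net: "sensor_network m G b" and r: "r < m"
    and T: "min_spanning_out_branching G b r T"
    and H: "E \<subseteq> parcs G" "\<forall>v<m. (r, v) \<in> E\<^sup>*"
  shows "subdigraph_cost b T \<le> (\<Sum>(i, j)\<in>E. b $$ (i, j))"
proof -
  note G = sensor_networkD[OF net]
  obtain F where F: "F \<subseteq> E" "branching_on {0..<m} r F"
    using branching_exists[of "{0..<m}" r E] H r G(2) by auto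
  let ?T = "\<lparr> pverts = {0..<m}, parcs = F \<rparr>"
  have "spanning_out_branching G r ?T"
    using F H G by (intro branching_on_spanning) auto
  then have "subdigraph_cost b T \<le> subdigraph_cost b ?T"
    using T by (auto simp: min_spanning_out_branching_def is_arg_min_def not_less)
  also have "\<dots> \<le> (\<Sum>(i, j)\<in>E. b $$ (i, j))"
    unfolding subdigraph_cost_def
  proof (rule sum_mono2)
    show "finite E" using H(1) G(3) finite_subset by blast
    show "0 \<le> (case e of (i, j) \<Rightarrow> b $$ (i, j))" if "e \<in> E - parcs ?T" for e
      using that H(1) less_imp_le[OF G(4)] by (cases e) auto
  qed (use F in simp)
  finally show ?thesis .
qed

lemma min_in_branching_le_subdigraph:
  assumes net: "sensor_network m G b" and r: "r < m"
    and T: "min_spanning_in_branching G b r T"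
    and H: "E \<subseteq> parcs G" "\<forall>v<m. (v, r) \<in> E\<^sup>*"
  shows "subdigraph_cost b T \<le> (\<Sum>(i, j)\<in>E. b $$ (i, j))"
proof -
  note G = sensor_networkD[OF net]
  have b: "b \<in> carrier_mat m m" using net by (simp add: sensor_network_def)
  have "spanning_in_branching G r T"
    using T by (simp add: min_spanning_in_branching_def is_arg_min_def)
  from spanning_in_branching_reach[OF this]
  have "subdigraph_cost b T = subdigraph_cost (transpose_mat b) (reverse T)"
    using subdigraph_cost_reverse[OF b, of T] G by auto
  also have "\<dots> \<le> (\<Sum>(i, j)\<in>E\<inverse>. transpose_mat b $$ (i, j))"
    using min_spanning_in_branching_reverse[OF net] T H r
    by (intro min_out_branching_le_subdigraph[OF sensor_network_reverse[OF net]]) (auto simp: rtrancl_converse)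
  also have "\<dots> = (\<Sum>(i, j)\<in>E. b $$ (i, j))"
    by (rule sum.reindex_bij_witness[of _ prod.swap prod.swap]) (use b H(1) G(2) in auto)
  finally show ?thesis .
qed

text \<open>Any two vertices are joined through the root: to it along the in-branching, from it
  along the out-branching. Links shared by both branchings are paid only once, so the cost of the
  union is at most the sum of the two costs.\<close>

lemma min_branching_union_2_approx:
  assumes net: "sensor_network m G b" and r: "r \<in> pverts G" and W: "min_branching_union m G b r W"
  shows "feasible m G W \<and> networking_cost m b W \<le> 2 * optimal_cost m G b"
proof -
  note G = sensor_networkD[OF net]
  have r': "r < m" using r G by simp
  obtain Tin Tout where Ti: "min_spanning_in_branching G b r Tin"
    and To: "min_spanning_out_branching G b r Tout"
    and U: "with_proj (network_of m W) = union (with_proj Tin) (with_proj Tout)"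
    and zo: "zero_one_mat m W"
    using W unfolding min_branching_union_def by blast
  have si: "spanning_in_branching G r Tin" and so: "spanning_out_branching G r Tout"
    using Ti To by (simp_all add: min_spanning_in_branching_def min_spanning_out_branching_def is_arg_min_def)
  note ri = spanning_in_branching_reach[OF si] and ro = spanning_out_branching_reach[OF so]
  have arcs: "parcs (network_of m W) = parcs Tin \<union> parcs Tout"
    using arg_cong[OF U, of arcs] by (simp add: union_def)
  have verts: "pverts (network_of m W) = {0..<m}" by (simp add: network_of_def)
  have sp: "spanning (with_proj (network_of m W)) (with_proj G)"
    unfolding spanning_with_proj_iff using arcs verts ri ro G by auto
  have "(u, v) \<in> (parcs Tin \<union> parcs Tout)\<^sup>*" if "u < m" "v < m" for u v
  proof -
    have "(u, r) \<in> (parcs Tin)\<^sup>*" "(r, v) \<in> (parcs Tout)\<^sup>*" using ri ro that G by auto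
    then have "(u, r) \<in> (parcs Tin \<union> parcs Tout)\<^sup>*" "(r, v) \<in> (parcs Tin \<union> parcs Tout)\<^sup>*"
      by (auto intro: in_rtrancl_UnI)
    then show ?thesis by (rule rtrancl_trans)
  qed
  moreover have "parcs (network_of m W) \<subseteq> pverts (network_of m W) \<times> pverts (network_of m W)"
    by (auto simp: network_of_def)
  ultimately have "strongly_connected (with_proj (network_of m W))"
    using G(5) by (simp add: strongly_connected_with_proj_iff verts arcs)
  with sp zo have fe: "feasible m G W" by (simp add: feasible_def)
  have "networking_cost m b W \<le> 2 * networking_cost m b W'" if W': "feasible m G W'" for W'
  proof -
    have zo': "zero_one_mat m W'" and sp': "spanning (with_proj (network_of m W')) (with_proj G)"
      and sc': "strongly_connected (with_proj (network_of m W'))"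
      using W' by (auto simp: feasible_def)
    let ?E = "parcs (network_of m W')"
    have E: "?E \<subseteq> parcs G" using sp' by (simp add: spanning_with_proj_iff)
    have reach: "(u, v) \<in> ?E\<^sup>*" if "u < m" "v < m" for u v
    proof -
      have "?E \<subseteq> pverts (network_of m W') \<times> pverts (network_of m W')" by (auto simp: network_of_def)
      then show ?thesis using sc' that by (simp add: strongly_connected_with_proj_iff network_of_def)
    qed
    have fin: "finite (parcs Tin)" "finite (parcs Tout)" using ri ro G(3) finite_subset by blast+
    have "networking_cost m b W = (\<Sum>(i, j)\<in>parcs Tin \<union> parcs Tout. b $$ (i, j))"
      by (simp add: networking_cost_eq[OF zo] subdigraph_cost_def arcs)
    also have "\<dots> = (\<Sum>(i, j)\<in>parcs Tin. b $$ (i, j)) + (\<Sum>(i, j)\<in>parcs Tout. b $$ (i, j))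
        - (\<Sum>(i, j)\<in>parcs Tin \<inter> parcs Tout. b $$ (i, j))"
      using sum.union_inter[OF fin, of "\<lambda>(i, j). b $$ (i, j)"] by simp
    also have "\<dots> \<le> subdigraph_cost b Tin + subdigraph_cost b Tout"
    proof -
      have "0 \<le> (\<Sum>(i, j)\<in>parcs Tin \<inter> parcs Tout. b $$ (i, j))"
        using G(4) ri(2) by (intro sum_nonneg) (auto intro: less_imp_le)
      then show ?thesis by (simp add: subdigraph_cost_def)
    qed
    also have "\<dots> \<le> 2 * (\<Sum>(i, j)\<in>?E. b $$ (i, j))"
      using min_in_branching_le_subdigraph[OF net r' Ti E] min_out_branching_le_subdigraph[OF net r' To E]
        reach r' by simp
    also have "\<dots> = 2 * networking_cost m b W'"
      by (simp add: networking_cost_eq[OF zo'] subdigraph_cost_def)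
    finally show ?thesis .
  qed
  \<comment> \<open>The union is itself feasible, so the minimum ranges over a nonempty finite set
    and belongs to some feasible matrix.\<close>
  moreover have "optimal_cost m G b \<in> networking_cost m b ` {W. feasible m G W}"
    unfolding optimal_cost_def using fe finite_feasible by (intro Min_in) auto
  ultimately have "networking_cost m b W \<le> 2 * optimal_cost m G b" by auto
  with fe show ?thesis by simp
qed

section \<open>A program logic with a clock\<close>

text \<open>Total correctness with a clock: a halting run is asserted, \<open>t\<close> is the time
  spent before \<open>c\<close>, and the postcondition receives the time after it. Sequencing
  thereby becomes plain composition.\<close>

definition wp :: "com \<Rightarrow> (nat \<Rightarrow> store \<Rightarrow> bool) \<Rightarrow> nat \<Rightarrow> store \<Rightarrow> bool" where
  "wp c Q t s \<longleftrightarrow> (\<exists>d s'. exec c s d s' \<and> Q (t + d) s')"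

lemma exec_Skip_iff: "exec Skip s d s' \<longleftrightarrow> d = 1 \<and> s' = s"
  using exec.Skip[of s] by (auto elim: SkipE)

lemma exec_NAssign_iff:
  "exec (NAssign a i x) s d s' \<longleftrightarrow> d = 1 + ncost i + ncost x \<and> s' = set_nat a (nval i s) (nval x s) s"
  using exec.NAssign[of a i x s] by (auto elim: NAssignE)

lemma exec_RAssign_iff:
  "exec (RAssign a i x) s d s' \<longleftrightarrow> d = 1 + ncost i + rcost x \<and> s' = set_real a (nval i s) (rval x s) s"
  using exec.RAssign[of a i x s] by (auto elim: RAssignE)

lemma exec_Cond_iff:
  "exec (Cond e c d) s t s' \<longleftrightarrow>
     (\<exists>t'. t = 1 + bcost e + t' \<and> exec (if bval e s then c else d) s t' s')"
proof
  assume "exec (Cond e c d) s t s'"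
  then show "\<exists>t'. t = 1 + bcost e + t' \<and> exec (if bval e s then c else d) s t' s'"
    by (rule CondE) auto
next
  assume "\<exists>t'. t = 1 + bcost e + t' \<and> exec (if bval e s then c else d) s t' s'"
  then obtain t' where "t = 1 + bcost e + t'" "exec (if bval e s then c else d) s t' s'" by blast
  then show "exec (Cond e c d) s t s'"
    using exec.CondTrue[of e s c t' s' d] exec.CondFalse[of e s d t' s' c] by (cases "bval e s") auto
qed

lemma wp_Skip [simp]: "wp Skip Q t s = Q (Suc t) s"
  by (simp add: wp_def exec_Skip_iff)

lemma wp_NAssign [simp]:
  "wp (NAssign a i x) Q t s = Q (t + (1 + ncost i + ncost x)) (set_nat a (nval i s) (nval x s) s)"
  by (simp add: wp_def exec_NAssign_iff)

lemma wp_RAssign [simp]: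
  "wp (RAssign a i x) Q t s = Q (t + (1 + ncost i + rcost x)) (set_real a (nval i s) (rval x s) s)"
  by (simp add: wp_def exec_RAssign_iff)

lemma wp_Seq [simp]: "wp (Seq c d) Q = wp c (wp d Q)"
proof (intro ext iffI)
  fix t s assume "wp (Seq c d) Q t s"
  then obtain k s2 where "exec (Seq c d) s k s2" "Q (t + k) s2" by (auto simp: wp_def)
  then obtain t1 s1 t2 where "exec c s t1 s1" "exec d s1 t2 s2" "Q (t + t1 + t2) s2"
    by (auto elim!: SeqE simp: add.assoc)
  then show "wp c (wp d Q) t s" unfolding wp_def by blast
next
  fix t s assume "wp c (wp d Q) t s"
  then obtain t1 s1 t2 s2 where "exec c s t1 s1" "exec d s1 t2 s2" "Q (t + t1 + t2) s2"
    unfolding wp_def by blast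
  then show "wp (Seq c d) Q t s"
    unfolding wp_def using exec.Seq[of c s t1 s1 d t2 s2] by (metis add.assoc)
qed

lemma wp_Cond [simp]:
  "wp (Cond e c d) Q t s = (if bval e s then wp c Q (t + (1 + bcost e)) s else wp d Q (t + (1 + bcost e)) s)"
proof -
  let ?c = "if bval e s then c else d"
  have "wp (Cond e c d) Q t s = wp ?c Q (t + (1 + bcost e)) s"
  proof
    assume "wp (Cond e c d) Q t s"
    then obtain k s' where k: "exec (Cond e c d) s k s'" "Q (t + k) s'" unfolding wp_def by blast
    then obtain t' where "exec ?c s t' s'" "k = 1 + bcost e + t'" unfolding exec_Cond_iff by blast
    moreover from this have "Q (t + (1 + bcost e) + t') s'" using k(2) by (simp add: add.assoc)
    ultimately show "wp ?c Q (t + (1 + bcost e)) s" unfolding wp_def by blast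
  next
    assume "wp ?c Q (t + (1 + bcost e)) s"
    then obtain t' s' where t': "exec ?c s t' s'" "Q (t + (1 + bcost e) + t') s'"
      unfolding wp_def by blast
    then have "exec (Cond e c d) s (1 + bcost e + t') s'" unfolding exec_Cond_iff by blast
    moreover have "Q (t + (1 + bcost e + t')) s'" using t'(2) by (simp only: add.assoc)
    ultimately show "wp (Cond e c d) Q t s" unfolding wp_def by blast
  qed
  then show ?thesis by simp
qed

lemma wp_mono: "wp c Q t s \<Longrightarrow> (\<And>d s'. Q (t + d) s' \<Longrightarrow> Q' (t' + d) s') \<Longrightarrow> wp c Q' t' s"
  unfolding wp_def by blast

text \<open>A syntactic overapproximation of the arrays written; through \<open>frame\<close> it
  yields the invariance of all other arrays without mentioning them in loop invariants.\<close>

primrec nwr :: "com \<Rightarrow> string set" where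
  "nwr Skip = {}"
| "nwr (NAssign a i x) = {a}"
| "nwr (RAssign a i x) = {}"
| "nwr (Seq c d) = nwr c \<union> nwr d"
| "nwr (Cond e c d) = nwr c \<union> nwr d"
| "nwr (While e c) = nwr c"

primrec rwr :: "com \<Rightarrow> string set" where
  "rwr Skip = {}"
| "rwr (NAssign a i x) = {}"
| "rwr (RAssign a i x) = {a}"
| "rwr (Seq c d) = rwr c \<union> rwr d"
| "rwr (Cond e c d) = rwr c \<union> rwr d"
| "rwr (While e c) = rwr c"

lemma nats_set_nat: "nats (set_nat a i v s) b = (if a = b then (nats s b)(i := v) else nats s b)"
  by (auto simp: set_nat_def)

lemma reals_set_real: "reals (set_real a i v s) b = (if a = b then (reals s b)(i := v) else reals s b)"
  by (auto simp: set_real_def)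

lemma reals_set_nat [simp]: "reals (set_nat a i v s) = reals s"
  by (simp add: set_nat_def)

lemma nats_set_real [simp]: "nats (set_real a i v s) = nats s"
  by (simp add: set_real_def)

lemmas set_simps = nats_set_nat reals_set_real

definition frame :: "com \<Rightarrow> store \<Rightarrow> store \<Rightarrow> bool" where
  "frame c s s' \<longleftrightarrow> (\<forall>a. a \<notin> nwr c \<longrightarrow> nats s' a = nats s a) \<and> (\<forall>a. a \<notin> rwr c \<longrightarrow> reals s' a = reals s a)"

lemma frameD:
  "frame c s s' \<Longrightarrow> a \<notin> nwr c \<Longrightarrow> nats s' a = nats s a"
  "frame c s s' \<Longrightarrow> a \<notin> rwr c \<Longrightarrow> reals s' a = reals s a"
  by (auto simp: frame_def)

lemma exec_frame: "exec c s t s' \<Longrightarrow> frame c s s'"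
  by (induction rule: exec.induct) (auto simp: frame_def set_simps)

lemma wp_frame: "wp c (\<lambda>t s'. frame c s s' \<longrightarrow> Q t s') t s \<Longrightarrow> wp c Q t s"
  unfolding wp_def using exec_frame by blast

text \<open>\<open>\<Phi>\<close> bounds the time still to be spent. Every round pays at least for
  its guard, so \<open>\<Phi>\<close> strictly decreases and termination comes with the time bound.
  The last, failing guard is charged separately.\<close>

lemma wp_While:
  fixes \<Phi> :: "store \<Rightarrow> nat"
  assumes init: "I s"
    and step: "\<And>s'. I s' \<Longrightarrow> frame c s s' \<Longrightarrow> bval e s' \<Longrightarrow>
        wp c (\<lambda>d s''. I s'' \<and> Suc (bcost e) + d + \<Phi> s'' \<le> \<Phi> s') 0 s'"
    and post: "\<And>t' s'. I s' \<Longrightarrow> frame c s s' \<Longrightarrow> \<not> bval e s' \<Longrightarrow> t' \<le> t + \<Phi> s + Suc (bcost e) \<Longrightarrow> Q t' s'"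
  shows "wp (While e c) Q t s"
proof -
  have "\<exists>d s''. exec (While e c) s' d s'' \<and> I s'' \<and> frame c s s'' \<and> \<not> bval e s'' \<and> d \<le> \<Phi> s' + Suc (bcost e)"
    if "I s'" "frame c s s'" for s'
    using that
  proof (induction "\<Phi> s'" arbitrary: s' rule: less_induct)
    case less
    show ?case
    proof (cases "bval e s'")
      case False
      then show ?thesis using less.prems exec.WhileFalse[OF False, of c] by fastforce
    next
      case True
      then obtain d s1 where d: "exec c s' d s1" "I s1" "Suc (bcost e) + d + \<Phi> s1 \<le> \<Phi> s'"
        using step[OF less.prems True] unfolding wp_def by auto
      have fr: "frame c s s1"
        using less.prems(2) exec_frame[OF d(1)] by (auto simp: frame_def)
      have "\<Phi> s1 < \<Phi> s'" using d(3) by simp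
      from less.hyps[OF this d(2) fr] obtain d' s'' where
        d': "exec (While e c) s1 d' s''" "I s''" "frame c s s''" "\<not> bval e s''" "d' \<le> \<Phi> s1 + Suc (bcost e)"
        by blast
      have "exec (While e c) s' (1 + bcost e + d + d') s''"
        by (rule exec.WhileTrue[OF True d(1) d'(1)])
      moreover have "1 + bcost e + d + d' \<le> \<Phi> s' + Suc (bcost e)" using d(3) d'(5) by simp
      ultimately show ?thesis using d' by blast
    qed
  qed
  moreover have "frame c s s" by (simp add: frame_def)
  ultimately obtain d s'' where "exec (While e c) s d s''" "I s''" "frame c s s''" "\<not> bval e s''"
    "d \<le> \<Phi> s + Suc (bcost e)"
    using init by blast
  then show ?thesis unfolding wp_def using post by (metis add.assoc add_le_cancel_left)
qed

abbreviation Var :: "string \<Rightarrow> nexp" where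
  "Var x \<equiv> NCell x (NConst 0)"

abbreviation setv :: "string \<Rightarrow> nexp \<Rightarrow> com" where
  "setv x e \<equiv> NAssign x (NConst 0) e"

definition For :: "string \<Rightarrow> string \<Rightarrow> com \<Rightarrow> com" where
  "For x N c = Seq (setv x (NConst 0))
     (While (NLess (Var x) (Var N)) (Seq c (setv x (NAdd (Var x) (NConst 1)))))"

lemma For_writes [simp]: "nwr (For x N c) = insert x (nwr c)" "rwr (For x N c) = rwr c"
  by (auto simp: For_def)

text \<open>Per round, the guard with its jump takes 6 operations and the increment 6, hence
  \<open>B + 12\<close>. The initial assignment takes 3 and the failing guard 6, hence
  \<open>9\<close>.\<close>

lemma wp_For:
  assumes fresh: "x \<notin> nwr c" "N \<notin> nwr c" "N \<noteq> x"
    and n: "nats s N 0 = n"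
    and init: "I 0 (set_nat x 0 0 s)"
    and step: "\<And>k s'. k < n \<Longrightarrow> frame (For x N c) s s' \<Longrightarrow> nats s' x 0 = k \<Longrightarrow> I k s' \<Longrightarrow>
        wp c (\<lambda>d s''. d \<le> B \<and> I (Suc k) (set_nat x 0 (Suc k) s'')) 0 s'"
    and post: "\<And>t' s'. frame (For x N c) s s' \<Longrightarrow> I n s' \<Longrightarrow> t' \<le> t + n * (B + 12) + 9 \<Longrightarrow> Q t' s'"
  shows "wp (For x N c) Q t s"
proof -
  let ?e = "NLess (Var x) (Var N)" and ?c = "Seq c (setv x (NAdd (Var x) (NConst 1)))"
  let ?s0 = "set_nat x 0 0 s"
  let ?I = "\<lambda>s'. nats s' x 0 \<le> n \<and> nats s' N 0 = n \<and> I (nats s' x 0) s'"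
  have fr: "frame (For x N c) s s'" if "frame ?c ?s0 s'" for s'
    using that by (auto simp: frame_def set_simps)
  have "wp (While ?e ?c) Q (t + 3) ?s0"
  proof (rule wp_While[where I = ?I and \<Phi> = "\<lambda>s'. (n - nats s' x 0) * (B + 12)"])
    show "?I ?s0" using init fresh n by (auto simp: set_simps)
  next
    fix s' assume I: "?I s'" and "frame ?c ?s0 s'" and e: "bval ?e s'"
    then have k: "nats s' x 0 < n" and f: "frame (For x N c) s s'" using fr by auto
    show "wp ?c (\<lambda>d s''. ?I s'' \<and> Suc (bcost ?e) + d + (n - nats s'' x 0) * (B + 12)
        \<le> (n - nats s' x 0) * (B + 12)) 0 s'"
      unfolding wp_Seq
    proof (rule wp_frame, rule wp_mono[OF step[OF k f refl]])
      show "I (nats s' x 0) s'" using I by simp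
    next
      fix d s'' assume *: "0 + d \<le> B \<and> I (Suc (nats s' x 0)) (set_nat x 0 (Suc (nats s' x 0)) s'')"
      have "(n - nats s' x 0) * (B + 12) = (B + 12) + (n - Suc (nats s' x 0)) * (B + 12)"
        using k by (metis Suc_diff_Suc mult_Suc)
      then show "frame c s' s'' \<longrightarrow> wp (setv x (NAdd (Var x) (NConst 1)))
           (\<lambda>d s''. ?I s'' \<and> Suc (bcost ?e) + d + (n - nats s'' x 0) * (B + 12)
            \<le> (n - nats s' x 0) * (B + 12)) (0 + d) s''"
        using * k fresh I by (auto simp: set_simps dest: frameD)
    qed
  next
    fix t' s' assume I: "?I s'" and "frame ?c ?s0 s'" and e: "\<not> bval ?e s'"
      and t': "t' \<le> t + 3 + (n - nats ?s0 x 0) * (B + 12) + Suc (bcost ?e)"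
    then have "nats s' x 0 = n" "frame (For x N c) s s'" using fr by auto
    then show "Q t' s'" using I t' post by (simp add: set_simps)
  qed
  then show ?thesis by (simp add: For_def numeral_3_eq_3)
qed

lemma row_index_eq:
  fixes u :: nat
  assumes "u < m" "u' < m"
  shows "p * m + u = p' * m + u' \<longleftrightarrow> p = p' \<and> u = u'"
proof
  assume eq: "p * m + u = p' * m + u'"
  from arg_cong[OF this, of "\<lambda>x. x div m"] arg_cong[OF this, of "\<lambda>x. x mod m"]
  show "p = p' \<and> u = u'" using assms by simp
qed simp

section \<open>The contraction phase on arrays\<close>

text \<open>A contraction merges the last set of the path into its predecessor until the last position \<open>tp\<close> is \<open>j\<close>, so \<open>j = tp\<close>
  means that none is pending. Cells \<open>p * n + u\<close> of \<open>q\<close> and \<open>h\<close> hold the least reduced cost of an arc from \<open>u\<close> into the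
  \<open>p\<close>-th set and the head of such an arc.\<close>

definition contraction_state :: "nat \<Rightarrow> (nat \<Rightarrow> nat \<Rightarrow> real) \<Rightarrow> nat \<Rightarrow> (nat \<Rightarrow> nat) \<Rightarrow> (nat \<Rightarrow> nat) \<Rightarrow>
    nat \<Rightarrow> (nat \<Rightarrow> nat) \<Rightarrow> nat \<Rightarrow> (nat \<Rightarrow> real) \<Rightarrow> (nat \<Rightarrow> nat) \<Rightarrow> bool" where
  "contraction_state n w K src dst j cmp tp q h \<longleftrightarrow>
     j \<le> tp \<and> tp < n \<and> (\<forall>x<n. cmp x \<le> Suc tp) \<and>
     (\<exists>S y. dual_log n w K src dst S y \<and> path_stack n K src dst S (\<lambda>x. min (cmp x) (Suc j)) j \<and>
        (\<forall>p\<le>tp. min_column n (reduced_cost w K S y) (comp_set n cmp p)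
           (\<lambda>u. q (p * n + u)) (\<lambda>u. h (p * n + u))))"

lemma contraction_stateD:
  assumes "contraction_state n w K src dst tp cmp tp q h"
  obtains S y where "tp < n" "\<forall>x<n. cmp x \<le> Suc tp" "dual_log n w K src dst S y"
    "path_stack n K src dst S cmp tp"
    "\<forall>p\<le>tp. min_column n (reduced_cost w K S y) (comp_set n cmp p)
           (\<lambda>u. q (p * n + u)) (\<lambda>u. h (p * n + u))"
proof -
  obtain S y where *: "tp < n" "\<forall>x<n. cmp x \<le> Suc tp" "dual_log n w K src dst S y"
    "path_stack n K src dst S (\<lambda>x. min (cmp x) (Suc tp)) tp"
    "\<forall>p\<le>tp. min_column n (reduced_cost w K S y) (comp_set n cmp p)
           (\<lambda>u. q (p * n + u)) (\<lambda>u. h (p * n + u))"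
    using assms unfolding contraction_state_def by blast
  have "\<forall>x<n. min (cmp x) (Suc tp) = cmp x" using *(2) by simp
  from path_stack_cong[OF this] *(4) have "path_stack n K src dst S cmp tp" by simp
  with * show thesis using that by blast
qed

lemma contraction_stateI:
  assumes "path_stack n K src dst S cmp tp" "dual_log n w K src dst S y"
    "\<And>p. p \<le> tp \<Longrightarrow> min_column n (reduced_cost w K S y) (comp_set n cmp p)
           (\<lambda>u. q (p * n + u)) (\<lambda>u. h (p * n + u))"
  shows "contraction_state n w K src dst tp cmp tp q h"
proof -
  have le: "\<forall>x<n. cmp x \<le> Suc tp" using assms(1) by (simp add: path_stack_def)
  then have "\<forall>x<n. cmp x = min (cmp x) (Suc tp)" by simp
  from path_stack_cong[OF this] assms(1)
  have "path_stack n K src dst S (\<lambda>x. min (cmp x) (Suc tp)) tp" by simp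
  then show ?thesis
    unfolding contraction_state_def using le assms path_stack_top_less by blast
qed

lemma min_column_cong:
  assumes "\<And>u. u < n \<Longrightarrow> q u = q' u" "\<And>u. u < n \<Longrightarrow> h u = h' u"
  shows "min_column n c A q h = min_column n c A q' h'"
  using assms by (auto simp: min_column_def)

text \<open>The part common to pushing and contracting: the selection is logged and all columns are
  adapted to the new reduced costs before the path changes.\<close>

lemma contraction_state_select:
  assumes cs: "contraction_state n w K src dst tp cmp tp q h"
    and u: "u < n" "cmp u \<noteq> Suc tp"
    and least: "\<forall>u'<n. cmp u' \<noteq> Suc tp \<longrightarrow> q (tp * n + u) \<le> q (tp * n + u')"
    and q1: "\<forall>p\<le>tp. \<forall>x<n. q1 (p * n + x) = (if p = tp then q (p * n + x) - q (tp * n + u) else q (p * n + x))"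
  obtains S y where "path_stack n K src dst S cmp tp" "h (tp * n + u) \<in> comp_set n cmp tp"
    "dual_log n w (Suc K) (src(K := u)) (dst(K := h (tp * n + u))) (S(K := comp_set n cmp tp)) y"
    "\<And>p. p \<le> tp \<Longrightarrow> min_column n (reduced_cost w (Suc K) (S(K := comp_set n cmp tp)) y)
        (comp_set n cmp p) (\<lambda>u. q1 (p * n + u)) (\<lambda>u. h (p * n + u))"
proof -
  let ?C = "comp_set n cmp"
  obtain S y where tp: "tp < n" and le: "\<forall>x<n. cmp x \<le> Suc tp" and log: "dual_log n w K src dst S y"
    and st: "path_stack n K src dst S cmp tp"
    and col: "\<forall>p\<le>tp. min_column n (reduced_cost w K S y) (?C p)
           (\<lambda>u. q (p * n + u)) (\<lambda>u. h (p * n + u))"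
    by (rule contraction_stateD[OF cs])
  let ?v = "h (tp * n + u)"
  have notin: "x \<notin> ?C tp \<longleftrightarrow> cmp x \<noteq> Suc tp" if "x < n" for x using that by (simp add: comp_set_def)
  have ctop: "x < n \<Longrightarrow> cmp x \<noteq> Suc tp \<Longrightarrow> h (tp * n + x) \<in> ?C tp \<and>
      q (tp * n + x) = reduced_cost w K S y x (h (tp * n + x)) \<and>
      (\<forall>v\<in>?C tp. q (tp * n + x) \<le> reduced_cost w K S y x v)" for x
    using col[rule_format, of tp] notin[of x] unfolding min_column_def by blast
  have v: "?v \<in> ?C tp" and qu: "q (tp * n + u) = reduced_cost w K S y u ?v"
    using ctop[OF u] by blast+
  let ?y = "y(K := reduced_cost w K S y u ?v)"
  have "dual_log n w (Suc K) (src(K := u)) (dst(K := ?v)) (S(K := ?C tp)) ?y"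
  proof (rule dual_log_extend[OF log])
    show "?C tp \<subseteq> {..<n}" by (auto simp: comp_set_def)
    show "strong_upto src dst K (?C tp)" using st by (simp add: path_stack_def)
    show "\<forall>i<K. S i \<inter> ?C tp = {} \<or> insert (src i) (S i) \<subseteq> ?C tp"
      using path_stack_laminar[OF st] by blast
    show "u < n" "u \<notin> ?C tp" "?v \<in> ?C tp" using u v notin by auto
    show "\<forall>u'<n. \<forall>v'\<in>?C tp. u' \<notin> ?C tp \<longrightarrow> reduced_cost w K S y u ?v \<le> reduced_cost w K S y u' v'"
    proof (intro allI ballI impI)
      fix u' v' assume *: "u' < n" "v' \<in> ?C tp" "u' \<notin> ?C tp"
      then have c: "cmp u' \<noteq> Suc tp" using notin by blast
      have "q (tp * n + u) \<le> q (tp * n + u')" using least * c by blast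
      also have "\<dots> \<le> reduced_cost w K S y u' v'" using ctop[OF *(1) c] * by blast
      finally show "reduced_cost w K S y u ?v \<le> reduced_cost w K S y u' v'" by (simp add: qu)
    qed
  qed
  moreover have "min_column n (reduced_cost w (Suc K) (S(K := ?C tp)) ?y)
        (?C p) (\<lambda>u. q1 (p * n + u)) (\<lambda>u. h (p * n + u))" if p: "p \<le> tp" for p
  proof (cases "p = tp")
    case True
    have "min_column n (reduced_cost w K S y) (?C tp) (\<lambda>u. q (tp * n + u)) (\<lambda>u. h (tp * n + u))"
      using col by simp
    then show ?thesis unfolding True
      by (rule min_column_select) (use q1 qu in simp)
  next
    case False
    have "min_column n (reduced_cost w K S y) (?C p) (\<lambda>u. q (p * n + u)) (\<lambda>u. h (p * n + u))"
      using col p by simp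
    then have "min_column n (reduced_cost w (Suc K) (S(K := ?C tp)) ?y) (?C p)
        (\<lambda>u. q (p * n + u)) (\<lambda>u. h (p * n + u))"
      by (rule min_column_other) (use False comp_set_disjoint[of tp p] in auto)
    moreover have "q1 (p * n + x) = q (p * n + x)" if "x < n" for x using q1 p False that by simp
    ultimately show ?thesis
      using min_column_cong[of n "\<lambda>u. q (p * n + u)" "\<lambda>u. q1 (p * n + u)" "\<lambda>u. h (p * n + u)" "\<lambda>u. h (p * n + u)"]
      by simp
  qed
  ultimately show thesis using that[OF st v] by blast
qed

lemma contraction_state_push:
  assumes cs: "contraction_state n w K src dst tp cmp tp q h"
    and u: "u < n" "cmp u = 0"
    and least: "\<forall>u'<n. cmp u' \<noteq> Suc tp \<longrightarrow> q (tp * n + u) \<le> q (tp * n + u')"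
    and q1: "\<forall>p\<le>tp. \<forall>x<n. q1 (p * n + x) = (if p = tp then q (p * n + x) - q (tp * n + u) else q (p * n + x))"
    and q2: "\<forall>p\<le>Suc tp. \<forall>x<n. q2 (p * n + x) = (if p = Suc tp then w x u else q1 (p * n + x)) \<and>
        h2 (p * n + x) = (if p = Suc tp then u else h (p * n + x))"
  shows "contraction_state n w (Suc K) (src(K := u)) (dst(K := h (tp * n + u))) (Suc tp)
    (cmp(u := Suc (Suc tp))) (Suc tp) q2 h2"
proof -
  let ?C = "comp_set n cmp" and ?cmp = "cmp(u := Suc (Suc tp))"
  let ?S = "\<lambda>S. S(K := ?C tp)"
  have u': "cmp u \<noteq> Suc tp" using u by simp
  obtain S y where st: "path_stack n K src dst S cmp tp" and v: "h (tp * n + u) \<in> ?C tp"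
    and log: "dual_log n w (Suc K) (src(K := u)) (dst(K := h (tp * n + u))) (?S S) y"
    and col: "\<And>p. p \<le> tp \<Longrightarrow> min_column n (reduced_cost w (Suc K) (?S S) y)
        (?C p) (\<lambda>u. q1 (p * n + u)) (\<lambda>u. h (p * n + u))"
    using contraction_state_select[OF cs u(1) u' least q1] by blast
  have le: "\<forall>x<n. cmp x \<le> Suc tp" using st by (simp add: path_stack_def)
  show ?thesis
  proof (rule contraction_stateI[OF path_stack_push[OF st u v] log])
    fix p assume p: "p \<le> Suc tp"
    show "min_column n (reduced_cost w (Suc K) (?S S) y) (comp_set n ?cmp p)
        (\<lambda>u. q2 (p * n + u)) (\<lambda>u. h2 (p * n + u))"
    proof (cases "p = Suc tp")
      case True
      have "comp_set n ?cmp (Suc tp) = {u}" using u le by (auto simp: comp_set_def)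
      moreover have pos: "\<forall>i<K. \<forall>x<n. x \<in> S i \<longrightarrow> 0 < cmp x" using st by (simp add: path_stack_def)
      have "u \<notin> S i" if "i < K" for i using pos that u by (metis less_irrefl)
      then have "\<forall>i<Suc K. u \<notin> (?S S) i" using u(2) by (auto simp: comp_set_def less_Suc_eq)
      then have "min_column n (reduced_cost w (Suc K) (?S S) y) {u}
          (\<lambda>x. q2 (p * n + x)) (\<lambda>x. h2 (p * n + x))"
        by (rule min_column_single) (use q2[rule_format, of p] True in auto)
      ultimately show ?thesis using True by simp
    next
      case False
      then have p': "p \<le> tp" using p by simp
      then have "comp_set n ?cmp p = ?C p" using u by (auto simp: comp_set_def)
      moreover have "q2 (p * n + x) = q1 (p * n + x)" "h2 (p * n + x) = h (p * n + x)" if "x < n" for x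
        using q2 False p that by auto
      ultimately show ?thesis
        using col[OF p'] min_column_cong[of n "\<lambda>u. q2 (p * n + u)" "\<lambda>u. q1 (p * n + u)"
            "\<lambda>u. h2 (p * n + u)" "\<lambda>u. h (p * n + u)"]
        by simp
    qed
  qed
qed

text \<open>The abstract path is contracted at once while the arrays still describe the old sets.
  The columns refer to the sets in the arrays, so beyond the reduction at the top none of them
  changes yet.\<close>

lemma contraction_state_contract:
  assumes cs: "contraction_state n w K src dst tp cmp tp q h"
    and u: "u < n" "cmp u = Suc j" "j < tp"
    and least: "\<forall>u'<n. cmp u' \<noteq> Suc tp \<longrightarrow> q (tp * n + u) \<le> q (tp * n + u')"
    and q1: "\<forall>p\<le>tp. \<forall>x<n. q1 (p * n + x) = (if p = tp then q (p * n + x) - q (tp * n + u) else q (p * n + x))"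
  shows "contraction_state n w (Suc K) (src(K := u)) (dst(K := h (tp * n + u))) j cmp tp q1 h"
proof -
  have u': "cmp u \<noteq> Suc tp" using u by simp
  obtain S y where *: "path_stack n K src dst S cmp tp" "h (tp * n + u) \<in> comp_set n cmp tp"
    "dual_log n w (Suc K) (src(K := u)) (dst(K := h (tp * n + u))) (S(K := comp_set n cmp tp)) y"
    "\<And>p. p \<le> tp \<Longrightarrow> min_column n (reduced_cost w (Suc K) (S(K := comp_set n cmp tp)) y)
        (comp_set n cmp p) (\<lambda>u. q1 (p * n + u)) (\<lambda>u. h (p * n + u))"
    using contraction_state_select[OF cs u(1) u' least q1] by blast
  from path_stack_contract[OF *(1) u *(2)] show ?thesis
    unfolding contraction_state_def
    using * u(3) path_stack_top_less[OF *(1)] by (auto simp: path_stack_def[of n K src dst S cmp tp])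
qed

text \<open>Labels cut at \<open>Suc j\<close> do not notice a merge at position \<open>j\<close> or
  above, so log and abstract path stay; only the columns of two adjacent sets are combined.\<close>

lemma contraction_state_merge:
  assumes cs: "contraction_state n w K src dst j cmp (Suc t) q h" and j: "j \<le> t"
    and cmp': "\<forall>x<n. cmp' x = (if cmp x = Suc (Suc t) then Suc t else cmp x)"
    and q': "\<forall>p\<le>t. \<forall>x<n. if p = t \<and> q (Suc t * n + x) < q (t * n + x)
       then q' (p * n + x) = q (Suc t * n + x) \<and> h' (p * n + x) = h (Suc t * n + x)
       else q' (p * n + x) = q (p * n + x) \<and> h' (p * n + x) = h (p * n + x)"
  shows "contraction_state n w K src dst j cmp' t q' h'"
proof -
  let ?C = "comp_set n cmp" and ?C' = "comp_set n cmp'"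
  obtain S y where tp: "Suc t < n" and le: "\<forall>x<n. cmp x \<le> Suc (Suc t)"
    and log: "dual_log n w K src dst S y"
    and st: "path_stack n K src dst S (\<lambda>x. min (cmp x) (Suc j)) j"
    and col: "\<forall>p\<le>Suc t. min_column n (reduced_cost w K S y) (?C p)
           (\<lambda>u. q (p * n + u)) (\<lambda>u. h (p * n + u))"
    using cs unfolding contraction_state_def by blast
  have "\<forall>x<n. min (cmp x) (Suc j) = min (cmp' x) (Suc j)" using cmp' j by auto
  from path_stack_cong[OF this] st have st': "path_stack n K src dst S (\<lambda>x. min (cmp' x) (Suc j)) j"
    by simp
  have le': "\<forall>x<n. cmp' x \<le> Suc t" using le cmp' by (auto simp: le_Suc_eq)
  have col': "min_column n (reduced_cost w K S y) (?C' p) (\<lambda>u. q' (p * n + u)) (\<lambda>u. h' (p * n + u))"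
    if p: "p \<le> t" for p
  proof (cases "p = t")
    case True
    have C: "?C' t = ?C t \<union> ?C (Suc t)" using cmp' by (auto simp: comp_set_def)
    have "min_column n (reduced_cost w K S y) (?C t \<union> ?C (Suc t)) (\<lambda>u. q' (t * n + u)) (\<lambda>u. h' (t * n + u))"
    proof (rule min_column_union)
      show "min_column n (reduced_cost w K S y) (?C t) (\<lambda>u. q (t * n + u)) (\<lambda>u. h (t * n + u))"
        "min_column n (reduced_cost w K S y) (?C (Suc t)) (\<lambda>u. q (Suc t * n + u)) (\<lambda>u. h (Suc t * n + u))"
        using col by (meson le_SucI order_refl)+
      show "\<forall>u<n. q' (t * n + u) = (if q (Suc t * n + u) < q (t * n + u) then q (Suc t * n + u) else q (t * n + u)) \<and>
         h' (t * n + u) = (if q (Suc t * n + u) < q (t * n + u) then h (Suc t * n + u) else h (t * n + u))"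
        using q'[rule_format, of t] by (auto split: if_splits)
    qed
    then show ?thesis using True C by simp
  next
    case False
    then have "?C' p = ?C p" using cmp' p by (auto simp: comp_set_def split: if_splits)
    moreover have "q' (p * n + x) = q (p * n + x)" "h' (p * n + x) = h (p * n + x)" if "x < n" for x
      using q'[rule_format, of p x] False p that by auto
    moreover have "min_column n (reduced_cost w K S y) (?C p) (\<lambda>u. q (p * n + u)) (\<lambda>u. h (p * n + u))"
      using col p by simp
    ultimately show ?thesis
      using min_column_cong[of n "\<lambda>u. q' (p * n + u)" "\<lambda>u. q (p * n + u)"
            "\<lambda>u. h' (p * n + u)" "\<lambda>u. h (p * n + u)"]
      by simp
  qed
  show ?thesis
    unfolding contraction_state_def using j tp le' log st' col' by (meson Suc_lessD)
qed

lemma contraction_state_full: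
  assumes "contraction_state n w K src dst tp cmp tp q h" "\<forall>x<n. cmp x = Suc tp"
  obtains S y where "dual_log n w K src dst S y" "strong_upto src dst K {..<n}" "K \<le> 2 * n"
proof -
  obtain S y where log: "dual_log n w K src dst S y" and st: "path_stack n K src dst S cmp tp"
    by (rule contraction_stateD[OF assms(1)])
  have "comp_set n cmp tp = {..<n}" using assms(2) by (auto simp: comp_set_def)
  then have "strong_upto src dst K {..<n}" "K \<le> 2 * n"
    using st unfolding path_stack_def by (metis order_refl, linarith)
  with log show thesis using that by blast
qed

lemma contraction_state_start:
  assumes "0 < n" "\<forall>u<n. \<forall>v<n. 0 \<le> w u v" "\<forall>x<n. cmp x = (if x = 0 then 1 else 0)"
    "\<forall>x<n. q x = w x 0 \<and> h x = 0"
  shows "contraction_state n w 0 src dst 0 cmp 0 q h"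
proof (rule contraction_stateI[where S = "\<lambda>_. {}" and y = "\<lambda>_. 0"])
  show "path_stack n 0 src dst (\<lambda>_. {}) cmp 0"
    using path_stack_start[OF assms(1)] path_stack_cong[OF assms(3)] by simp
  show "dual_log n w 0 src dst (\<lambda>_. {}) (\<lambda>_. 0)" using assms(2) by (rule dual_log_0)
  fix p :: nat assume p: "p \<le> 0"
  have "comp_set n cmp 0 = {0}" using assms(1,3) by (auto simp: comp_set_def split: if_splits)
  then show "min_column n (reduced_cost w 0 (\<lambda>_. {}) (\<lambda>_. 0)) (comp_set n cmp p)
      (\<lambda>u. q (p * n + u)) (\<lambda>u. h (p * n + u))"
    using min_column_single[of 0 0 "\<lambda>_. {}" n q w h "\<lambda>_. 0"] assms(4) p by simp
qed

section \<open>The program\<close>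

abbreviation At :: "string \<Rightarrow> string \<Rightarrow> nexp" where
  "At a x \<equiv> NCell a (Var x)"

abbreviation idx :: "string \<Rightarrow> string \<Rightarrow> nexp" where
  "idx x y \<equiv> NAdd (NCell ''row'' (Var x)) (Var y)"

text \<open>The machine cannot multiply, so the offsets \<open>i * m\<close> of matrix rows are tabulated by repeated addition.\<close>

definition rows :: "nat \<Rightarrow> store \<Rightarrow> bool" where
  "rows n s \<longleftrightarrow> nats s ''m'' 0 = n \<and> (\<forall>i\<le>n. nats s ''row'' i = i * n)"

lemma rowsD: "rows n s \<Longrightarrow> nats s ''m'' 0 = n" "rows n s \<Longrightarrow> i \<le> n \<Longrightarrow> nats s ''row'' i = i * n"
  by (auto simp: rows_def)

lemma rows_cong: "rows n s \<Longrightarrow> nats s' ''m'' = nats s ''m'' \<Longrightarrow> nats s' ''row'' = nats s ''row'' \<Longrightarrow> rows n s'"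
  by (simp add: rows_def)

definition push :: com where
  "push = Seq (NAssign ''comp'' (Var ''x'') (NAdd (Var ''t'') (NConst 1)))
     (For ''u'' ''m'' (Seq (RAssign ''q'' (idx ''t'' ''u'') (RCell ''w'' (idx ''x'' ''u'')))
                          (NAssign ''h'' (idx ''t'' ''u'') (Var ''x''))))"

lemma push_writes [simp]: "nwr push = {''comp'', ''u'', ''h''}" "rwr push = {''q''}"
  by (auto simp: push_def)

text \<open>Weights are stored by head: row \<open>x\<close> of \<open>w\<close> lists the costs of
  the arcs into \<open>x\<close>. A new path set takes this row unchanged as its column.\<close>

lemma wp_push:
  assumes rows: "rows n s" and tp: "nats s ''t'' 0 = tp" "tp < n" and x: "nats s ''x'' 0 = x" "x < n"
    and post: "\<And>d s'. frame push s s' \<Longrightarrow> d \<le> t + n * 40 + 40 \<Longrightarrow>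
      nats s' ''comp'' = (nats s ''comp'')(x := Suc tp) \<Longrightarrow>
      (\<forall>p v. v < n \<longrightarrow> reals s' ''q'' (p * n + v) = (if p = tp then reals s ''w'' (x * n + v) else reals s ''q'' (p * n + v)) \<and>
         nats s' ''h'' (p * n + v) = (if p = tp then x else nats s ''h'' (p * n + v))) \<Longrightarrow> Q d s'"
  shows "wp push Q t s"
proof (rule wp_frame)
  note rws = rowsD[OF rows]
  show "wp push (\<lambda>t s'. frame push s s' \<longrightarrow> Q t s') t s"
    unfolding push_def wp_Seq wp_NAssign
    apply (rule wp_For[where n = n and B = 24 and
       I = "\<lambda>k s'. nats s' ''comp'' = (nats s ''comp'')(x := Suc tp) \<and>
      (\<forall>p v. v < n \<longrightarrow> reals s' ''q'' (p * n + v) = (if p = tp \<and> v < k then reals s ''w'' (x * n + v) else reals s ''q'' (p * n + v)) \<and>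
         nats s' ''h'' (p * n + v) = (if p = tp \<and> v < k then x else nats s ''h'' (p * n + v)))"])
    prefer 6
    subgoal premises p for k s'
    proof -
      have "nats s' ''row'' = nats s ''row''" "nats s' ''t'' 0 = tp" "nats s' ''x'' 0 = x"
        "reals s' ''w'' = reals s ''w''"
        using tp x by (simp_all add: frameD[OF p(2)] set_simps)
      then show ?thesis
        using p(1,4) tp x by (auto simp: p(3) set_simps rws row_index_eq less_Suc_eq)
    qed
    prefer 6
    subgoal for d s' using post[of s' d] by (simp add: push_def)
    by (simp_all add: set_simps rws tp x)
qed


text \<open>The inner loop takes \<open>n * (B + 12) + 9\<close> operations and as a loop body adds
  12, whence the 21. \<open>stable\<close> says that the invariant ignores both counters.\<close>

lemma wp_For2:
  assumes fresh: "x \<notin> nwr c" "y \<notin> nwr c" "N \<notin> nwr c" "N \<noteq> x" "N \<noteq> y" "x \<noteq> y"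
    and n: "nats s N 0 = n"
    and stable: "\<And>i j s' v. I i j (set_nat x 0 v s') = I i j s'" "\<And>i j s' v. I i j (set_nat y 0 v s') = I i j s'"
    and init: "I 0 0 s"
    and row: "\<And>i s'. I i n s' \<Longrightarrow> I (Suc i) 0 s'"
    and step: "\<And>i j s'. i < n \<Longrightarrow> j < n \<Longrightarrow> frame (For x N (For y N c)) s s' \<Longrightarrow> nats s' x 0 = i \<Longrightarrow>
        nats s' y 0 = j \<Longrightarrow> I i j s' \<Longrightarrow> wp c (\<lambda>d s''. d \<le> B \<and> I i (Suc j) s'') 0 s'"
    and post: "\<And>t' s'. frame (For x N (For y N c)) s s' \<Longrightarrow> I n 0 s' \<Longrightarrow>
        t' \<le> t + n * (n * (B + 12) + 21) + 9 \<Longrightarrow> Q t' s'"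
  shows "wp (For x N (For y N c)) Q t s"
proof (rule wp_For[where n = n and B = "n * (B + 12) + 9" and I = "\<lambda>i. I i 0"])
  fix i s' assume i: "i < n" and fr: "frame (For x N (For y N c)) s s'" and x: "nats s' x 0 = i" and I: "I i 0 s'"
  show "wp (For y N c) (\<lambda>d s''. d \<le> n * (B + 12) + 9 \<and> I (Suc i) 0 (set_nat x 0 (Suc i) s'')) 0 s'"
  proof (rule wp_For[where n = n and B = B and I = "I i"])
    show "nats s' N 0 = n" using fr n fresh by (simp add: frameD)
    show "I i 0 (set_nat y 0 0 s')" using I stable by simp
    fix j s'' assume j: "j < n" and fr': "frame (For y N c) s' s''" and y: "nats s'' y 0 = j" and I': "I i j s''"
    have "frame (For x N (For y N c)) s s''" using fr fr' by (auto simp: frame_def)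
    moreover have "nats s'' x 0 = i" using fr' x fresh by (simp add: frameD)
    ultimately show "wp c (\<lambda>d s''. d \<le> B \<and> I i (Suc j) (set_nat y 0 (Suc j) s'')) 0 s''"
      using step[OF i j _ _ y I'] stable by simp
  qed (use fresh stable row in auto)
qed (use fresh n init stable post in \<open>auto simp: algebra_simps\<close>)

section \<open>Reading the input matrices and writing the output matrix\<close>

definition init_rows :: com where
  "init_rows = For ''i'' ''m'' (NAssign ''row'' (NAdd (Var ''i'') (NConst 1)) (NAdd (At ''row'' ''i'') (Var ''m'')))"

lemma init_rows_writes [simp]: "nwr init_rows = {''i'', ''row''}" "rwr init_rows = {}"
  by (auto simp: init_rows_def)

lemma wp_init_rows:
  assumes m: "nats s ''m'' 0 = n" "nats s ''row'' 0 = 0"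
    and post: "\<And>d s'. frame init_rows s s' \<Longrightarrow> rows n s' \<Longrightarrow> d \<le> t + n * 40 + 40 \<Longrightarrow> Q d s'"
  shows "wp init_rows Q t s"
  unfolding init_rows_def
  apply (rule wp_For[where n = n and B = 20 and I = "\<lambda>k s'. \<forall>i\<le>k. nats s' ''row'' i = i * n"])
  prefer 6
  subgoal premises p for k s'
  proof -
    have "nats s' ''m'' 0 = n" using m by (simp add: frameD[OF p(2)])
    then show ?thesis using p(4) by (auto simp: p(3) set_simps le_Suc_eq)
  qed
  prefer 6
  subgoal premises p for d s'
  proof (rule post)
    have "nats s' ''m'' 0 = n" using m by (simp add: frameD[OF p(1)])
    then show "rows n s'" using p(2) by (simp add: rows_def)
  qed (use p in \<open>simp_all add: init_rows_def\<close>)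
  by (simp_all add: set_simps m)

definition sum_links :: com where
  "sum_links = For ''i'' ''m'' (For ''j'' ''m'' (Cond (NEq (NCell ''link'' (idx ''i'' ''j'')) (NConst 1))
     (RAssign ''M'' (NConst 0) (RAdd (RCell ''M'' (NConst 0)) (RCell ''b'' (idx ''i'' ''j'')))) Skip))"

lemma sum_links_writes [simp]: "nwr sum_links = {''i'', ''j''}" "rwr sum_links = {''M''}"
  by (auto simp: sum_links_def)

lemma wp_sum_links:
  assumes rows: "rows n s" and M: "reals s ''M'' 0 = 0"
    and post: "\<And>d s'. frame sum_links s s' \<Longrightarrow>
      reals s' ''M'' 0 = (\<Sum>i<n. \<Sum>j<n. if nats s ''link'' (i * n + j) = 1 then reals s ''b'' (i * n + j) else 0) \<Longrightarrow>
      d \<le> t + n * (n * 52 + 21) + 9 \<Longrightarrow> Q d s'"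
  shows "wp sum_links Q t s"
proof -
  note rws = rowsD[OF rows]
  let ?f = "\<lambda>i j. if nats s ''link'' (i * n + j) = 1 then reals s ''b'' (i * n + j) else 0"
  show ?thesis
    unfolding sum_links_def
    apply (rule wp_For2[where n = n and B = 40 and
        I = "\<lambda>i j s'. reals s' ''M'' 0 = (\<Sum>i'<i. \<Sum>j<n. ?f i' j) + (\<Sum>j'<j. ?f i j')"])
    prefer 12
    subgoal premises p for i j s'
    proof -
      have "nats s' ''row'' = nats s ''row''" "nats s' ''link'' = nats s ''link''" "reals s' ''b'' = reals s ''b''"
        by (simp_all add: frameD[OF p(3)])
      then show ?thesis using p(1,2,6) by (simp add: p(4,5) set_simps rws)
    qed
    prefer 12
    subgoal for d s' using post[of s' d] by (simp add: sum_links_def)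
    by (simp_all add: rws M)
qed

text \<open>With \<open>bk\<close> set, the indices of the links read are exchanged, which reverses
  the network. \<open>M\<close> is the weight of a missing link.\<close>

definition load_weights :: "bool \<Rightarrow> com" where
  "load_weights bk = (let e = (if bk then idx ''i'' ''j'' else idx ''j'' ''i'') in
     For ''i'' ''m'' (For ''j'' ''m'' (Cond (NEq (NCell ''link'' e) (NConst 1))
       (RAssign ''w'' (idx ''i'' ''j'') (RCell ''b'' e))
       (RAssign ''w'' (idx ''i'' ''j'') (RCell ''M'' (NConst 0))))))"

lemma load_weights_writes [simp]: "nwr (load_weights bk) = {''i'', ''j''}" "rwr (load_weights bk) = {''w''}"
  by (auto simp: load_weights_def Let_def)

definition weight :: "nat \<Rightarrow> store \<Rightarrow> bool \<Rightarrow> nat \<Rightarrow> nat \<Rightarrow> real" where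
  "weight n s bk u v = (let e = (if bk then v * n + u else u * n + v) in
     if nats s ''link'' e = 1 then reals s ''b'' e else reals s ''M'' 0)"

lemma wp_load_weights:
  assumes rows: "rows n s"
    and post: "\<And>d s'. frame (load_weights bk) s s' \<Longrightarrow>
      \<forall>u<n. \<forall>v<n. reals s' ''w'' (v * n + u) = weight n s bk u v \<Longrightarrow>
      d \<le> t + n * (n * 52 + 21) + 9 \<Longrightarrow> Q d s'"
  shows "wp (load_weights bk) Q t s"
proof -
  note rws = rowsD[OF rows]
  let ?e = "if bk then idx ''i'' ''j'' else idx ''j'' ''i''"
  show ?thesis
    unfolding load_weights_def Let_def
    apply (rule wp_For2[where n = n and B = 40 and
        I = "\<lambda>i j s'. \<forall>v u. u < n \<longrightarrow> v < i \<or> v = i \<and> u < j \<longrightarrow> reals s' ''w'' (v * n + u) = weight n s bk u v"])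
    prefer 12
    subgoal premises p for i j s'
    proof -
      have "nats s' ''row'' = nats s ''row''" "nats s' ''link'' = nats s ''link''"
        "reals s' ''b'' = reals s ''b''" "reals s' ''M'' = reals s ''M''"
        by (simp_all add: frameD[OF p(3)])
      then show ?thesis using p(1,2,6)
        by (cases bk) (auto simp: p(4,5) set_simps rws row_index_eq less_Suc_eq weight_def)
    qed
    prefer 12
    subgoal for d s' using post[of s' d] by (simp add: load_weights_def Let_def)
    by (auto simp: rws less_Suc_eq)
qed

text \<open>Cells of \<open>W\<close> are only ever set, so a second pass adds its arcs to those of
  the first and forms the union.\<close>

definition store_arcs :: "bool \<Rightarrow> com" where
  "store_arcs bk = For ''i'' ''m'' (For ''j'' ''m'' (Cond (NEq (NCell ''A'' (idx ''i'' ''j'')) (NConst 1))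
       (NAssign ''W'' (if bk then idx ''j'' ''i'' else idx ''i'' ''j'') (NConst 1)) Skip))"

lemma store_arcs_writes [simp]: "nwr (store_arcs bk) = {''i'', ''j'', ''W''}" "rwr (store_arcs bk) = {}"
  by (auto simp: store_arcs_def)

lemma wp_store_arcs:
  assumes rows: "rows n s"
    and post: "\<And>d s'. frame (store_arcs bk) s s' \<Longrightarrow>
      \<forall>u<n. \<forall>v<n. nats s' ''W'' (u * n + v) =
        (if nats s ''A'' (if bk then v * n + u else u * n + v) = 1 then 1 else nats s ''W'' (u * n + v)) \<Longrightarrow>
      d \<le> t + n * (n * 52 + 21) + 9 \<Longrightarrow> Q d s'"
  shows "wp (store_arcs bk) Q t s"
proof -
  note rws = rowsD[OF rows]
  show ?thesis
    unfolding store_arcs_def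
    apply (rule wp_For2[where n = n and B = 40 and
        I = "\<lambda>i j s'. \<forall>v<n. \<forall>u<n. nats s' ''W'' (if bk then v * n + u else u * n + v) =
          (if (u < i \<or> u = i \<and> v < j) \<and> nats s ''A'' (u * n + v) = 1 then 1
           else nats s ''W'' (if bk then v * n + u else u * n + v))"])
    prefer 12
    subgoal premises p for i j s'
    proof -
      have "nats s' ''row'' = nats s ''row''" "nats s' ''A'' = nats s ''A''"
        by (simp_all add: frameD[OF p(3)])
      then show ?thesis using p(1,2,6)
        by (cases bk) (auto simp: p(4,5) set_simps rws row_index_eq less_Suc_eq)
    qed
    prefer 12
    subgoal premises p for d s'
    proof (rule post)
      show "\<forall>u<n. \<forall>v<n. nats s' ''W'' (u * n + v) =
        (if nats s ''A'' (if bk then v * n + u else u * n + v) = 1 then 1 else nats s ''W'' (u * n + v))"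
        using p(2) by (cases bk) simp_all
    qed (use p in \<open>simp_all add: store_arcs_def\<close>)
    by (auto simp: set_simps rws less_Suc_eq)
qed


section \<open>One selection: search, reduction, push or contraction\<close>

definition scan :: com where
  "scan = Seq (setv ''f'' (NConst 0)) (For ''u'' ''m''
     (Cond (NEq (At ''comp'' ''u'') (NAdd (Var ''t'') (NConst 1))) Skip
        (Cond (BNot (BAnd (NEq (Var ''f'') (NConst 1))
                (BNot (RLess (RCell ''q'' (idx ''t'' ''u'')) (RCell ''best'' (NConst 0))))))
           (Seq (RAssign ''best'' (NConst 0) (RCell ''q'' (idx ''t'' ''u'')))
             (Seq (setv ''x'' (Var ''u'')) (setv ''f'' (NConst 1)))) Skip)))"

lemma scan_writes [simp]: "nwr scan = {''f'', ''u'', ''x''}" "rwr scan = {''best''}"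
  by (auto simp: scan_def)

text \<open>The flag \<open>f\<close> stands in for an infinite initial minimum. The nested
  negations in \<open>scan\<close> encode the disjunction that no candidate is known yet or the
  current one is smaller. If \<open>f\<close> stays 0, the last set is the whole vertex set.\<close>

lemma wp_scan:
  assumes rows: "rows n s" and tp: "nats s ''t'' 0 = tp" "tp < n"
    and none: "\<And>d s'. frame scan s s' \<Longrightarrow> d \<le> t + n * 72 + 12 \<Longrightarrow> nats s' ''f'' 0 = 0 \<Longrightarrow>
      \<forall>v<n. nats s ''comp'' v = Suc tp \<Longrightarrow> Q d s'"
    and some: "\<And>d s' x. frame scan s s' \<Longrightarrow> d \<le> t + n * 72 + 12 \<Longrightarrow> nats s' ''f'' 0 = 1 \<Longrightarrow>
      nats s' ''x'' 0 = x \<Longrightarrow> x < n \<Longrightarrow> nats s ''comp'' x \<noteq> Suc tp \<Longrightarrow>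
      reals s' ''best'' 0 = reals s ''q'' (tp * n + x) \<Longrightarrow>
      \<forall>v<n. nats s ''comp'' v \<noteq> Suc tp \<longrightarrow> reals s ''q'' (tp * n + x) \<le> reals s ''q'' (tp * n + v) \<Longrightarrow> Q d s'"
  shows "wp scan Q t s"
proof (rule wp_frame)
  note rws = rowsD[OF rows]
  let ?q = "\<lambda>v. reals s ''q'' (tp * n + v)"
  show "wp scan (\<lambda>t s'. frame scan s s' \<longrightarrow> Q t s') t s"
    unfolding scan_def wp_Seq wp_NAssign
    apply (rule wp_For[where n = n and B = 60 and
       I = "\<lambda>k s'. (nats s' ''f'' 0 = 0 \<and> (\<forall>v<k. nats s ''comp'' v = Suc tp)) \<or>
         (nats s' ''f'' 0 = 1 \<and> nats s' ''x'' 0 < k \<and> nats s ''comp'' (nats s' ''x'' 0) \<noteq> Suc tp \<and>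
          reals s' ''best'' 0 = ?q (nats s' ''x'' 0) \<and>
          (\<forall>v<k. nats s ''comp'' v \<noteq> Suc tp \<longrightarrow> ?q (nats s' ''x'' 0) \<le> ?q v))"])
    prefer 6
    subgoal premises p for k s'
    proof -
      have "nats s' ''row'' = nats s ''row''" "nats s' ''t'' 0 = tp" "nats s' ''comp'' = nats s ''comp''"
        "reals s' ''q'' = reals s ''q''"
        using tp by (simp_all add: frameD[OF p(2)] set_simps)
      then show ?thesis
        using p(1,4) tp by (auto simp: p(3) set_simps rws less_Suc_eq)
    qed
    prefer 6
    subgoal premises p for d s'
    proof
      assume fr: "frame (Seq (setv ''f'' (NConst 0)) (For ''u'' ''m''
     (Cond (NEq (At ''comp'' ''u'') (NAdd (Var ''t'') (NConst 1))) Skip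
        (Cond (BNot (BAnd (NEq (Var ''f'') (NConst 1))
                (BNot (RLess (RCell ''q'' (idx ''t'' ''u'')) (RCell ''best'' (NConst 0))))))
           (Seq (RAssign ''best'' (NConst 0) (RCell ''q'' (idx ''t'' ''u'')))
             (Seq (setv ''x'' (Var ''u'')) (setv ''f'' (NConst 1)))) Skip)))) s s'"
      then have fr: "frame scan s s'" by (simp add: scan_def)
      have d: "d \<le> t + n * 72 + 12" using p(3) by simp
      from p(2) show "Q d s'"
        using none[OF fr d] some[OF fr d _ refl] by blast
    qed
    by (simp_all add: set_simps rws tp)
qed

definition subtract :: com where
  "subtract = For ''u'' ''m'' (RAssign ''q'' (idx ''t'' ''u'')
     (RSub (RCell ''q'' (idx ''t'' ''u'')) (RCell ''best'' (NConst 0))))"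

lemma subtract_writes [simp]: "nwr subtract = {''u''}" "rwr subtract = {''q''}"
  by (auto simp: subtract_def)

lemma wp_subtract:
  assumes rows: "rows n s" and tp: "nats s ''t'' 0 = tp" "tp < n"
    and post: "\<And>d s'. frame subtract s s' \<Longrightarrow> d \<le> t + n * 42 + 9 \<Longrightarrow>
      (\<forall>p v. v < n \<longrightarrow> reals s' ''q'' (p * n + v) =
         (if p = tp then reals s ''q'' (p * n + v) - reals s ''best'' 0 else reals s ''q'' (p * n + v))) \<Longrightarrow> Q d s'"
  shows "wp subtract Q t s"
proof -
  note rws = rowsD[OF rows]
  show ?thesis
    unfolding subtract_def
    apply (rule wp_For[where n = n and B = 30 and
       I = "\<lambda>k s'. \<forall>p v. v < n \<longrightarrow> reals s' ''q'' (p * n + v) =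
         (if p = tp \<and> v < k then reals s ''q'' (p * n + v) - reals s ''best'' 0 else reals s ''q'' (p * n + v))"])
    prefer 6
    subgoal premises p for k s'
    proof -
      have "nats s' ''row'' = nats s ''row''" "nats s' ''t'' 0 = tp" "reals s' ''best'' = reals s ''best''"
        using tp by (simp_all add: frameD[OF p(2)])
      then show ?thesis
        using p(1,4) tp by (auto simp: p(3) set_simps rws row_index_eq less_Suc_eq)
    qed
    prefer 6
    subgoal for d s' using post[of s' d] by (simp add: subtract_def)
    by (simp_all add: set_simps rws)
qed

text \<open>\<open>t\<close> has already been lowered here, so row \<open>t + 1\<close> is the one
  being absorbed.\<close>

definition merge_columns :: com where
  "merge_columns = For ''u'' ''m''
     (Cond (RLess (RCell ''q'' (NAdd (NCell ''row'' (NAdd (Var ''t'') (NConst 1))) (Var ''u''))) (RCell ''q'' (idx ''t'' ''u'')))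
       (Seq (RAssign ''q'' (idx ''t'' ''u'') (RCell ''q'' (NAdd (NCell ''row'' (NAdd (Var ''t'') (NConst 1))) (Var ''u''))))
          (NAssign ''h'' (idx ''t'' ''u'') (NCell ''h'' (NAdd (NCell ''row'' (NAdd (Var ''t'') (NConst 1))) (Var ''u''))))) Skip)"

lemma merge_columns_writes [simp]: "nwr merge_columns = {''u'', ''h''}" "rwr merge_columns = {''q''}"
  by (auto simp: merge_columns_def)

lemma wp_merge_columns:
  assumes rows: "rows n s" and tp: "nats s ''t'' 0 = tp" "Suc tp < n"
    and post: "\<And>d s'. frame merge_columns s s' \<Longrightarrow> d \<le> t + n * 72 + 9 \<Longrightarrow>
      (\<forall>p v. v < n \<longrightarrow> (if p = tp \<and> reals s ''q'' (Suc tp * n + v) < reals s ''q'' (tp * n + v)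
         then reals s' ''q'' (p * n + v) = reals s ''q'' (Suc tp * n + v) \<and> nats s' ''h'' (p * n + v) = nats s ''h'' (Suc tp * n + v)
         else reals s' ''q'' (p * n + v) = reals s ''q'' (p * n + v) \<and> nats s' ''h'' (p * n + v) = nats s ''h'' (p * n + v))) \<Longrightarrow>
      Q d s'"
  shows "wp merge_columns Q t s"
proof -
  note rws = rowsD[OF rows]
  show ?thesis
    unfolding merge_columns_def
    apply (rule wp_For[where n = n and B = 60 and
       I = "\<lambda>k s'. \<forall>p v. v < n \<longrightarrow> (if p = tp \<and> v < k \<and> reals s ''q'' (Suc tp * n + v) < reals s ''q'' (tp * n + v)
         then reals s' ''q'' (p * n + v) = reals s ''q'' (Suc tp * n + v) \<and> nats s' ''h'' (p * n + v) = nats s ''h'' (Suc tp * n + v)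
         else reals s' ''q'' (p * n + v) = reals s ''q'' (p * n + v) \<and> nats s' ''h'' (p * n + v) = nats s ''h'' (p * n + v))"])
    prefer 6
    subgoal premises p for k s'
    proof -
      have eqs: "nats s' ''row'' = nats s ''row''" "nats s' ''t'' 0 = tp"
        using tp by (simp_all add: frameD[OF p(2)])
      \<comment> \<open>Row \<open>Suc tp\<close> is never written in this loop and row
        \<open>tp\<close> only at earlier indices, so round \<open>k\<close> reads original
        values.\<close>
      have upper: "reals s' ''q'' (Suc tp * n + k) = reals s ''q'' (Suc tp * n + k)"
        "nats s' ''h'' (Suc tp * n + k) = nats s ''h'' (Suc tp * n + k)"
        and lower: "reals s' ''q'' (tp * n + k) = reals s ''q'' (tp * n + k)"
        using p(4)[rule_format, OF p(1), of "Suc tp"] p(4)[rule_format, OF p(1), of tp] by auto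
      show ?thesis
        using p(1,4) tp(2) upper lower
        by (auto simp: p(3) eqs set_simps rws row_index_eq less_Suc_eq simp del: mult_Suc split: if_splits)
    qed
    prefer 6
    subgoal for d s' using post[of s' d] by (simp add: merge_columns_def)
    by (simp_all add: set_simps rws)
qed

text \<open>Labels are positions plus one, so the absorbed position \<open>t + 1\<close> carries the
  label \<open>t + 2\<close>.\<close>

definition relabel :: com where
  "relabel = For ''u'' ''m'' (Cond (NEq (At ''comp'' ''u'') (NAdd (Var ''t'') (NConst 2)))
     (NAssign ''comp'' (Var ''u'') (NAdd (Var ''t'') (NConst 1))) Skip)"

lemma relabel_writes [simp]: "nwr relabel = {''u'', ''comp''}" "rwr relabel = {}"
  by (auto simp: relabel_def)

lemma wp_relabel:
  assumes rows: "rows n s" and tp: "nats s ''t'' 0 = tp"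
    and post: "\<And>d s'. frame relabel s s' \<Longrightarrow> d \<le> t + n * 42 + 9 \<Longrightarrow>
      (\<forall>v<n. nats s' ''comp'' v = (if nats s ''comp'' v = Suc (Suc tp) then Suc tp else nats s ''comp'' v)) \<Longrightarrow> Q d s'"
  shows "wp relabel Q t s"
proof -
  note rws = rowsD[OF rows]
  show ?thesis
    unfolding relabel_def
    apply (rule wp_For[where n = n and B = 30 and
       I = "\<lambda>k s'. \<forall>v<n. nats s' ''comp'' v =
          (if v < k \<and> nats s ''comp'' v = Suc (Suc tp) then Suc tp else nats s ''comp'' v)"])
    prefer 6
    subgoal premises p for k s'
    proof -
      have "nats s' ''t'' 0 = tp"
        using tp by (simp add: frameD[OF p(2)])
      then show ?thesis
        using p(1,4) by (auto simp: p(3) set_simps less_Suc_eq)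
    qed
    prefer 6
    subgoal for d s' using post[of s' d] by (simp add: relabel_def)
    by (simp_all add: set_simps rws)
qed

definition cstate :: "nat \<Rightarrow> (nat \<Rightarrow> nat \<Rightarrow> real) \<Rightarrow> nat \<Rightarrow> store \<Rightarrow> bool" where
  "cstate n w j s \<longleftrightarrow> contraction_state n w (nats s ''K'' 0) (nats s ''src'') (nats s ''dst'') j
     (nats s ''comp'') (nats s ''t'' 0) (reals s ''q'') (nats s ''h'')"

definition merge :: com where
  "merge = Seq (setv ''t'' (NSub (Var ''t'') (NConst 1))) (Seq merge_columns relabel)"

lemma merge_writes [simp]: "nwr merge = {''t'', ''u'', ''h'', ''comp''}" "rwr merge = {''q''}"
  by (auto simp: merge_def)

lemma wp_merge:
  assumes rows: "rows n s" and tp: "nats s ''t'' 0 = Suc tp" and j: "j \<le> tp" and cs: "cstate n w j s"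
    and post: "\<And>d s'. frame merge s s' \<Longrightarrow> d \<le> t + n * 114 + 24 \<Longrightarrow> nats s' ''t'' 0 = tp \<Longrightarrow> cstate n w j s' \<Longrightarrow>
      (\<forall>v<n. nats s' ''comp'' v = (if nats s ''comp'' v = Suc (Suc tp) then Suc tp else nats s ''comp'' v)) \<Longrightarrow> Q d s'"
  shows "wp merge Q t s"
proof (rule wp_frame)
  have tpn: "Suc tp < n" using cs tp by (simp add: cstate_def contraction_state_def)
  let ?s = "set_nat ''t'' 0 tp s"
  have rows1: "rows n ?s" by (rule rows_cong[OF rows]) (simp_all add: set_simps)
  have "wp merge_columns (wp relabel (\<lambda>t s'. frame merge s s' \<longrightarrow> Q t s')) (t + 6) ?s"
  proof (rule wp_merge_columns[OF rows1 _ tpn])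
    show "nats ?s ''t'' 0 = tp" by (simp add: set_simps)
    fix d1 s1 assume fr1: "frame merge_columns ?s s1" and d1: "d1 \<le> t + 6 + n * 72 + 9"
      and q: "\<forall>p v. v < n \<longrightarrow> (if p = tp \<and> reals ?s ''q'' (Suc tp * n + v) < reals ?s ''q'' (tp * n + v)
         then reals s1 ''q'' (p * n + v) = reals ?s ''q'' (Suc tp * n + v) \<and> nats s1 ''h'' (p * n + v) = nats ?s ''h'' (Suc tp * n + v)
         else reals s1 ''q'' (p * n + v) = reals ?s ''q'' (p * n + v) \<and> nats s1 ''h'' (p * n + v) = nats ?s ''h'' (p * n + v))"
    have rows2: "rows n s1" by (rule rows_cong[OF rows1]) (simp_all add: frameD[OF fr1])
    have t1: "nats s1 ''t'' 0 = tp" by (simp add: frameD[OF fr1] set_simps)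
    show "wp relabel (\<lambda>t s'. frame merge s s' \<longrightarrow> Q t s') d1 s1"
    proof (rule wp_relabel[OF rows2 t1])
      fix d2 s2 assume fr2: "frame relabel s1 s2" and d2: "d2 \<le> d1 + n * 42 + 9"
        and c: "\<forall>v<n. nats s2 ''comp'' v = (if nats s1 ''comp'' v = Suc (Suc tp) then Suc tp else nats s1 ''comp'' v)"
      have eqs: "nats s2 ''t'' 0 = tp" "nats s2 ''K'' = nats s ''K''" "nats s2 ''src'' = nats s ''src''"
        "nats s2 ''dst'' = nats s ''dst''" "nats s1 ''comp'' = nats s ''comp''" "reals s2 ''q'' = reals s1 ''q''"
        "nats s2 ''h'' = nats s1 ''h''"
        using t1 by (simp_all add: frameD[OF fr1] frameD[OF fr2] set_simps)
      have "cstate n w j s2"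
        unfolding cstate_def eqs
        by (rule contraction_state_merge[OF cs[unfolded cstate_def tp] j c[unfolded eqs]])
          (use q in \<open>simp add: set_simps\<close>)
      then show "frame merge s s2 \<longrightarrow> Q d2 s2"
        using post[of s2 d2] c d1 d2 by (simp add: eqs)
    qed
  qed
  then show "wp merge (\<lambda>t s'. frame merge s s' \<longrightarrow> Q t s') t s"
    by (simp add: merge_def tp eval_nat_numeral)
qed

definition contract :: com where
  "contract = While (NLess (At ''comp'' ''x'') (NAdd (Var ''t'') (NConst 1))) merge"

lemma contract_writes [simp]: "nwr contract = {''t'', ''u'', ''h'', ''comp''}" "rwr contract = {''q''}"
  by (auto simp: contract_def)

text \<open>The label \<open>Suc j\<close> of \<open>x\<close> marks the target: merging stops when
  the top has come down to \<open>j\<close>. A merge takes at most \<open>114 * n + 24\<close>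
  operations and the guard 9, well within \<open>300 * (n + 1)\<close> per position.\<close>

lemma wp_contract:
  assumes rows: "rows n s" and cs: "cstate n w j s" and x: "nats s ''x'' 0 = x" "x < n" "nats s ''comp'' x = Suc j"
    and post: "\<And>d s'. frame contract s s' \<Longrightarrow> cstate n w j s' \<Longrightarrow> nats s' ''t'' 0 = j \<Longrightarrow>
      \<forall>v<n. nats s' ''comp'' v = 0 \<longleftrightarrow> nats s ''comp'' v = 0 \<Longrightarrow>
      d \<le> t + (nats s ''t'' 0 - j) * (300 * (n + 1)) + 9 \<Longrightarrow> Q d s'"
  shows "wp contract Q t s"
  unfolding contract_def
proof (rule wp_While[where \<Phi> = "\<lambda>s'. (nats s' ''t'' 0 - j) * (300 * (n + 1))" and
      I = "\<lambda>s'. cstate n w j s' \<and> nats s' ''comp'' x = Suc j \<and> (\<forall>v<n. nats s' ''comp'' v = 0 \<longleftrightarrow> nats s ''comp'' v = 0)"])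
  show "cstate n w j s \<and> nats s ''comp'' x = Suc j \<and> (\<forall>v<n. nats s ''comp'' v = 0 \<longleftrightarrow> nats s ''comp'' v = 0)"
    using cs x by simp
next
  fix s' assume I: "cstate n w j s' \<and> nats s' ''comp'' x = Suc j \<and> (\<forall>v<n. nats s' ''comp'' v = 0 \<longleftrightarrow> nats s ''comp'' v = 0)"
    and fr: "frame merge s s'" and e: "bval (NLess (At ''comp'' ''x'') (NAdd (Var ''t'') (NConst 1))) s'"
  have rows': "rows n s'" by (rule rows_cong[OF rows]) (simp_all add: frameD[OF fr])
  have x': "nats s' ''x'' 0 = x" using x by (simp add: frameD[OF fr])
  have "j < nats s' ''t'' 0" using e I x' by simp
  then obtain tp where tp: "nats s' ''t'' 0 = Suc tp" "j \<le> tp" by (metis Suc_leI Suc_le_D Suc_le_mono)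
  show "wp merge (\<lambda>d s''. (cstate n w j s'' \<and> nats s'' ''comp'' x = Suc j \<and>
       (\<forall>v<n. nats s'' ''comp'' v = 0 \<longleftrightarrow> nats s ''comp'' v = 0)) \<and>
       Suc (bcost (NLess (At ''comp'' ''x'') (NAdd (Var ''t'') (NConst 1)))) + d +
        (nats s'' ''t'' 0 - j) * (300 * (n + 1)) \<le> (nats s' ''t'' 0 - j) * (300 * (n + 1))) 0 s'"
  proof (rule wp_merge[OF rows' tp])
    show "cstate n w j s'" using I by simp
    fix d s'' assume d: "d \<le> 0 + n * 114 + 24" and t'': "nats s'' ''t'' 0 = tp" and cs'': "cstate n w j s''"
      and c: "\<forall>v<n. nats s'' ''comp'' v = (if nats s' ''comp'' v = Suc (Suc tp) then Suc tp else nats s' ''comp'' v)"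
    have "nats s'' ''comp'' x = Suc j" using c x(2) I tp(2) by auto
    moreover have "\<forall>v<n. nats s'' ''comp'' v = 0 \<longleftrightarrow> nats s ''comp'' v = 0" using c I by auto
    moreover have "(Suc tp - j) * (300 * (n + 1)) = 300 * (n + 1) + (tp - j) * (300 * (n + 1))"
      using tp(2) by (simp add: Suc_diff_le)
    ultimately show "(cstate n w j s'' \<and> nats s'' ''comp'' x = Suc j \<and>
       (\<forall>v<n. nats s'' ''comp'' v = 0 \<longleftrightarrow> nats s ''comp'' v = 0)) \<and>
       Suc (bcost (NLess (At ''comp'' ''x'') (NAdd (Var ''t'') (NConst 1)))) + d +
        (nats s'' ''t'' 0 - j) * (300 * (n + 1)) \<le> (nats s' ''t'' 0 - j) * (300 * (n + 1))"
      using d t'' cs'' tp by simp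
  qed
next
  fix d s' assume I: "cstate n w j s' \<and> nats s' ''comp'' x = Suc j \<and> (\<forall>v<n. nats s' ''comp'' v = 0 \<longleftrightarrow> nats s ''comp'' v = 0)"
    and fr: "frame merge s s'" and e: "\<not> bval (NLess (At ''comp'' ''x'') (NAdd (Var ''t'') (NConst 1))) s'"
    and d: "d \<le> t + (nats s ''t'' 0 - j) * (300 * (n + 1)) +
      Suc (bcost (NLess (At ''comp'' ''x'') (NAdd (Var ''t'') (NConst 1))))"
  show "Q d s'"
  proof (rule post)
    show "frame contract s s'" using fr by (simp add: frame_def)
    have "nats s' ''x'' 0 = x" using x by (simp add: frameD[OF fr])
    then have "nats s' ''t'' 0 \<le> j" using e I by simp
    moreover have "j \<le> nats s' ''t'' 0" using I by (simp add: cstate_def contraction_state_def)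
    ultimately show "nats s' ''t'' 0 = j" by simp
  qed (use I d in simp_all)
qed

definition record_arc :: com where
  "record_arc = Seq (NAssign ''src'' (Var ''K'') (Var ''x''))
     (Seq (NAssign ''dst'' (Var ''K'') (NCell ''h'' (idx ''t'' ''x''))) (setv ''K'' (NAdd (Var ''K'') (NConst 1))))"

lemma record_arc_writes [simp]: "nwr record_arc = {''src'', ''dst'', ''K''}" "rwr record_arc = {}"
  by (auto simp: record_arc_def)

lemma wp_record_arc:
  assumes rows: "rows n s" and tp: "nats s ''t'' 0 = tp" "tp < n"
    and post: "\<And>d s'. frame record_arc s s' \<Longrightarrow> d \<le> t + 40 \<Longrightarrow>
      nats s' ''src'' = (nats s ''src'')(nats s ''K'' 0 := nats s ''x'' 0) \<Longrightarrow>
      nats s' ''dst'' = (nats s ''dst'')(nats s ''K'' 0 := nats s ''h'' (tp * n + nats s ''x'' 0)) \<Longrightarrow>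
      nats s' ''K'' 0 = Suc (nats s ''K'' 0) \<Longrightarrow> Q d s'"
  shows "wp record_arc Q t s"
proof (rule wp_frame)
  note rws = rowsD[OF rows]
  show "wp record_arc (\<lambda>t s'. frame record_arc s s' \<longrightarrow> Q t s') t s"
    using tp by (auto simp: record_arc_def set_simps rws intro!: post)
qed

definition push_or_contract :: com where
  "push_or_contract = Cond (NEq (At ''comp'' ''x'') (NConst 0))
     (Seq (setv ''t'' (NAdd (Var ''t'') (NConst 1))) push) contract"

lemma push_or_contract_writes [simp]:
  "nwr push_or_contract = {''u'', ''t'', ''comp'', ''h''}" "rwr push_or_contract = {''q''}"
  by (auto simp: push_or_contract_def)

definition advance :: com where
  "advance = Cond (NEq (Var ''f'') (NConst 0)) (setv ''run'' (NConst 0))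
     (Seq record_arc (Seq subtract push_or_contract))"

lemma advance_writes [simp]:
  "nwr advance = {''u'', ''run'', ''src'', ''dst'', ''K'', ''t'', ''comp'', ''h''}" "rwr advance = {''q''}"
  by (auto simp: advance_def)

definition step :: com where
  "step = Seq scan advance"

lemma step_writes [simp]:
  "nwr step = {''f'', ''u'', ''x'', ''run'', ''src'', ''dst'', ''K'', ''t'', ''comp'', ''h''}"
  "rwr step = {''best'', ''q''}"
  by (auto simp: step_def)

text \<open>An off-path vertex counts twice: once for its push and once for the later merge of the
  position that it opens.\<close>

definition potential :: "nat \<Rightarrow> store \<Rightarrow> nat" where
  "potential n s = 2 * card {v. v < n \<and> nats s ''comp'' v = 0} + nats s ''t'' 0"

definition finished :: "nat \<Rightarrow> (nat \<Rightarrow> nat \<Rightarrow> real) \<Rightarrow> store \<Rightarrow> bool" where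
  "finished n w s \<longleftrightarrow> nats s ''K'' 0 \<le> 2 * n \<and> strong_upto (nats s ''src'') (nats s ''dst'') (nats s ''K'' 0) {..<n} \<and>
     (\<exists>S y. dual_log n w (nats s ''K'' 0) (nats s ''src'') (nats s ''dst'') S y)"

text \<open>A push lowers the potential by 1, a contraction by its number \<open>tp - j\<close> of
  merges, and each unit pays for \<open>700 * (n + 1)\<close> operations. The slack of 10 covers the
  guard of the surrounding loop.\<close>

lemma wp_step:
  assumes rows: "rows n s" and tp: "nats s ''t'' 0 = tp" and cs: "cstate n w tp s"
    and w: "\<forall>u<n. \<forall>v<n. reals s ''w'' (v * n + u) = w u v"
    and post: "\<And>d s'. frame step s s' \<Longrightarrow> (nats s' ''run'' 0 = 0 \<and> finished n w s' \<and> d \<le> 400 * (n + 1)) \<or>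
        (nats s' ''run'' 0 = nats s ''run'' 0 \<and> cstate n w (nats s' ''t'' 0) s' \<and>
         d + 10 + 700 * (n + 1) * potential n s' \<le> 700 * (n + 1) * potential n s) \<Longrightarrow> Q d s'"
  shows "wp step Q 0 s"
proof (rule wp_frame)
  let ?Q = "\<lambda>d s'. frame step s s' \<longrightarrow> Q d s'"
  have tpn: "tp < n" and le: "\<forall>v<n. nats s ''comp'' v \<le> Suc tp"
    using cs tp by (simp_all add: cstate_def contraction_state_def)
  note cs0 = cs[unfolded cstate_def tp]
  have "wp scan (wp advance ?Q) 0 s"
  proof (rule wp_scan[OF rows tp tpn])
    fix d1 s1 assume fr: "frame scan s s1" and d1: "d1 \<le> 0 + n * 72 + 12" and f: "nats s1 ''f'' 0 = 0"
      and full: "\<forall>v<n. nats s ''comp'' v = Suc tp"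
    obtain S y where "dual_log n w (nats s ''K'' 0) (nats s ''src'') (nats s ''dst'') S y"
      "strong_upto (nats s ''src'') (nats s ''dst'') (nats s ''K'' 0) {..<n}" "nats s ''K'' 0 \<le> 2 * n"
      by (rule contraction_state_full[OF cs0 full])
    then have "finished n w (set_nat ''run'' 0 0 s1)"
      by (auto simp: finished_def set_simps frameD[OF fr])
    then show "wp advance ?Q d1 s1"
      using f d1 post by (simp add: set_simps advance_def)
  next
    fix d1 s1 x assume fr1: "frame scan s s1" and d1: "d1 \<le> 0 + n * 72 + 12" and f: "nats s1 ''f'' 0 = 1"
      and x: "nats s1 ''x'' 0 = x" "x < n" "nats s ''comp'' x \<noteq> Suc tp"
      and best: "reals s1 ''best'' 0 = reals s ''q'' (tp * n + x)"
      and least: "\<forall>v<n. nats s ''comp'' v \<noteq> Suc tp \<longrightarrow> reals s ''q'' (tp * n + x) \<le> reals s ''q'' (tp * n + v)"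
    have rows1: "rows n s1" by (rule rows_cong[OF rows]) (simp_all add: frameD[OF fr1])
    have t1: "nats s1 ''t'' 0 = tp" using tp by (simp add: frameD[OF fr1])
    have "wp record_arc (wp subtract (wp push_or_contract ?Q)) (d1 + 5) s1"
    proof (rule wp_record_arc[OF rows1 t1 tpn])
      fix d2 s2 assume fr2: "frame record_arc s1 s2" and d2: "d2 \<le> d1 + 5 + 40"
        and src: "nats s2 ''src'' = (nats s1 ''src'')(nats s1 ''K'' 0 := nats s1 ''x'' 0)"
        and dst: "nats s2 ''dst'' = (nats s1 ''dst'')(nats s1 ''K'' 0 := nats s1 ''h'' (tp * n + nats s1 ''x'' 0))"
        and K: "nats s2 ''K'' 0 = Suc (nats s1 ''K'' 0)"
      have rows2: "rows n s2" by (rule rows_cong[OF rows1]) (simp_all add: frameD[OF fr2])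
      have t2: "nats s2 ''t'' 0 = tp" using t1 by (simp add: frameD[OF fr2])
      show "wp subtract (wp push_or_contract ?Q) d2 s2"
      proof (rule wp_subtract[OF rows2 t2 tpn])
        fix d3 s3 assume fr3: "frame subtract s2 s3" and d3: "d3 \<le> d2 + n * 42 + 9"
          and q: "\<forall>p v. v < n \<longrightarrow> reals s3 ''q'' (p * n + v) =
             (if p = tp then reals s2 ''q'' (p * n + v) - reals s2 ''best'' 0 else reals s2 ''q'' (p * n + v))"
        have rows3: "rows n s3" by (rule rows_cong[OF rows2]) (simp_all add: frameD[OF fr3])
        have eqs: "nats s3 ''t'' 0 = tp" "nats s3 ''x'' 0 = x" "nats s3 ''comp'' = nats s ''comp''"
          "nats s3 ''h'' = nats s ''h''" "reals s3 ''w'' = reals s ''w''"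
          "nats s3 ''src'' = (nats s ''src'')(nats s ''K'' 0 := x)"
          "nats s3 ''dst'' = (nats s ''dst'')(nats s ''K'' 0 := nats s ''h'' (tp * n + x))"
          "nats s3 ''K'' 0 = Suc (nats s ''K'' 0)" "nats s3 ''run'' = nats s ''run''"
          using t2 x src dst K by (simp_all add: frameD[OF fr1] frameD[OF fr2] frameD[OF fr3])
        have q1: "\<forall>p\<le>tp. \<forall>v<n. reals s3 ''q'' (p * n + v) =
            (if p = tp then reals s ''q'' (p * n + v) - reals s ''q'' (tp * n + x) else reals s ''q'' (p * n + v))"
          using q best by (simp add: frameD[OF fr1] frameD[OF fr2])
        have d3': "d3 \<le> 200 * (n + 1)" using d1 d2 d3 by simp
        show "wp push_or_contract ?Q d3 s3"
        proof (cases "nats s ''comp'' x = 0")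
          case True
          let ?s = "set_nat ''t'' 0 (Suc tp) s3"
          have rows4: "rows n ?s" by (rule rows_cong[OF rows3]) (simp_all add: set_simps)
          \<comment> \<open>That there is room for one more position is read off the abstract path
            after the push.\<close>
          have tpn': "Suc tp < n"
          proof -
            obtain S y where st: "path_stack n (nats s ''K'' 0) (nats s ''src'') (nats s ''dst'') S (nats s ''comp'') tp"
              by (rule contraction_stateD[OF cs0])
            then have "comp_set n (nats s ''comp'') tp \<noteq> {}" by (simp add: path_stack_def)
            then obtain v where "v \<in> comp_set n (nats s ''comp'') tp" by blast
            from path_stack_top_less[OF path_stack_push[OF st x(2) True this]] show ?thesis .
          qed
          have "wp push ?Q (d3 + 12) ?s"
          proof (rule wp_push[OF rows4 _ tpn' _ x(2)])
            show "nats ?s ''t'' 0 = Suc tp" "nats ?s ''x'' 0 = x" by (simp_all add: set_simps eqs)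
            fix d4 s4 assume fr4: "frame push ?s s4" and d4: "d4 \<le> d3 + 12 + n * 40 + 40"
              and c4: "nats s4 ''comp'' = (nats ?s ''comp'')(x := Suc (Suc tp))"
              and q4: "\<forall>p v. v < n \<longrightarrow> reals s4 ''q'' (p * n + v) = (if p = Suc tp then reals ?s ''w'' (x * n + v) else reals ?s ''q'' (p * n + v)) \<and>
                nats s4 ''h'' (p * n + v) = (if p = Suc tp then x else nats ?s ''h'' (p * n + v))"
            have eqs4: "nats s4 ''t'' 0 = Suc tp" "nats s4 ''src'' = nats s3 ''src''" "nats s4 ''dst'' = nats s3 ''dst''"
              "nats s4 ''K'' 0 = Suc (nats s ''K'' 0)" "nats s4 ''run'' = nats s ''run''"
              "nats s4 ''comp'' = (nats s ''comp'')(x := Suc (Suc tp))"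
              using c4 by (simp_all add: frameD[OF fr4] set_simps eqs)
            have "cstate n w (Suc tp) s4"
              unfolding cstate_def eqs4 eqs
              by (rule contraction_state_push[OF cs0 x(2) True least q1])
                (use q4 w x(2) in \<open>simp add: set_simps eqs\<close>)
            moreover have "potential n s = Suc (potential n s4)"
            proof -
              have "{v. v < n \<and> nats s ''comp'' v = 0} = insert x {v. v < n \<and> nats s4 ''comp'' v = 0}"
                using x(2) True by (auto simp: eqs4)
              then have "card {v. v < n \<and> nats s ''comp'' v = 0} = Suc (card {v. v < n \<and> nats s4 ''comp'' v = 0})"
                by (simp add: eqs4)
              then show ?thesis by (simp add: potential_def tp eqs4(1))
            qed
            then have "700 * (n + 1) * potential n s = 700 * (n + 1) * potential n s4 + 700 * (n + 1)" by simp
            then have "d4 + 10 + 700 * (n + 1) * potential n s4 \<le> 700 * (n + 1) * potential n s"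
              using d3' d4 by simp
            ultimately show "frame step s s4 \<longrightarrow> Q d4 s4" using post[of s4 d4] by (simp add: eqs4)
          qed
          then show ?thesis using True by (simp add: push_or_contract_def eqs eval_nat_numeral)
        next
          case False
          then obtain j where j: "nats s ''comp'' x = Suc j" using not0_implies_Suc by blast
          then have jt: "j < tp" using le x(2,3) by (metis Suc_le_mono le_neq_implies_less)
          have cs3: "cstate n w j s3"
            unfolding cstate_def eqs
            by (rule contraction_state_contract[OF cs0 x(2) j jt least q1])
          have x3: "nats s3 ''comp'' x = Suc j" using j by (simp add: eqs)
          have "wp contract ?Q (d3 + 6) s3"
          proof (rule wp_contract[OF rows3 cs3 eqs(2) x(2) x3])
            fix d4 s4 assume fr4: "frame contract s3 s4" and cs4: "cstate n w j s4" and t4: "nats s4 ''t'' 0 = j"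
              and c4: "\<forall>v<n. nats s4 ''comp'' v = 0 \<longleftrightarrow> nats s3 ''comp'' v = 0"
              and d4: "d4 \<le> d3 + 6 + (nats s3 ''t'' 0 - j) * (300 * (n + 1)) + 9"
            have run: "nats s4 ''run'' = nats s ''run''" by (simp add: frameD[OF fr4] eqs)
            have "{v. v < n \<and> nats s4 ''comp'' v = 0} = {v. v < n \<and> nats s ''comp'' v = 0}"
              using c4 by (auto simp: eqs)
            then have "potential n s = potential n s4 + (tp - j)"
              using jt by (simp add: potential_def tp t4)
            then have P: "700 * (n + 1) * potential n s = 700 * (n + 1) * potential n s4 + 700 * (n + 1) * (tp - j)"
              by (simp only: distrib_left)
            define D where "D = (tp - j) * (n + 1)"
            \<comment> \<open>At least one merge takes place, so the fixed part of the step can be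
              charged to \<open>D\<close> too.\<close>
            have "1 * (n + 1) \<le> D" unfolding D_def using jt by (intro mult_right_mono) auto
            moreover have "700 * (n + 1) * (tp - j) = 700 * D" "(tp - j) * (300 * (n + 1)) = 300 * D"
              by (simp_all only: D_def mult_ac)
            ultimately have "d4 + 10 + 700 * (n + 1) * potential n s4 \<le> 700 * (n + 1) * potential n s"
              using d3' d4 unfolding P eqs(1) by simp
            then show "frame step s s4 \<longrightarrow> Q d4 s4" using post[of s4 d4] cs4 run t4 by simp
          qed
          then show ?thesis using j by (simp add: push_or_contract_def eqs eval_nat_numeral)
        qed
      qed
    qed
    then show "wp advance ?Q d1 s1"
      using f by (simp add: advance_def eval_nat_numeral)
  qed
  then show "wp step ?Q 0 s" by (simp add: step_def)
qed


section \<open>The contraction loop and its running time\<close>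

definition clear_comp :: com where
  "clear_comp = For ''i'' ''m'' (NAssign ''comp'' (Var ''i'') (NConst 0))"

lemma clear_comp_writes [simp]: "nwr clear_comp = {''i'', ''comp''}" "rwr clear_comp = {}"
  by (auto simp: clear_comp_def)

lemma wp_clear_comp:
  assumes rows: "rows n s"
    and post: "\<And>d s'. frame clear_comp s s' \<Longrightarrow> d \<le> t + n * 22 + 9 \<Longrightarrow> \<forall>v<n. nats s' ''comp'' v = 0 \<Longrightarrow> Q d s'"
  shows "wp clear_comp Q t s"
  unfolding clear_comp_def
  apply (rule wp_For[where n = n and B = 10 and I = "\<lambda>k s'. \<forall>v<k. nats s' ''comp'' v = 0"])
  prefer 6
  subgoal by (auto simp: set_simps less_Suc_eq)
  prefer 6
  subgoal for d s' using post[of s' d] by (simp add: clear_comp_def)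
  by (simp_all add: set_simps rowsD[OF rows])

definition contraction_loop :: com where
  "contraction_loop = While (NEq (Var ''run'') (NConst 1)) step"

lemma contraction_loop_writes [simp]: "nwr contraction_loop = nwr step" "rwr contraction_loop = rwr step"
  by (auto simp: contraction_loop_def)

lemma wp_contraction_loop:
  assumes rows: "rows n s" and cs: "cstate n w (nats s ''t'' 0) s" and run: "nats s ''run'' 0 = 1"
    and w: "\<forall>u<n. \<forall>v<n. reals s ''w'' (v * n + u) = w u v"
    and post: "\<And>d s'. frame contraction_loop s s' \<Longrightarrow> finished n w s' \<Longrightarrow>
      d \<le> t + 700 * (n + 1) * (potential n s + 1) + 5 \<Longrightarrow> Q d s'"
  shows "wp contraction_loop Q t s"
  unfolding contraction_loop_def
\<comment> \<open>The extra unit beside the potential pays for the last round, in which the scan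
  finds nothing and \<open>run\<close> is cleared.\<close>
proof (rule wp_While[where \<Phi> = "\<lambda>s'. if nats s' ''run'' 0 = 1 then 700 * (n + 1) * (potential n s' + 1) else 0" and
      I = "\<lambda>s'. (nats s' ''run'' 0 = 1 \<and> cstate n w (nats s' ''t'' 0) s') \<or> (nats s' ''run'' 0 = 0 \<and> finished n w s')"])
  show "(nats s ''run'' 0 = 1 \<and> cstate n w (nats s ''t'' 0) s) \<or> (nats s ''run'' 0 = 0 \<and> finished n w s)"
    using cs run by simp
next
  fix s' assume I: "(nats s' ''run'' 0 = 1 \<and> cstate n w (nats s' ''t'' 0) s') \<or> (nats s' ''run'' 0 = 0 \<and> finished n w s')"
    and fr: "frame step s s'" and e: "bval (NEq (Var ''run'') (NConst 1)) s'"
  then have run': "nats s' ''run'' 0 = 1" and cs': "cstate n w (nats s' ''t'' 0) s'" by auto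
  have rows': "rows n s'" by (rule rows_cong[OF rows]) (simp_all add: frameD[OF fr])
  have w': "\<forall>u<n. \<forall>v<n. reals s' ''w'' (v * n + u) = w u v" using w by (simp add: frameD[OF fr])
  show "wp step (\<lambda>d s''. ((nats s'' ''run'' 0 = 1 \<and> cstate n w (nats s'' ''t'' 0) s'') \<or>
         (nats s'' ''run'' 0 = 0 \<and> finished n w s'')) \<and>
       Suc (bcost (NEq (Var ''run'') (NConst 1))) + d +
         (if nats s'' ''run'' 0 = 1 then 700 * (n + 1) * (potential n s'' + 1) else 0)
       \<le> (if nats s' ''run'' 0 = 1 then 700 * (n + 1) * (potential n s' + 1) else 0)) 0 s'"
    by (rule wp_step[OF rows' refl cs' w']) (use run' in \<open>auto simp: algebra_simps\<close>)
next
  fix d s' assume "(nats s' ''run'' 0 = 1 \<and> cstate n w (nats s' ''t'' 0) s') \<or> (nats s' ''run'' 0 = 0 \<and> finished n w s')"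
    and "frame step s s'" "\<not> bval (NEq (Var ''run'') (NConst 1)) s'"
    "d \<le> t + (if nats s ''run'' 0 = 1 then 700 * (n + 1) * (potential n s + 1) else 0)
       + Suc (bcost (NEq (Var ''run'') (NConst 1)))"
  then show "Q d s'" using run by (intro post) (auto simp: frame_def)
qed

definition contraction_phase :: com where
  "contraction_phase = Seq clear_comp (Seq (setv ''x'' (NConst 0)) (Seq (setv ''t'' (NConst 0)) (Seq push
     (Seq (setv ''K'' (NConst 0)) (Seq (setv ''run'' (NConst 1)) contraction_loop)))))"

lemma contraction_phase_writes [simp]: "nwr contraction_phase = insert ''i'' (nwr step)" "rwr contraction_phase = rwr step"
  by (auto simp: contraction_phase_def)

lemma wp_contraction_phase:
  assumes rows: "rows n s" and n: "0 < n" and nonneg: "\<forall>u<n. \<forall>v<n. 0 \<le> w u v"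
    and w: "\<forall>u<n. \<forall>v<n. reals s ''w'' (v * n + u) = w u v"
    and post: "\<And>d s'. frame contraction_phase s s' \<Longrightarrow> finished n w s' \<Longrightarrow> d \<le> t + 2000 * (n + 1) ^ 2 \<Longrightarrow> Q d s'"
  shows "wp contraction_phase Q t s"
proof (rule wp_frame)
  let ?Q = "\<lambda>d s'. frame contraction_phase s s' \<longrightarrow> Q d s'"
  have "wp clear_comp (wp (Seq (setv ''x'' (NConst 0)) (Seq (setv ''t'' (NConst 0)) (Seq push
     (Seq (setv ''K'' (NConst 0)) (Seq (setv ''run'' (NConst 1)) contraction_loop))))) ?Q) t s"
  proof (rule wp_clear_comp[OF rows])
    fix d1 s1 assume fr1: "frame clear_comp s s1" and d1: "d1 \<le> t + n * 22 + 9"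
      and c1: "\<forall>v<n. nats s1 ''comp'' v = 0"
    let ?s = "set_nat ''t'' 0 0 (set_nat ''x'' 0 0 s1)"
    have rows1: "rows n ?s" by (rule rows_cong[OF rows]) (simp_all add: frameD[OF fr1] set_simps)
    have "wp push (wp (Seq (setv ''K'' (NConst 0)) (Seq (setv ''run'' (NConst 1)) contraction_loop)) ?Q) (d1 + 6) ?s"
    proof (rule wp_push[OF rows1 _ n _ n])
      show "nats ?s ''t'' 0 = 0" "nats ?s ''x'' 0 = 0" by (simp_all add: set_simps)
      fix d2 s2 assume fr2: "frame push ?s s2" and d2: "d2 \<le> d1 + 6 + n * 40 + 40"
        and c2: "nats s2 ''comp'' = (nats ?s ''comp'')(0 := Suc 0)"
        and q2: "\<forall>p v. v < n \<longrightarrow> reals s2 ''q'' (p * n + v) = (if p = 0 then reals ?s ''w'' (0 * n + v) else reals ?s ''q'' (p * n + v)) \<and>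
         nats s2 ''h'' (p * n + v) = (if p = 0 then 0 else nats ?s ''h'' (p * n + v))"
      let ?s2 = "set_nat ''run'' 0 1 (set_nat ''K'' 0 0 s2)"
      have rows2: "rows n ?s2" by (rule rows_cong[OF rows1]) (simp_all add: frameD[OF fr2] set_simps)
      have t2: "nats ?s2 ''t'' 0 = 0" by (simp add: frameD[OF fr2] set_simps)
      have cs: "cstate n w (nats ?s2 ''t'' 0) ?s2"
        unfolding cstate_def t2
      proof -
        have "contraction_state n w 0 (nats ?s2 ''src'') (nats ?s2 ''dst'') 0 (nats ?s2 ''comp'') 0 (reals ?s2 ''q'') (nats ?s2 ''h'')"
        proof (rule contraction_state_start[OF n nonneg])
          show "\<forall>x<n. nats ?s2 ''comp'' x = (if x = 0 then 1 else 0)"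
            using c1 c2 by (simp add: set_simps)
          show "\<forall>x<n. reals ?s2 ''q'' x = w x 0 \<and> nats ?s2 ''h'' x = 0"
          proof (intro allI impI)
            fix x assume "x < n"
            then show "reals ?s2 ''q'' x = w x 0 \<and> nats ?s2 ''h'' x = 0"
              using q2[rule_format, of x 0] w[rule_format, of x 0] n by (simp add: frameD[OF fr1] set_simps)
          qed
        qed
        then show "contraction_state n w (nats ?s2 ''K'' 0) (nats ?s2 ''src'') (nats ?s2 ''dst'') 0 (nats ?s2 ''comp'') 0 (reals ?s2 ''q'') (nats ?s2 ''h'')"
          by (simp add: set_simps)
      qed
      have w2: "\<forall>u<n. \<forall>v<n. reals ?s2 ''w'' (v * n + u) = w u v"
        using w by (simp add: frameD[OF fr1] frameD[OF fr2])
      have pot: "potential n ?s2 \<le> 2 * n"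
      proof -
        have "card {v. v < n \<and> nats ?s2 ''comp'' v = 0} \<le> card {..<n}" by (intro card_mono) auto
        then show ?thesis using t2 by (simp add: potential_def)
      qed
      have "wp contraction_loop ?Q (d2 + 6) ?s2"
      proof (rule wp_contraction_loop[OF rows2 cs _ w2])
        show "nats ?s2 ''run'' 0 = 1" by (simp add: set_simps)
        fix d3 s3 assume fin: "finished n w s3" and d3: "d3 \<le> d2 + 6 + 700 * (n + 1) * (potential n ?s2 + 1) + 5"
        have "700 * (n + 1) * (potential n ?s2 + 1) \<le> 700 * (n + 1) * (2 * n + 1)"
          using pot by (intro mult_left_mono) auto
        \<comment> \<open>The initial potential is at most \<open>2 * n\<close>, so the loop
          contributes about \<open>1400 * n ^ 2\<close>; initialisation is linear.\<close>
        then have "d3 \<le> t + 2000 * (n + 1) ^ 2"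
          using d1 d2 d3 by (simp add: power2_eq_square algebra_simps)
        then show "?Q d3 s3" using post fin by blast
      qed
      then show "wp (Seq (setv ''K'' (NConst 0)) (Seq (setv ''run'' (NConst 1)) contraction_loop)) ?Q d2 s2"
        by (simp add: eval_nat_numeral)
    qed
    then show "wp (Seq (setv ''x'' (NConst 0)) (Seq (setv ''t'' (NConst 0)) (Seq push
     (Seq (setv ''K'' (NConst 0)) (Seq (setv ''run'' (NConst 1)) contraction_loop))))) ?Q d1 s1"
      by (simp add: eval_nat_numeral)
  qed
  then show "wp contraction_phase ?Q t s" by (simp add: contraction_phase_def)
qed

section \<open>Growing the branching from the log\<close>

definition find_arc :: com where
  "find_arc = For ''i'' ''K'' (Cond (BAnd (NEq (Var ''f'') (NConst 0))
       (BAnd (NEq (NCell ''X'' (At ''src'' ''i'')) (NConst 1)) (NEq (NCell ''X'' (At ''dst'' ''i'')) (NConst 0))))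
     (Seq (NAssign ''X'' (At ''dst'' ''i'') (NConst 1))
       (Seq (NAssign ''A'' (NAdd (NCell ''row'' (At ''src'' ''i'')) (At ''dst'' ''i'')) (NConst 1))
          (setv ''f'' (NConst 1)))) Skip)"

lemma find_arc_writes [simp]: "nwr find_arc = {''i'', ''X'', ''A'', ''f''}" "rwr find_arc = {}"
  by (auto simp: find_arc_def)

definition growth_stored :: "nat \<Rightarrow> nat set \<Rightarrow> (nat \<times> nat) set \<Rightarrow> store \<Rightarrow> bool" where
  "growth_stored n X F s \<longleftrightarrow> X \<subseteq> {..<n} \<and> (\<forall>v<n. nats s ''X'' v = (if v \<in> X then 1 else 0)) \<and>
     (\<forall>u<n. \<forall>v<n. nats s ''A'' (u * n + v) = (if (u, v) \<in> F then 1 else 0))"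

text \<open>A loop cannot be left early, so \<open>f\<close> disables the rounds after the first
  hit. Only one arc is added per pass: an older arc may leave the enlarged set, and the search for
  the earliest one must start afresh.\<close>

lemma wp_find_arc:
  assumes rows: "rows n s" and f: "nats s ''f'' 0 = 0"
    and K: "nats s ''K'' 0 = K" "nats s ''src'' = src" "nats s ''dst'' = dst"
    and log: "dual_log n w K src dst S y" and strong: "strong_upto src dst K {..<n}" and r: "r < n"
    and gr: "tight_growth K src dst S r X F" "growth_stored n X F s" "X = {..<n} \<or> c < card X"
    and post: "\<And>d s' X F. frame find_arc s s' \<Longrightarrow> d \<le> t + K * 72 + 9 \<Longrightarrow> tight_growth K src dst S r X F \<Longrightarrow>
      growth_stored n X F s' \<Longrightarrow> X = {..<n} \<or> Suc c < card X \<Longrightarrow> Q d s'"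
  shows "wp find_arc Q t s"
proof -
  note rws = rowsD[OF rows]
  have bounds: "src i < n" "dst i < n" if "i < K" for i
    using log that by (auto simp: dual_log_def)
  show ?thesis
    unfolding find_arc_def
    apply (rule wp_For[where n = K and B = 60 and I = "\<lambda>k s'. \<exists>X F. tight_growth K src dst S r X F \<and> growth_stored n X F s' \<and>
       ((nats s' ''f'' 0 = 0 \<and> (X = {..<n} \<or> c < card X) \<and> (\<forall>j<k. \<not> (src j \<in> X \<and> dst j \<notin> X))) \<or>
        (nats s' ''f'' 0 = 1 \<and> (X = {..<n} \<or> Suc c < card X)))"])
    prefer 6
    subgoal premises p for k s'
    proof -
      have eqs: "nats s' ''row'' = nats s ''row''" "nats s' ''src'' = src" "nats s' ''dst'' = dst"
        using K by (simp_all add: frameD[OF p(2)])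
      obtain X F where X: "tight_growth K src dst S r X F" "growth_stored n X F s'"
        and fl: "(nats s' ''f'' 0 = 0 \<and> (X = {..<n} \<or> c < card X) \<and> (\<forall>j<k. \<not> (src j \<in> X \<and> dst j \<notin> X))) \<or>
        (nats s' ''f'' 0 = 1 \<and> (X = {..<n} \<or> Suc c < card X))"
        using p(4) by blast
      have mem: "nats s' ''X'' v = (if v \<in> X then 1 else 0)" if "v < n" for v
        using X(2) that by (simp add: growth_stored_def)
      note b = bounds[OF p(1)]
      show ?thesis
      proof (cases "nats s' ''f'' 0 = 0 \<and> src k \<in> X \<and> dst k \<notin> X")
        case True
        let ?X = "insert (dst k) X" and ?F = "insert (src k, dst k) F"
        have "tight_growth K src dst S r ?X ?F"
          by (rule tight_growth_step[OF log X(1) p(1)]) (use True fl in auto)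
        moreover have "growth_stored n ?X ?F
            (set_nat ''i'' 0 (Suc k) (set_nat ''f'' 0 1 (set_nat ''A'' (src k * n + dst k) 1 (set_nat ''X'' (dst k) 1 s'))))"
          using X(2) b by (auto simp: growth_stored_def set_simps row_index_eq)
        moreover have "Suc c < card ?X"
        proof -
          have "X \<noteq> {..<n}" using True b by auto
          moreover have "finite X" using X(2) finite_subset by (auto simp: growth_stored_def)
          ultimately show ?thesis using True fl by auto
        qed
        ultimately show ?thesis
          using True b by (auto simp: p(3) eqs mem rws set_simps)
      next
        case False
        have "growth_stored n X F (set_nat ''i'' 0 (Suc k) s')" using X(2) by (simp add: growth_stored_def set_simps)
        moreover have "(nats s' ''f'' 0 = 0 \<and> (X = {..<n} \<or> c < card X) \<and> (\<forall>j<Suc k. \<not> (src j \<in> X \<and> dst j \<notin> X))) \<or>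
          (nats s' ''f'' 0 = 1 \<and> (X = {..<n} \<or> Suc c < card X))"
          using fl False by (auto simp: less_Suc_eq)
        ultimately show ?thesis
          using False b X(1) by (auto simp: p(3) eqs mem set_simps)
      qed
    qed
    prefer 6
    subgoal premises p for d s'
    proof -
      obtain X F where X: "tight_growth K src dst S r X F" "growth_stored n X F s'"
        and fl: "(nats s' ''f'' 0 = 0 \<and> (X = {..<n} \<or> c < card X) \<and> (\<forall>j<K. \<not> (src j \<in> X \<and> dst j \<notin> X))) \<or>
        (nats s' ''f'' 0 = 1 \<and> (X = {..<n} \<or> Suc c < card X))"
        using p(2) by blast
      have "X = {..<n} \<or> Suc c < card X"
      proof (cases "{..<n} \<subseteq> X")
        case True
        then show ?thesis using X(2) by (auto simp: growth_stored_def)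
      next
        case False
        have rn: "r \<in> {..<n}" using r by simp
        obtain i where "i < K" "src i \<in> X" "dst i \<notin> X"
          by (rule tight_growth_continues[OF strong X(1) rn False])
        then show ?thesis using fl by blast
      qed
      then show ?thesis using post[OF _ _ X] p(1,3) by (simp add: find_arc_def)
    qed
    subgoal by simp
    subgoal by simp
    subgoal by simp
    subgoal using K by simp
    subgoal
      by (rule exI[of _ X], rule exI[of _ F]) (use gr f in \<open>simp add: growth_stored_def set_simps\<close>)
    done
qed

definition grow_loop :: com where
  "grow_loop = For ''c'' ''m'' (Seq (setv ''f'' (NConst 0)) find_arc)"

lemma grow_loop_writes [simp]: "nwr grow_loop = {''c'', ''i'', ''X'', ''A'', ''f''}" "rwr grow_loop = {}"
  by (auto simp: grow_loop_def)

text \<open>After \<open>k\<close> passes the reached set is complete or has more than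
  \<open>k\<close> vertices, so \<open>n\<close> passes suffice. At most \<open>2 * n\<close> logged
  arcs at 72 operations each give the 144.\<close>

lemma wp_grow_loop:
  assumes rows: "rows n s" and fin: "finished n w s" and r: "r < n" and gr: "growth_stored n {r} {} s"
    and post: "\<And>d s' F. frame grow_loop s s' \<Longrightarrow> d \<le> t + n * (n * 144 + 24) + 9 \<Longrightarrow> optimal_branching n w r F \<Longrightarrow>
      growth_stored n {..<n} F s' \<Longrightarrow> Q d s'"
  shows "wp grow_loop Q t s"
proof -
  note rws = rowsD[OF rows]
  obtain K src dst S y where K: "nats s ''K'' 0 = K" "nats s ''src'' = src" "nats s ''dst'' = dst" "K \<le> 2 * n"
    and log: "dual_log n w K src dst S y" and strong: "strong_upto src dst K {..<n}"
    using fin by (auto simp: finished_def)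
  show ?thesis
    unfolding grow_loop_def
    apply (rule wp_For[where n = n and B = "n * 144 + 12" and I = "\<lambda>k s'. \<exists>X F. tight_growth K src dst S r X F \<and>
        growth_stored n X F s' \<and> (X = {..<n} \<or> k < card X)"])
    prefer 6
    subgoal premises p for k s'
    proof -
      let ?s = "set_nat ''f'' 0 0 s'"
      have rows': "rows n ?s" by (rule rows_cong[OF rows]) (simp_all add: frameD[OF p(2)] set_simps)
      have eqs: "nats ?s ''K'' 0 = K" "nats ?s ''src'' = src" "nats ?s ''dst'' = dst"
        using K by (simp_all add: frameD[OF p(2)] set_simps)
      obtain X F where X: "tight_growth K src dst S r X F" "growth_stored n X F s'" "X = {..<n} \<or> k < card X"
        using p(4) by blast
      then have X': "growth_stored n X F ?s" by (simp add: growth_stored_def set_simps)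
      have f: "nats ?s ''f'' 0 = 0" by (simp add: set_simps)
      have "wp find_arc (\<lambda>d s''. d \<le> n * 144 + 12 \<and> (\<exists>X F. tight_growth K src dst S r X F \<and>
        growth_stored n X F (set_nat ''c'' 0 (Suc k) s'') \<and> (X = {..<n} \<or> Suc k < card X))) 3 ?s"
      proof (rule wp_find_arc[OF rows' f eqs log strong r X(1) X' X(3)])
        fix d s'' X F assume "d \<le> 3 + K * 72 + 9" "tight_growth K src dst S r X F" "growth_stored n X F s''"
          "X = {..<n} \<or> Suc k < card X"
        then show "d \<le> n * 144 + 12 \<and> (\<exists>X F. tight_growth K src dst S r X F \<and>
          growth_stored n X F (set_nat ''c'' 0 (Suc k) s'') \<and> (X = {..<n} \<or> Suc k < card X))"
          using K(4) by (auto simp: growth_stored_def set_simps)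
      qed
      then show ?thesis by (simp add: eval_nat_numeral)
    qed
    prefer 6
    subgoal premises p for d s'
    proof -
      obtain X F where X: "tight_growth K src dst S r X F" "growth_stored n X F s'" "X = {..<n} \<or> n < card X"
        using p(2) by blast
      have "card X \<le> card {..<n}" using X(2) by (intro card_mono) (auto simp: growth_stored_def)
      then have "X = {..<n}" using X(3) by auto
      then show ?thesis
        using post[of s' d F] tight_growth_optimal[OF log] X p(1,3) by (simp add: grow_loop_def algebra_simps)
    qed
    subgoal by simp
    subgoal by simp
    subgoal by simp
    subgoal using rws by simp
    subgoal
      by (rule exI[of _ "{r}"], rule exI[of _ "{}"])
        (use gr in \<open>simp add: growth_stored_def set_simps tight_growth_start\<close>)
    done
qed

text \<open>The procedure runs twice in the same memory, so leftovers of the first run must be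
  erased here, as \<open>clear_comp\<close> does for the labels.\<close>

definition clear_growth :: com where
  "clear_growth = Seq (For ''i'' ''m'' (For ''j'' ''m'' (NAssign ''A'' (idx ''i'' ''j'') (NConst 0))))
     (Seq (For ''i'' ''m'' (NAssign ''X'' (Var ''i'') (NConst 0))) (NAssign ''X'' (Var ''r'') (NConst 1)))"

lemma clear_growth_writes [simp]: "nwr clear_growth = {''i'', ''j'', ''X'', ''A''}" "rwr clear_growth = {}"
  by (auto simp: clear_growth_def)

lemma wp_clear_growth:
  assumes rows: "rows n s" and r: "nats s ''r'' 0 = r" "r < n"
    and post: "\<And>d s'. frame clear_growth s s' \<Longrightarrow> d \<le> t + n * (n * 32 + 50) + 30 \<Longrightarrow>
      growth_stored n {r} {} s' \<Longrightarrow> Q d s'"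
  shows "wp clear_growth Q t s"
proof (rule wp_frame)
  let ?Q = "\<lambda>d s'. frame clear_growth s s' \<longrightarrow> Q d s'"
  note rws = rowsD[OF rows]
  let ?c2 = "Seq (For ''i'' ''m'' (NAssign ''X'' (Var ''i'') (NConst 0))) (NAssign ''X'' (Var ''r'') (NConst 1))"
  have "wp (For ''i'' ''m'' (For ''j'' ''m'' (NAssign ''A'' (idx ''i'' ''j'') (NConst 0)))) (wp ?c2 ?Q) t s"
    apply (rule wp_For2[where n = n and B = 20 and
        I = "\<lambda>i j s'. \<forall>u v. v < n \<longrightarrow> u < i \<or> u = i \<and> v < j \<longrightarrow> nats s' ''A'' (u * n + v) = 0"])
    prefer 12
    subgoal premises p for i j s'
    proof -
      have "nats s' ''row'' = nats s ''row''" by (simp_all add: frameD[OF p(3)])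
      then show ?thesis using p(1,2,6) by (auto simp: p(4,5) set_simps rws row_index_eq less_Suc_eq)
    qed
    prefer 12
    subgoal premises p for d1 s1
    proof -
      have rows1: "rows n s1" by (rule rows_cong[OF rows]) (simp_all add: frameD[OF p(1)])
      have r1: "nats s1 ''r'' 0 = r" using r by (simp add: frameD[OF p(1)])
      have "wp (For ''i'' ''m'' (NAssign ''X'' (Var ''i'') (NConst 0))) (wp (NAssign ''X'' (Var ''r'') (NConst 1)) ?Q) d1 s1"
        apply (rule wp_For[where n = n and B = 10 and I = "\<lambda>k s'. \<forall>v<k. nats s' ''X'' v = 0"])
        prefer 6
        subgoal by (auto simp: set_simps less_Suc_eq)
        prefer 6
        subgoal premises p' for d2 s2
        proof -
          have r2: "nats s2 ''r'' 0 = r" "nats s2 ''A'' = nats s1 ''A''" using r1 by (simp_all add: frameD[OF p'(1)])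
          have "growth_stored n {r} {} (set_nat ''X'' r 1 s2)"
            using p'(2) p(2) r(2) by (auto simp: growth_stored_def set_simps r2)
          then show ?thesis using post p'(3) p(3) by (simp add: r2 algebra_simps)
        qed
        by (simp_all add: rowsD[OF rows1])
      then show ?thesis by simp
    qed
    by (auto simp: set_simps rws less_Suc_eq)
  then show "wp clear_growth ?Q t s" by (simp add: clear_growth_def)
qed

definition arborescence_program :: com where
  "arborescence_program = Seq contraction_phase (Seq clear_growth grow_loop)"

lemma arborescence_program_writes [simp]:
  "nwr arborescence_program = nwr step \<union> {''i'', ''j'', ''c'', ''X'', ''A'', ''f''}"
  "rwr arborescence_program = rwr step"
  by (auto simp: arborescence_program_def)

lemma wp_arborescence_program:
  assumes rows: "rows n s" and r: "nats s ''r'' 0 = r" "r < n" and nonneg: "\<forall>u<n. \<forall>v<n. 0 \<le> w u v"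
    and w: "\<forall>u<n. \<forall>v<n. reals s ''w'' (v * n + u) = w u v"
    and post: "\<And>d s' F. frame arborescence_program s s' \<Longrightarrow> d \<le> t + 2500 * (n + 1) ^ 2 \<Longrightarrow>
      optimal_branching n w r F \<Longrightarrow> \<forall>u<n. \<forall>v<n. nats s' ''A'' (u * n + v) = (if (u, v) \<in> F then 1 else 0) \<Longrightarrow> Q d s'"
  shows "wp arborescence_program Q t s"
proof (rule wp_frame)
  let ?Q = "\<lambda>d s'. frame arborescence_program s s' \<longrightarrow> Q d s'"
  have n: "0 < n" using r by simp
  have "wp contraction_phase (wp clear_growth (wp grow_loop ?Q)) t s"
  proof (rule wp_contraction_phase[OF rows n nonneg w])
    fix d1 s1 assume fr1: "frame contraction_phase s s1" and fin: "finished n w s1"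
      and d1: "d1 \<le> t + 2000 * (n + 1) ^ 2"
    have rows1: "rows n s1" by (rule rows_cong[OF rows]) (simp_all add: frameD[OF fr1])
    have r1: "nats s1 ''r'' 0 = r" using r by (simp add: frameD[OF fr1])
    show "wp clear_growth (wp grow_loop ?Q) d1 s1"
    proof (rule wp_clear_growth[OF rows1 r1 r(2)])
      fix d2 s2 assume fr2: "frame clear_growth s1 s2" and d2: "d2 \<le> d1 + n * (n * 32 + 50) + 30"
        and gr: "growth_stored n {r} {} s2"
      have rows2: "rows n s2" by (rule rows_cong[OF rows1]) (simp_all add: frameD[OF fr2])
      have fin2: "finished n w s2" using fin by (simp add: finished_def frameD[OF fr2])
      show "wp grow_loop ?Q d2 s2"
      proof (rule wp_grow_loop[OF rows2 fin2 r(2) gr])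
        fix d3 s3 F assume d3: "d3 \<le> d2 + n * (n * 144 + 24) + 9" and F: "optimal_branching n w r F"
          and A: "growth_stored n {..<n} F s3"
        have "d3 \<le> t + 2500 * (n + 1) ^ 2"
          using d1 d2 d3 by (simp add: power2_eq_square algebra_simps)
        then show "?Q d3 s3" using post F A by (simp add: growth_stored_def)
      qed
    qed
  qed
  then show "wp arborescence_program ?Q t s" by (simp add: arborescence_program_def)
qed

text \<open>A missing link gets a weight exceeding the total cost of all links, so an optimal branching of the
  complete digraph uses links only.\<close>

lemma optimal_branching_min_spanning:
  assumes net: "sensor_network m G b" and M: "M = 2 * subdigraph_cost b G"
    and F: "optimal_branching m (\<lambda>u v. if (u, v) \<in> parcs G then b $$ (u, v) else M) r F"
  shows "min_spanning_out_branching G b r \<lparr> pverts = {0..<m}, parcs = F \<rparr>"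
proof -
  note G = sensor_networkD[OF net]
  let ?w = "\<lambda>u v. if (u, v) \<in> parcs G then b $$ (u, v) else M"
  let ?T = "\<lparr> pverts = {0..<m}, parcs = F \<rparr>"
  have V: "{0..<m} = {..<m}" by auto
  have br: "branching_on {..<m} r F" using F by (simp add: optimal_branching_def)
  then have r: "r < m" and Fm: "F \<subseteq> {..<m} \<times> {..<m}" by (auto simp: branching_on_def)
  then have fin: "finite F" using finite_subset by blast
  have eqG: "(\<Sum>(u, v)\<in>E. ?w u v) = (\<Sum>(u, v)\<in>E. b $$ (u, v))" if "E \<subseteq> parcs G" for E
    using that by (intro sum.cong) auto
  have le: "(\<Sum>(u, v)\<in>F. ?w u v) \<le> (\<Sum>(u, v)\<in>E. b $$ (u, v))"
    if E: "E \<subseteq> parcs G" "\<forall>v<m. (r, v) \<in> E\<^sup>*" for E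
  proof -
    have "E \<subseteq> {..<m} \<times> {..<m}" using E(1) G(2) V by auto
    then have "(\<Sum>(u, v)\<in>F. ?w u v) \<le> (\<Sum>(u, v)\<in>E. ?w u v)"
      using F E(2) unfolding optimal_branching_def by blast
    then show ?thesis by (simp only: eqG[OF E(1)])
  qed
  have cost0: "0 \<le> subdigraph_cost b G"
    unfolding subdigraph_cost_def using G(4) by (intro sum_nonneg) (auto intro: less_imp_le)
  have sub: "F \<subseteq> parcs G"
  proof (rule ccontr)
    assume "\<not> F \<subseteq> parcs G"
    then obtain u v where uv: "(u, v) \<in> F" "(u, v) \<notin> parcs G" by auto
    \<comment> \<open>An arc of a branching is no loop, so connectivity supplies a link of
      \<open>G\<close> and the total cost is positive. Only then does twice the total exceed the
      total, which is the cost of the competitor consisting of all links.\<close>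
    have "u \<noteq> v" using br uv(1) unfolding branching_on_def by (metis (mono_tags, lifting) case_prodD n_not_Suc_n)
    moreover have "(u, v) \<in> (parcs G)\<^sup>*" using G(6)[of u v] uv(1) Fm by auto
    ultimately obtain e where e: "e \<in> parcs G" by (auto elim: rtranclE)
    have "0 < (\<Sum>(i, j)\<in>parcs G. b $$ (i, j))"
      by (rule sum_pos) (use G(3,4) e in auto)
    then have pos: "0 < subdigraph_cost b G" by (simp add: subdigraph_cost_def)
    have "M = (\<Sum>(u, v)\<in>{(u, v)}. ?w u v)" using uv by simp
    also have "\<dots> \<le> (\<Sum>(u, v)\<in>F. ?w u v)"
      using uv fin cost0 less_imp_le[OF G(4)] by (intro sum_mono2) (auto simp: M)
    also have "\<dots> \<le> subdigraph_cost b G"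
      unfolding subdigraph_cost_def by (rule le) (use G(6) r in auto)
    finally show False using pos M by simp
  qed
  have "spanning_out_branching G r ?T"
    using br sub G V by (intro branching_on_spanning) auto
  moreover have "subdigraph_cost b ?T \<le> subdigraph_cost b T'" if T': "spanning_out_branching G r T'" for T'
    using le[of "parcs T'"] spanning_out_branching_reach[OF T'] G(1) eqG[OF sub]
    by (simp add: subdigraph_cost_def)
  ultimately show ?thesis
    unfolding min_spanning_out_branching_def is_arg_min_def by (meson not_less)
qed

section \<open>Two passes, on the network and on its reversal\<close>

definition networking_program :: com where
  "networking_program = Seq init_rows (Seq sum_links
     (Seq (RAssign ''M'' (NConst 0) (RAdd (RCell ''M'' (NConst 0)) (RCell ''M'' (NConst 0))))
     (Seq (load_weights False) (Seq arborescence_program (Seq (store_arcs False)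
     (Seq (load_weights True) (Seq arborescence_program (store_arcs True))))))))"

lemma index_less:
  fixes i j m :: nat
  assumes "i < m" "j < m"
  shows "i * m + j < m * m"
proof -
  have "i * m + j < Suc i * m" using assms(2) by simp
  also have "\<dots> \<le> m * m" using assms(1) by (intro mult_right_mono) auto
  finally show ?thesis .
qed

lemma rooted_input_cells:
  assumes "i < m" "j < m"
  shows "nats (rooted_input m G b r) ''link'' (i * m + j) = (if (i, j) \<in> parcs G then 1 else 0)"
    "reals (rooted_input m G b r) ''b'' (i * m + j) = b $$ (i, j)"
  using assms index_less[OF assms] by (auto simp: rooted_input_def network_input_def set_simps)

lemma min_branching_union_arcs:
  assumes Ti: "min_spanning_in_branching G b r \<lparr> pverts = {0..<m}, parcs = F\<inverse> \<rparr>"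
    and To: "min_spanning_out_branching G b r \<lparr> pverts = {0..<m}, parcs = F' \<rparr>"
    and F: "F \<subseteq> {..<m} \<times> {..<m}" "F' \<subseteq> {..<m} \<times> {..<m}"
    and W: "\<forall>u<m. \<forall>v<m. nats s ''W'' (u * m + v) = (if (v, u) \<in> F \<or> (u, v) \<in> F' then 1 else 0)"
  shows "min_branching_union m G b r (output_mat m s)"
proof -
  have carr: "output_mat m s \<in> carrier_mat m m" by (simp add: output_mat_def)
  have ent: "output_mat m s $$ (u, v) = (if (v, u) \<in> F \<or> (u, v) \<in> F' then 1 else 0)"
    if "u < m" "v < m" for u v
    using that W by (simp add: output_mat_def)
  have "elements_mat (output_mat m s) \<subseteq> {0, 1}"
  proof
    fix a assume "a \<in> elements_mat (output_mat m s)"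
    then obtain i j where "i < m" "j < m" "a = output_mat m s $$ (i, j)"
      using elements_matD[of a "output_mat m s"] carr by auto
    then show "a \<in> {0, 1}" using ent by simp
  qed
  with carr have "zero_one_mat m (output_mat m s)" by (simp add: zero_one_mat_def)
  moreover have "parcs (network_of m (output_mat m s)) = F\<inverse> \<union> F'"
    using F ent by (auto simp: network_of_def split: if_splits)
  then have "with_proj (network_of m (output_mat m s)) =
      union (with_proj \<lparr> pverts = {0..<m}, parcs = F\<inverse> \<rparr>) (with_proj \<lparr> pverts = {0..<m}, parcs = F' \<rparr>)"
    by (simp add: with_proj_def union_def network_of_def)
  ultimately show ?thesis unfolding min_branching_union_def using Ti To by blast
qed

lemma wp_networking_program:
  assumes net: "sensor_network m G b" and r: "r < m"
  shows "wp networking_program (\<lambda>t s. t \<le> 6000 * (m + 1) ^ 2 \<and> min_branching_union m G b r (output_mat m s))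
    0 (rooted_input m G b r)"
proof -
  note G = sensor_networkD[OF net]
  let ?s = "rooted_input m G b r"
  let ?Q = "\<lambda>t s. t \<le> 6000 * (m + 1) ^ 2 \<and> min_branching_union m G b r (output_mat m s)"
  \<comment> \<open>The total is doubled, rather than increased by one, because the machine language
    has no real constants.\<close>
  let ?M = "2 * subdigraph_cost b G"
  have in_m: "nats ?s ''m'' 0 = m" "nats ?s ''row'' 0 = 0" "nats ?s ''r'' 0 = r"
    "reals ?s ''M'' 0 = 0" "\<And>k. nats ?s ''W'' k = 0"
    by (simp_all add: rooted_input_def network_input_def set_simps)
  note cells = rooted_input_cells[of _ m _ G b r]
  have total: "(\<Sum>i<m. \<Sum>j<m. if nats ?s ''link'' (i * m + j) = 1 then reals ?s ''b'' (i * m + j) else 0)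
      = subdigraph_cost b G"
  proof -
    have "(\<Sum>i<m. \<Sum>j<m. if nats ?s ''link'' (i * m + j) = 1 then reals ?s ''b'' (i * m + j) else 0)
      = (\<Sum>i<m. \<Sum>j<m. if (i, j) \<in> parcs G then b $$ (i, j) else 0)"
      by (intro sum.cong refl) (simp add: cells)
    also have "\<dots> = (\<Sum>e\<in>{..<m} \<times> {..<m}. if e \<in> parcs G then b $$ e else 0)"
      unfolding sum.cartesian_product by (rule sum.cong) auto
    also have "\<dots> = (\<Sum>e\<in>({..<m} \<times> {..<m}) \<inter> parcs G. b $$ e)"
      by (simp add: sum.inter_restrict)
    also have "({..<m} \<times> {..<m}) \<inter> parcs G = parcs G" using G(2) by auto
    finally show ?thesis by (simp add: subdigraph_cost_def case_prod_unfold)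
  qed
  \<comment> \<open>\<open>w True\<close> is the weight function of the reversed network, which
    makes both passes instances of the single statement \<open>pass\<close>.\<close>
  define w where "w bk u v = (if bk then if (v, u) \<in> parcs G then b $$ (v, u) else ?M
     else if (u, v) \<in> parcs G then b $$ (u, v) else ?M)" for bk u v
  have w_load: "weight m s bk u v = w bk u v"
    if "nats s ''link'' = nats ?s ''link''" "reals s ''b'' = reals ?s ''b''" "reals s ''M'' 0 = ?M" "u < m" "v < m"
    for s bk u v
    using that by (cases bk) (simp_all add: weight_def w_def cells)
  have "0 \<le> subdigraph_cost b G"
    unfolding subdigraph_cost_def using G(4) by (intro sum_nonneg) (auto intro: less_imp_le)
  then have w0: "\<forall>u<m. \<forall>v<m. 0 \<le> w bk u v" for bk
    using less_imp_le[OF G(4)] by (auto simp: w_def)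
  have out: "min_spanning_out_branching G b r \<lparr> pverts = {0..<m}, parcs = F \<rparr>"
    if "optimal_branching m (w False) r F" for F
    by (rule optimal_branching_min_spanning[OF net refl]) (use that in \<open>simp add: w_def[abs_def]\<close>)
  have inb: "min_spanning_in_branching G b r \<lparr> pverts = {0..<m}, parcs = F\<inverse> \<rparr>"
    if F: "optimal_branching m (w True) r F" for F
  proof -
    have b: "b \<in> carrier_mat m m" using net by (simp add: sensor_network_def)
    have M: "?M = 2 * subdigraph_cost (transpose_mat b) (reverse G)"
      using subdigraph_cost_reverse[OF b G(2)] by simp
    have F0: "F \<subseteq> {..<m} \<times> {..<m}" using F by (simp add: optimal_branching_def branching_on_def)
    have weq: "w True u v = (if (u, v) \<in> parcs (reverse G) then transpose_mat b $$ (u, v) else ?M)" for u v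
      using b G(2) by (auto simp: w_def)
    have "w True = (\<lambda>u v. if (u, v) \<in> parcs (reverse G) then transpose_mat b $$ (u, v) else ?M)"
      using weq by blast
    then have "min_spanning_out_branching (reverse G) (transpose_mat b) r \<lparr> pverts = {0..<m}, parcs = F \<rparr>"
      using optimal_branching_min_spanning[OF sensor_network_reverse[OF net] M] F by simp
    moreover have "\<lparr> pverts = {0..<m}, parcs = F \<rparr> = reverse \<lparr> pverts = {0..<m}, parcs = F\<inverse> \<rparr>"
      by (simp add: reverse_def)
    ultimately show ?thesis using min_spanning_in_branching_reverse[OF net] by simp
  qed
  let ?P3 = "wp (Seq (load_weights True) (Seq arborescence_program (store_arcs True))) ?Q"
  let ?P2 = "wp (Seq (load_weights False) (Seq arborescence_program (store_arcs False))) ?P3"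
  let ?P1 = "wp (RAssign ''M'' (NConst 0) (RAdd (RCell ''M'' (NConst 0)) (RCell ''M'' (NConst 0)))) ?P2"
  have pass: "wp (Seq (load_weights bk) (Seq arborescence_program (store_arcs bk))) R t s"
    if s: "rows m s" "nats s ''r'' 0 = r" "nats s ''link'' = nats ?s ''link''" "reals s ''b'' = reals ?s ''b''"
      "reals s ''M'' 0 = ?M"
      and R: "\<And>d s' F. rows m s' \<Longrightarrow> nats s' ''r'' 0 = r \<Longrightarrow> nats s' ''link'' = nats ?s ''link'' \<Longrightarrow>
        reals s' ''b'' = reals ?s ''b'' \<Longrightarrow> reals s' ''M'' 0 = ?M \<Longrightarrow> d \<le> t + 2700 * (m + 1) ^ 2 \<Longrightarrow>
        optimal_branching m (w bk) r F \<Longrightarrow> \<forall>u<m. \<forall>v<m. nats s' ''W'' (u * m + v) =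
          (if (if bk then (v, u) else (u, v)) \<in> F then 1 else nats s ''W'' (u * m + v)) \<Longrightarrow> R d s'"
    for bk R t s
  proof -
    have "wp (load_weights bk) (wp arborescence_program (wp (store_arcs bk) R)) t s"
    proof (rule wp_load_weights[OF s(1)])
      fix d1 s1 assume fr1: "frame (load_weights bk) s s1" and d1: "d1 \<le> t + m * (m * 52 + 21) + 9"
        and w1: "\<forall>u<m. \<forall>v<m. reals s1 ''w'' (v * m + u) = weight m s bk u v"
      have rows1: "rows m s1" by (rule rows_cong[OF s(1)]) (simp_all add: frameD[OF fr1])
      have r1: "nats s1 ''r'' 0 = r" using s by (simp add: frameD[OF fr1])
      have w1': "\<forall>u<m. \<forall>v<m. reals s1 ''w'' (v * m + u) = w bk u v" using w1 w_load s by simp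
      show "wp arborescence_program (wp (store_arcs bk) R) d1 s1"
      proof (rule wp_arborescence_program[OF rows1 r1 r w0 w1'])
        fix d2 s2 F assume fr2: "frame arborescence_program s1 s2" and d2: "d2 \<le> d1 + 2500 * (m + 1) ^ 2"
          and F: "optimal_branching m (w bk) r F"
          and A: "\<forall>u<m. \<forall>v<m. nats s2 ''A'' (u * m + v) = (if (u, v) \<in> F then 1 else 0)"
        have rows2: "rows m s2" by (rule rows_cong[OF rows1]) (simp_all add: frameD[OF fr2])
        show "wp (store_arcs bk) R d2 s2"
        proof (rule wp_store_arcs[OF rows2])
          fix d3 s3 assume fr3: "frame (store_arcs bk) s2 s3" and d3: "d3 \<le> d2 + m * (m * 52 + 21) + 9"
            and W: "\<forall>u<m. \<forall>v<m. nats s3 ''W'' (u * m + v) =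
              (if nats s2 ''A'' (if bk then v * m + u else u * m + v) = 1 then 1 else nats s2 ''W'' (u * m + v))"
          have rows3: "rows m s3" by (rule rows_cong[OF rows2]) (simp_all add: frameD[OF fr3])
          show "R d3 s3"
          proof (rule R[OF rows3 _ _ _ _ _ F])
            show "nats s3 ''r'' 0 = r" "nats s3 ''link'' = nats ?s ''link''" "reals s3 ''b'' = reals ?s ''b''"
              "reals s3 ''M'' 0 = ?M"
              using s by (simp_all add: frameD[OF fr1] frameD[OF fr2] frameD[OF fr3])
            show "d3 \<le> t + 2700 * (m + 1) ^ 2"
              using d1 d2 d3 by (simp add: power2_eq_square algebra_simps)
            have W2: "nats s2 ''W'' = nats s ''W''" by (simp add: frameD[OF fr1] frameD[OF fr2])
            show "\<forall>u<m. \<forall>v<m. nats s3 ''W'' (u * m + v) =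
              (if (if bk then (v, u) else (u, v)) \<in> F then 1 else nats s ''W'' (u * m + v))"
              using W A by (cases bk) (simp_all add: W2)
          qed
        qed
      qed
    qed
    then show ?thesis by simp
  qed
  have "wp init_rows (wp sum_links ?P1) 0 ?s"
  proof (rule wp_init_rows[OF in_m(1,2)])
    fix d1 s1 assume fr1: "frame init_rows ?s s1" and rows1: "rows m s1" and d1: "d1 \<le> 0 + m * 40 + 40"
    have M1: "reals s1 ''M'' 0 = 0" using in_m by (simp add: frameD[OF fr1])
    show "wp sum_links ?P1 d1 s1"
    proof (rule wp_sum_links[OF rows1 M1])
      fix d2 s2 assume fr2: "frame sum_links s1 s2" and d2: "d2 \<le> d1 + m * (m * 52 + 21) + 9"
        and M2: "reals s2 ''M'' 0 = (\<Sum>i<m. \<Sum>j<m. if nats s1 ''link'' (i * m + j) = 1 then reals s1 ''b'' (i * m + j) else 0)"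
      have M2': "reals s2 ''M'' 0 = subdigraph_cost b G"
      proof -
        have "nats s1 ''link'' = nats ?s ''link''" "reals s1 ''b'' = reals ?s ''b''"
          by (simp_all add: frameD[OF fr1])
        then show ?thesis using M2 total by (simp only:)
      qed
      let ?s2 = "set_real ''M'' 0 ?M s2"
      have rows2: "rows m ?s2" by (rule rows_cong[OF rows1]) (simp_all add: frameD[OF fr2])
      have assign: "wp (RAssign ''M'' (NConst 0) (RAdd (RCell ''M'' (NConst 0)) (RCell ''M'' (NConst 0)))) R d2 s2"
        if "R (d2 + 7) ?s2" for R
        using that by (simp add: M2' eval_nat_numeral)
      show "?P1 d2 s2"
      proof (rule assign, rule pass[OF rows2])
        show "nats ?s2 ''r'' 0 = r" "nats ?s2 ''link'' = nats ?s ''link''" "reals ?s2 ''b'' = reals ?s ''b''"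
          "reals ?s2 ''M'' 0 = ?M"
          using in_m by (simp_all add: frameD[OF fr1] frameD[OF fr2] set_simps)
        fix d3 s3 F' assume s3: "rows m s3" "nats s3 ''r'' 0 = r" "nats s3 ''link'' = nats ?s ''link''"
          "reals s3 ''b'' = reals ?s ''b''" "reals s3 ''M'' 0 = ?M"
          and d3: "d3 \<le> d2 + 7 + 2700 * (m + 1) ^ 2" and F': "optimal_branching m (w False) r F'"
          and W3: "\<forall>u<m. \<forall>v<m. nats s3 ''W'' (u * m + v) =
          (if (if False then (v, u) else (u, v)) \<in> F' then 1 else nats ?s2 ''W'' (u * m + v))"
        show "?P3 d3 s3"
        proof (rule pass[OF s3])
          fix d4 F and s4 :: store assume d4: "d4 \<le> d3 + 2700 * (m + 1) ^ 2" and F: "optimal_branching m (w True) r F"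
            and W4: "\<forall>u<m. \<forall>v<m. nats s4 ''W'' (u * m + v) =
          (if (if True then (v, u) else (u, v)) \<in> F then 1 else nats s3 ''W'' (u * m + v))"
          have Fm: "F \<subseteq> {..<m} \<times> {..<m}" "F' \<subseteq> {..<m} \<times> {..<m}"
            using F F' by (simp_all add: optimal_branching_def branching_on_def)
          \<comment> \<open>Because \<open>W\<close> starts at 0, the two conditional updates amount
            to the indicator of the union.\<close>
          have W5: "\<forall>u<m. \<forall>v<m. nats s4 ''W'' (u * m + v) = (if (v, u) \<in> F \<or> (u, v) \<in> F' then 1 else 0)"
            using W3 W4 in_m(5) by (simp add: frameD[OF fr1] frameD[OF fr2])
          have "min_branching_union m G b r (output_mat m s4)"
            by (rule min_branching_union_arcs[OF inb[OF F] out[OF F'] Fm]) (use W5 in blast)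
          moreover have "d4 \<le> 6000 * (m + 1) ^ 2"
            using d1 d2 d3 d4 by (simp add: power2_eq_square algebra_simps)
          ultimately show "?Q d4 s4" by simp
        qed
      qed
    qed
  qed
  then show ?thesis by (simp add: networking_program_def)
qed

section \<open>The two algorithmic claims and the quadratic bound\<close>

lemma networking_program_computes:
  "computes_min_branching_union networking_program (\<lambda>m. 6000 * (m + 1) ^ 2)"
  unfolding computes_min_branching_union_def
proof (intro allI impI)
  fix m G b r assume net: "sensor_network m G b" and "r \<in> pverts G"
  then have "r < m" using sensor_networkD[OF net] by simp
  from wp_networking_program[OF net this]
  show "\<exists>t s. exec networking_program (rooted_input m G b r) t s \<and> t \<le> 6000 * (m + 1) ^ 2 \<and>
               min_branching_union m G b r (output_mat m s)"
    unfolding wp_def by auto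
qed

text \<open>Unset cells are 0, so an input without a root already designates sensor 0 as
  root.\<close>

lemma network_input_eq_rooted: "network_input m G b = rooted_input m G b 0"
  by (auto simp: rooted_input_def network_input_def set_nat_def fun_eq_iff)

lemma networking_program_approximates:
  "approximation_algorithm 2 networking_program (\<lambda>m. 6000 * (m + 1) ^ 2)"
  unfolding approximation_algorithm_def
proof (intro allI impI)
  fix m G b assume net: "sensor_network m G b"
  then have r: "0 \<in> pverts G" using sensor_networkD[OF net] by simp
  then show "\<exists>t s. exec networking_program (network_input m G b) t s \<and> t \<le> 6000 * (m + 1) ^ 2 \<and>
               feasible m G (output_mat m s) \<and>
               networking_cost m b (output_mat m s) \<le> 2 * optimal_cost m G b"
    using networking_program_computes net min_branching_union_2_approx[OF net r]
    unfolding computes_min_branching_union_def network_input_eq_rooted by blast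
qed

lemma time_bound: "(\<lambda>m. real (6000 * (m + 1) ^ 2)) \<in> O(\<lambda>m. real m ^ 2)"
proof (rule bigoI[where c = 24000])
  show "\<forall>\<^sub>F m in sequentially. norm (real (6000 * (m + 1) ^ 2)) \<le> 24000 * norm (real m ^ 2)"
  proof (rule eventually_sequentiallyI[of 1])
    fix m :: nat assume "1 \<le> m"
    \<comment> \<open>For \<open>m\<close> at least 1, \<open>m + 1\<close> is at most
      \<open>2 * m\<close>; squaring gives the factor 4 between 6000 and 24000.\<close>
    then have "(real m + 1) ^ 2 \<le> (2 * real m) ^ 2" by (intro power_mono) auto
    then show "norm (real (6000 * (m + 1) ^ 2)) \<le> 24000 * norm (real m ^ 2)"
      by (simp add: power_mult_distrib add.commute)
  qed
qed

theorem mainTheorem3: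
  shows
    "(\<forall>m G b r W. sensor_network m G b \<longrightarrow> r \<in> pverts G \<longrightarrow> min_branching_union m G b r W \<longrightarrow>
        feasible m G W \<and> networking_cost m b W \<le> 2 * optimal_cost m G b)
   \<and> (\<exists>P T. computes_min_branching_union P T \<and> (\<lambda>m. real (T m)) \<in> O(\<lambda>m. real m ^ 2))
   \<and> (\<exists>P T. approximation_algorithm 2 P T \<and> (\<lambda>m. real (T m)) \<in> O(\<lambda>m. real m ^ 2))"
  using min_branching_union_2_approx networking_program_computes networking_program_approximates time_bound
  by blast

end
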